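(* Let $m\ge5$ be a prime and let $k$ and $r$ be positive integers. Let $f_{m,k,r}(z)=\left(\eta(m^kz)^{m^k}/\eta(z)\right)^{r}$ and \[ w_{m,k,r}=\begin{cases}\frac{2m^k-m^{k-1}-1}{2}\,r, & k\text{ odd},\\[4pt] \frac{3m^k-2m^{k-1}-1}{2}\,r, & k\text{ even}.\end{cases} \] Then there exists a modular form $G_{m,k,r}(z)\in M_{w_{m,k,r}}(\mathrm{SL}_2(\mathbb{Z}))$ such that \[ f_{m,k,r}(z)\,|\,U_{m^k}\equiv G_{m,k,r}(z)\pmod{m^k}. \]
   Context: $q=e^{2\pi iz}$, $\eta(z)=q^{1/24}\prod_{n\ge1}(1-q^n)$ is Dedekind's eta function. For $f=\sum a(n)q^n$, $f|U_\ell=\sum a(\ell n)q^n$. $M_w(\mathrm{SL}_2(\mathbb{Z}))$ is the space of holomorphic modular forms of weight $w$ on $\mathrm{SL}_2(\mathbb{Z})$. Congruence modulo $m^k$ means coefficientwise congruence of $q$-expansions. *)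

theory Defs
  imports "HOL-Complex_Analysis.Complex_Analysis" "HOL-Number_Theory.Number_Theory"
begin

definition upper_half_plane :: "complex set" where
  "upper_half_plane = {z. Im z > 0}"

definition nome :: "complex \<Rightarrow> complex" where
  "nome z = exp (2 * of_real pi * \<i> * z)"

definition dedekind_eta :: "complex \<Rightarrow> complex" where
  "dedekind_eta z = exp (2 * of_real pi * \<i> * z / 24) * (\<Prod>n. 1 - nome z ^ Suc n)"

definition has_q_expansion :: "(complex \<Rightarrow> complex) \<Rightarrow> complex fps \<Rightarrow> bool" where
  "has_q_expansion f F \<longleftrightarrow>
     (\<forall>z\<in>upper_half_plane. (\<lambda>n. fps_nth F n * nome z ^ n) sums f z)"

(* Meaningful only if an expansion in nonnegative integral powers of q exists; it is
   then unique by has_q_expansion_unique below. *)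
definition q_expansion :: "(complex \<Rightarrow> complex) \<Rightarrow> complex fps" where
  "q_expansion f = (THE F. has_q_expansion f F)"

(* Having a q-expansion without negative powers is holomorphy at the cusp infinity, the
   only cusp of SL_2(Z). Values outside the upper half-plane are unconstrained. *)
definition modular_forms :: "int \<Rightarrow> (complex \<Rightarrow> complex) set" where
  "modular_forms w = {f.
     f holomorphic_on upper_half_plane \<and>
     (\<forall>a b c d :: int. a * d - b * c = 1 \<longrightarrow>
        (\<forall>z\<in>upper_half_plane.
           f ((of_int a * z + of_int b) / (of_int c * z + of_int d)) =
           (of_int c * z + of_int d) powi w * f z)) \<and>
     (\<exists>F. has_q_expansion f F)}"

definition U_op :: "nat \<Rightarrow> complex fps \<Rightarrow> complex fps" where
  "U_op l F = Abs_fps (\<lambda>n. fps_nth F (l * n))"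

(* Coefficientwise congruence in the integers; in particular both series are required to
   have integral coefficients. *)
definition fps_cong :: "nat \<Rightarrow> complex fps \<Rightarrow> complex fps \<Rightarrow> bool" where
  "fps_cong N F G \<longleftrightarrow>
     (\<forall>n. \<exists>a b :: int. fps_nth F n = of_int a \<and> fps_nth G n = of_int b \<and> [a = b] (mod int N))"

definition eta_quotient :: "nat \<Rightarrow> nat \<Rightarrow> nat \<Rightarrow> complex \<Rightarrow> complex" where
  "eta_quotient m k r z =
     (dedekind_eta (of_nat (m ^ k) * z) ^ (m ^ k) / dedekind_eta z) ^ r"

(* The division by 2 is exact for odd m, see weight_exact below. *)
definition weight :: "nat \<Rightarrow> nat \<Rightarrow> nat \<Rightarrow> int" where
  "weight m k r =
     (if odd k then (2 * int m ^ k - int m ^ (k - 1) - 1) div 2 * int r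
      else (3 * int m ^ k - 2 * int m ^ (k - 1) - 1) div 2 * int r)"

lemma weight_exact:
  assumes "odd m"
  shows "2 * weight m k r =
     (if odd k then (2 * int m ^ k - int m ^ (k - 1) - 1) * int r
      else (3 * int m ^ k - 2 * int m ^ (k - 1) - 1) * int r)"
proof -
  have "2 * ((2 * int m ^ k - int m ^ (k - 1) - 1) div 2) = 2 * int m ^ k - int m ^ (k - 1) - 1"
    by (rule dvd_mult_div_cancel) (use assms in simp)
  moreover have "2 * ((3 * int m ^ k - 2 * int m ^ (k - 1) - 1) div 2)
      = 3 * int m ^ k - 2 * int m ^ (k - 1) - 1"
    by (rule dvd_mult_div_cancel) (use assms in simp)
  ultimately show ?thesis
    by (simp only: weight_def if_distrib[of "(*) 2"] mult.assoc[symmetric])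
qed

lemma nome_surj:
  assumes "x \<noteq> 0" "norm x < 1"
  shows "\<exists>z\<in>upper_half_plane. nome z = x"
proof
  let ?z = "Ln x / (2 * of_real pi * \<i>)"
  show "nome ?z = x"
    using assms by (simp add: nome_def)
  have "Im ?z = - ln (norm x) / (2 * pi)"
    using assms by (simp add: Im_divide power2_eq_square)
  moreover have "ln (norm x) < 0"
    using assms by simp
  ultimately show "?z \<in> upper_half_plane"
    by (simp add: upper_half_plane_def divide_neg_pos)
qed

lemma has_q_expansion_unique:
  assumes "has_q_expansion f F" "has_q_expansion f G"
  shows "F = G"
proof (rule ccontr)
  assume "F \<noteq> G"
  define H where "H = F - G"
  define N where "N = subdegree H"
  have HN: "fps_nth H N \<noteq> 0"
    unfolding N_def by (rule nth_subdegree_nonzero) (use \<open>F \<noteq> G\<close> in \<open>simp add: H_def\<close>)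
  have "(\<lambda>n. fps_nth H (n + N) * x ^ n) sums 0" if x: "x \<noteq> 0" "norm x < 1" for x
  proof -
    obtain z where z: "z \<in> upper_half_plane" "nome z = x"
      using nome_surj[OF x] by blast
    have "(\<lambda>n. fps_nth F n * x ^ n - fps_nth G n * x ^ n) sums (f z - f z)"
      using assms z unfolding has_q_expansion_def by (intro sums_diff) auto
    hence "(\<lambda>n. fps_nth H n * x ^ n) sums 0"
      by (simp add: H_def algebra_simps)
    hence "(\<lambda>n. fps_nth H (n + N) * x ^ (n + N)) sums
             (0 - (\<Sum>n<N. fps_nth H n * x ^ n))"
      by (rule sums_split_initial_segment)
    moreover have "(\<Sum>n<N. fps_nth H n * x ^ n) = 0"
      by (rule sum.neutral) (auto simp: N_def)
    ultimately have "(\<lambda>n. fps_nth H (n + N) * x ^ (n + N)) sums 0"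
      by (simp only: diff_0_right)
    hence "(\<lambda>n. fps_nth H (n + N) * x ^ (n + N) * inverse (x ^ N)) sums (0 * inverse (x ^ N))"
      by (rule sums_mult2)
    moreover have "fps_nth H (n + N) * x ^ (n + N) * inverse (x ^ N) = fps_nth H (n + N) * x ^ n" for n
      using x by (simp add: power_add)
    ultimately show ?thesis
      by (simp only: mult_zero_left)
  qed
  hence "((\<lambda>_. 0) \<longlongrightarrow> fps_nth H (0 + N)) (at (0::complex))"
    by (intro powser_limit_0_strong[where s = 1 and a = "\<lambda>n. fps_nth H (n + N)"]) auto
  hence "fps_nth H (0 + N) = 0"
    by (rule LIM_unique[OF _ tendsto_const])
  with HN show False by simp
qed

end

theory Submission
  imports Defs
begin

text \<open>
  Let \<open>l = m\<^sup>k\<close>. Since \<open>(1 - q\<^sup>l\<^sup>n)\<^sup>l \<equiv> (1 - q\<^sup>n)\<^bsup>l l\<^esup>\<close> modulo \<open>m\<^sup>k\<close>, the eta quotient is congruent to the level one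
  form \<open>\<eta>\<^bsup>r(l l - 1)\<^esup>\<close>. The constant term of a weakly holomorphic form of weight 2 vanishes, and
  conversely a power series is congruent to a form of weight \<open>w\<close> if its product with every weakly
  holomorphic integral form \<open>g\<close> of weight \<open>2 - w\<close> has constant term divisible by \<open>m\<^sup>k\<close>. So it
  suffices that the constant term of \<open>\<eta>\<^bsup>r(l l - 1)\<^esup> g(q\<^sup>l)\<close> vanishes modulo \<open>m\<^sup>k\<close>.
  In very negative weight the operator \<open>q \<mapsto> q\<^sup>m\<close> is congruent to the Hecke operator \<open>T\<^sub>m\<close>; applying
  this to \<open>g \<eta>\<^bsup>2s\<^esup>\<close> and dividing by \<open>\<eta>\<^bsup>2sl\<^esup>\<close> makes \<open>g(q\<^sup>l)\<close> congruent to a level one form, of a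
  weight so small that the product with \<open>\<eta>\<^bsup>r(l l - 1)\<^esup>\<close> has weight at most 2. The weight is
  raised to 2 by a form congruent to 1, which also comes from a Hecke operator.
\<close>

subsection \<open>Partial fractions\<close>

text \<open>Everything is expressed in powers of eta^2 instead of eta: the weights are then
  integral, no branch of a square root has to be chosen, and the Jacobi symbols of the classical eta
  multiplier disappear. Series are therefore taken in q^(1/12). The polynomial
  \<open>eta_exponent\<close> merges the classical exponents for odd and even \<open>c\<close>, both
  of which agree with it modulo 12.

  The weight is shaped by a balance. Let l = m^k and e = r(l^2 - 1)/2. In weight v the Hecke
  operator, scaled to contain q -> q^m with coefficient 1, differs from that map by a multiple of
  m^(1-v); so g eta^(2s), of weight 2 - w + s, needs weight at most 1 - k. This bounds s from above.
  After division by eta^(2sl) the product has weight 2 + e - w - s(l - 1), which must not exceed 2.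
  This bounds s from below. Moreover m^(k-1) has to divide s, to make eta(lz)^(2s) congruent to
  eta(z)^(2sl) modulo m^k, and the missing weight must be a multiple of (m - 1)m^(k-1), the weight
  of the form congruent to 1. Here the parity of k enters, as m^k is m or 1 modulo 2(m - 1).\<close>

lemma cot_partial_fractions:
  fixes x :: complex
  assumes x: "x \<notin> \<int>"
  shows "(\<lambda>k. 2 * x / (x\<^sup>2 - of_nat (Suc k) ^ 2)) sums (of_real pi * cot (of_real pi * x) - 1 / x)"
proof -
  define f :: "nat \<Rightarrow> complex \<Rightarrow> complex" where
    "f = (\<lambda>k z. if k = 0 then of_real pi * z else 1 - z\<^sup>2 / of_nat k ^ 2)"
  define R where "R = norm x + 1"
  have holo: "f k holomorphic_on A" for k A
    by (cases "k = 0") (auto simp: f_def intro!: holomorphic_intros)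
  have lim: "(\<lambda>n. \<Prod>k<n. f k z) \<longlonglongrightarrow> sin (of_real pi * z)" for z
  proof -
    have "(\<Prod>k<Suc n. f k z) = of_real pi * z * (\<Prod>k=1..n. 1 - z^2 / of_nat k^2)" for n
    proof -
      have "{..<Suc n} = insert 0 {1..n}" by auto
      thus ?thesis by (auto simp: f_def)
    qed
    hence "(\<lambda>n. \<Prod>k<Suc n. f k z) \<longlonglongrightarrow> sin (of_real pi * z)"
      using sin_product_formula_complex[of z] by simp
    thus ?thesis by (rule LIMSEQ_imp_Suc)
  qed
  have "uniformly_convergent_on (cball 0 R) (\<lambda>N z. \<Sum>n<N. norm (f n z - 1))"
  proof (rule Weierstrass_m_test'_ev)
    show "\<forall>\<^sub>F n in sequentially. \<forall>z\<in>cball 0 R. norm (norm (f n z - 1)) \<le> R\<^sup>2 * (1 / real n ^ 2)"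
      using eventually_gt_at_top[of 0]
    proof eventually_elim
      case (elim n)
      thus ?case by (auto simp: f_def norm_divide norm_power intro!: divide_right_mono power_mono)
    qed
    show "summable (\<lambda>n. R\<^sup>2 * (1 / real n ^ 2))"
      by (intro summable_mult inverse_power_summable[of 2, unfolded inverse_eq_divide]) auto
  qed
  hence "uniformly_convergent_on (cball 0 R) (\<lambda>N z. \<Prod>n<N. f n z)"
    by (intro uniformly_convergent_on_prod' holomorphic_on_imp_continuous_on[OF holo]) auto
  then obtain P where P: "uniform_limit (cball 0 R) (\<lambda>N z. \<Prod>n<N. f n z) P sequentially"
    by (auto simp: uniformly_convergent_on_def)
  have P_eq: "P z = sin (of_real pi * z)" if "z \<in> cball 0 R" for z
    using LIMSEQ_unique[OF tendsto_uniform_limitI[OF P that] lim] .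
  have P': "uniform_limit (ball 0 R) (\<lambda>N z. \<Prod>n<N. f n z) (\<lambda>z. sin (of_real pi * z)) sequentially"
    using uniform_limit_on_subset[OF P, of "ball 0 R"] P_eq
    by (subst uniform_limit_cong'[where g = "\<lambda>N z. \<Prod>n<N. f n z" and i = P]) auto
  have nz: "sin (of_real pi * x) \<noteq> 0"
    using x by (auto simp: sin_eq_0 complex_is_Int_iff)
  \<comment> \<open>Logarithmic differentiation of the sine product; the factor with index 0
    contributes \<open>1 / x\<close> and is split off afterwards.\<close>
  have "(\<lambda>k. deriv (f k) x / f k x) sums (deriv (\<lambda>z. sin (of_real pi * z)) x / sin (of_real pi * x))"
    by (rule logderiv_prodinf_complex_uniform_limit[OF P' holo nz]) (auto simp: R_def)
  hence "(\<lambda>k. deriv (f (Suc k)) x / f (Suc k) x) sums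
          (deriv (\<lambda>z. sin (of_real pi * z)) x / sin (of_real pi * x) - deriv (f 0) x / f 0 x)"
    by (subst sums_Suc_iff) simp
  moreover have "deriv (\<lambda>z. sin (of_real pi * z)) x = of_real pi * cos (of_real pi * x)"
    by (rule DERIV_imp_deriv) (auto intro!: derivative_eq_intros)
  moreover have "deriv (f 0) x / f 0 x = 1 / x"
  proof -
    have "deriv (f 0) x = of_real pi"
      unfolding f_def by (rule DERIV_imp_deriv) (auto intro!: derivative_eq_intros)
    thus ?thesis by (simp add: f_def)
  qed
  moreover have "deriv (f (Suc k)) x / f (Suc k) x = 2 * x / (x\<^sup>2 - of_nat (Suc k) ^ 2)" for k
  proof -
    define a :: complex where "a = of_nat (Suc k)"
    have a: "a \<noteq> 0" by (simp add: a_def del: of_nat_Suc)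
    have fk: "f (Suc k) = (\<lambda>z. 1 - z\<^sup>2 / a\<^sup>2)"
      by (simp add: f_def a_def)
    have "deriv (f (Suc k)) x = - 2 * x / a\<^sup>2"
      unfolding fk using a by (intro DERIV_imp_deriv) (auto intro!: derivative_eq_intros simp: field_simps power2_eq_square)
    moreover have "x\<^sup>2 \<noteq> a\<^sup>2"
      unfolding a_def using x by (metis Ints_minus Ints_of_nat power2_eq_iff)
    ultimately have "deriv (f (Suc k)) x / f (Suc k) x = 2 * x / (x\<^sup>2 - a\<^sup>2)"
      using a by (simp add: fk divide_simps) (simp add: algebra_simps)
    thus ?thesis by (simp add: a_def)
  qed
  ultimately show ?thesis
    by (simp add: cot_def)
qed

text \<open>Termwise differentiation of the cotangent series, legitimate because the partial sums
  converge uniformly on a unit disc around \<open>w\<close> with the integers removed.\<close>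

lemma csc_squared_partial_fractions:
  fixes w :: complex
  assumes w: "w \<notin> \<int>"
  shows "(\<lambda>k. 1 / (w + of_nat (Suc k))\<^sup>2 + 1 / (w - of_nat (Suc k))\<^sup>2) sums
           ((of_real pi / sin (of_real pi * w))\<^sup>2 - 1 / w\<^sup>2)"
proof -
  define R where "R = norm w + 1"
  define g :: "nat \<Rightarrow> complex \<Rightarrow> complex" where "g = (\<lambda>k x. 2 * x / (x\<^sup>2 - of_nat (Suc k) ^ 2))"
  define G :: "complex \<Rightarrow> complex" where "G = (\<lambda>x. of_real pi * cot (of_real pi * x) - 1 / x)"
  define A where "A = ball w 1 - (\<int>::complex set)"
  have A: "open A" "w \<in> A"
    using w by (auto simp: A_def intro!: open_Diff closed_Ints)
  have nz: "x\<^sup>2 - of_nat (Suc k) ^ 2 \<noteq> 0" "x + of_nat (Suc k) \<noteq> 0" "x - of_nat (Suc k) \<noteq> 0" if "x \<in> A" for x k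
  proof -
    have "x \<notin> \<int>" using that by (auto simp: A_def)
    thus a: "x + of_nat (Suc k) \<noteq> 0" "x - of_nat (Suc k) \<noteq> 0"
      by (metis Ints_minus Ints_of_nat add_eq_0_iff2, metis Ints_of_nat eq_iff_diff_eq_0)
    show "x\<^sup>2 - of_nat (Suc k) ^ 2 \<noteq> 0"
      using a by (simp add: power2_eq_square square_diff_square_factored del: of_nat_Suc)
  qed
  have "uniformly_convergent_on A (\<lambda>N x. \<Sum>n<N. g n x)"
  proof (rule Weierstrass_m_test'_ev)
    have "filterlim (\<lambda>n. real (Suc n) ^ 2) at_top sequentially" by real_asymp
    hence "eventually (\<lambda>n. real (Suc n) ^ 2 > 2 * R\<^sup>2) sequentially"
      by (simp add: filterlim_at_top_dense)
    thus "\<forall>\<^sub>F n in sequentially. \<forall>x\<in>A. norm (g n x) \<le> 4 * R * (1 / real (Suc n) ^ 2)"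
    proof eventually_elim
      case (elim n)
      show ?case
      proof
        fix x assume "x \<in> A"
        hence "dist w x < 1" by (auto simp: A_def)
        hence xR: "norm x \<le> R"
          unfolding R_def by norm
        have "norm x ^ 2 \<le> R ^ 2" using xR by (intro power_mono) auto
        moreover have "norm (of_nat (Suc n) ^ 2 :: complex) - norm (x\<^sup>2) \<le> norm (x\<^sup>2 - of_nat (Suc n) ^ 2)"
          by (metis norm_minus_commute norm_triangle_ineq2)
        ultimately have *: "norm (x\<^sup>2 - of_nat (Suc n) ^ 2) \<ge> real (Suc n) ^ 2 / 2"
          using elim by (simp add: norm_power del: of_nat_Suc)
        have "norm (g n x) = 2 * norm x / norm (x\<^sup>2 - of_nat (Suc n) ^ 2)"
          by (simp add: g_def norm_divide norm_mult)
        also have "\<dots> \<le> 2 * R / (real (Suc n) ^ 2 / 2)"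
          by (intro frac_le * mult_left_mono xR) (use xR in \<open>auto simp: R_def\<close>)
        finally show "norm (g n x) \<le> 4 * R * (1 / real (Suc n) ^ 2)" by simp
      qed
    qed
    have "summable (\<lambda>n. 1 / real n ^ 2)"
      using inverse_power_summable[of 2, where 'a = real] by (simp add: inverse_eq_divide)
    hence "summable (\<lambda>n. 1 / real (Suc n) ^ 2)"
      by (subst summable_Suc_iff)
    thus "summable (\<lambda>n. 4 * R * (1 / real (Suc n) ^ 2))"
      by (rule summable_mult)
  qed
  then obtain H where H: "uniform_limit A (\<lambda>N x. \<Sum>n<N. g n x) H sequentially"
    by (auto simp: uniformly_convergent_on_def)
  have "H x = G x" if "x \<in> A" for x
    using LIMSEQ_unique[OF tendsto_uniform_limitI[OF H that]] cot_partial_fractions[of x] that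
    by (auto simp: A_def G_def g_def sums_def)
  hence G: "uniform_limit A (\<lambda>N x. \<Sum>n<N. g n x) G sequentially"
    using H by (subst uniform_limit_cong'[where g = "\<lambda>N x. \<Sum>n<N. g n x" and i = H]) auto
  have gd: "(g k has_field_derivative - (1 / (x + of_nat (Suc k))\<^sup>2 + 1 / (x - of_nat (Suc k))\<^sup>2)) (at x)"
    if "x \<in> A" for k x
  proof -
    define a :: complex where "a = of_nat (Suc k)"
    have n: "x\<^sup>2 - a\<^sup>2 \<noteq> 0" "x + a \<noteq> 0" "x - a \<noteq> 0" using nz[OF that, of k] by (simp_all add: a_def)
    have eq: "x\<^sup>2 - a\<^sup>2 = (x + a) * (x - a)" by (simp add: power2_eq_square algebra_simps)
    have "((\<lambda>x. 2 * x / (x\<^sup>2 - a\<^sup>2)) has_field_derivative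
       (2 * (x\<^sup>2 - a\<^sup>2) - 2 * x * (2 * x)) / ((x\<^sup>2 - a\<^sup>2) * (x\<^sup>2 - a\<^sup>2))) (at x)"
      using n by (auto intro!: derivative_eq_intros)
    also have "(2 * (x\<^sup>2 - a\<^sup>2) - 2 * x * (2 * x)) / ((x\<^sup>2 - a\<^sup>2) * (x\<^sup>2 - a\<^sup>2)) = 
      - (1 / (x + a)\<^sup>2 + 1 / (x - a)\<^sup>2)"
      using n(2,3) unfolding eq by (simp add: divide_simps) (simp add: power2_eq_square algebra_simps)
    finally show ?thesis by (simp add: g_def a_def)
  qed
  have "((\<lambda>n. deriv (\<lambda>x. \<Sum>k<n. g k x) w) \<longlongrightarrow> deriv G w) sequentially"
  proof (rule deriv_complex_uniform_limit[OF G _ _ A])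
    have "(\<lambda>x. \<Sum>k<n. g k x) holomorphic_on A" for n
      using nz by (auto simp: g_def simp del: of_nat_Suc intro!: holomorphic_intros)
    thus "\<forall>\<^sub>F n in sequentially. (\<lambda>x. \<Sum>k<n. g k x) holomorphic_on A" by simp
  qed auto
  moreover have "deriv (\<lambda>x. \<Sum>k<n. g k x) w = (\<Sum>k<n. - (1 / (w + of_nat (Suc k))\<^sup>2 + 1 / (w - of_nat (Suc k))\<^sup>2))" for n
    by (intro DERIV_imp_deriv DERIV_sum gd A)
  moreover have "deriv G w = - ((of_real pi / sin (of_real pi * w))\<^sup>2 - 1 / w\<^sup>2)"
  proof -
    have s: "sin (of_real pi * w) \<noteq> 0" using w by (auto simp: sin_eq_0 complex_is_Int_iff)
    have w0: "w \<noteq> 0" using w by auto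
    have "((\<lambda>x. cot (of_real pi * x)) has_field_derivative - inverse ((sin (of_real pi * w))\<^sup>2) * of_real pi) (at w)"
      by (rule DERIV_chain2[where f = cot and g = "\<lambda>x. of_real pi * x", OF DERIV_cot[OF s]])
         (auto intro!: derivative_eq_intros)
    moreover have "((\<lambda>x. 1 / x) has_field_derivative - (1 / w\<^sup>2)) (at w)"
      using w0 by (auto intro!: derivative_eq_intros simp: power2_eq_square)
    ultimately have "(G has_field_derivative
        of_real pi * (- inverse ((sin (of_real pi * w))\<^sup>2) * of_real pi) - - (1 / w\<^sup>2)) (at w)"
      unfolding G_def by (intro DERIV_diff DERIV_cmult)
    thus ?thesis
      by (simp add: DERIV_imp_deriv power_divide field_simps power2_eq_square)
  qed
  ultimately have "(\<lambda>k. - (1 / (w + of_nat (Suc k))\<^sup>2 + 1 / (w - of_nat (Suc k))\<^sup>2)) sums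
      (- ((of_real pi / sin (of_real pi * w))\<^sup>2 - 1 / w\<^sup>2))"
    unfolding sums_def by simp
  from sums_minus[OF this] show ?thesis by (simp only: minus_minus)
qed

lemma double_sums_swap:
  fixes f :: "nat \<Rightarrow> nat \<Rightarrow> complex"
  assumes f1: "\<And>m. summable (\<lambda>n. norm (f m n))"
    and f2: "summable (\<lambda>m. \<Sum>n. norm (f m n))"
  obtains s where "(\<lambda>m. \<Sum>n. f m n) sums s" "(\<lambda>n. \<Sum>m. f m n) sums s"
proof -
  let ?f = "\<lambda>(m, n). f m n"
  have suminf_eq: "infsum g UNIV = suminf g" if "summable (\<lambda>n. norm (g n))" for g :: "nat \<Rightarrow> 'b :: banach"
    using norm_summable_imp_summable_on[OF that] by (metis has_sum_imp_sums has_sum_infsum sums_unique)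
  have abs: "Infinite_Sum.abs_summable_on ?f (UNIV \<times> UNIV)"
    unfolding Infinite_Sum.abs_summable_on_Sigma_iff
  proof (intro conjI ballI)
    fix m :: nat
    have "summable (\<lambda>n. norm (norm (f m n)))" using f1[of m] by simp
    from norm_summable_imp_summable_on[OF this]
    show "(\<lambda>n. norm (?f (m, n))) summable_on UNIV" by simp
  next
    have eq: "infsum (\<lambda>y. norm (f x y)) UNIV = (\<Sum>n. norm (f x n))" for x
      using f1[of x] by (intro suminf_eq) auto
    have nn: "0 \<le> (\<Sum>n. norm (f x n))" for x
      using f1[of x] by (intro suminf_nonneg) auto
    have "summable (\<lambda>m. norm (\<Sum>n. norm (f m n)))" using f2 nn by simp
    from norm_summable_imp_summable_on[OF this]
    show "(\<lambda>x. norm (infsum (\<lambda>y. norm (?f (x, y))) UNIV)) summable_on UNIV"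
      using nn by (simp add: eq)
  qed
  then obtain s where s: "(?f has_sum s) (UNIV \<times> UNIV)"
    using abs_summable_summable summable_on_def by blast
  have s': "((\<lambda>(n, m). f m n) has_sum s) (UNIV \<times> UNIV)"
    using iffD1[OF has_sum_swap s] by (simp add: case_prod_unfold)
  have abs': "Infinite_Sum.abs_summable_on (\<lambda>(n, m). f m n) (UNIV \<times> UNIV)"
    using summable_on_swap[of "\<lambda>x. norm (?f x)" UNIV UNIV] abs
    by (simp add: case_prod_unfold)
  have f3: "summable (\<lambda>m. norm (f m n))" for n
  proof -
    have "Infinite_Sum.abs_summable_on (\<lambda>m. f m n) UNIV"
      using abs' unfolding Infinite_Sum.abs_summable_on_Sigma_iff by simp
    thus ?thesis by (rule summable_on_imp_summable)
  qed
  have "((\<lambda>m. \<Sum>n. f m n) has_sum s) UNIV"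
  proof (rule has_sum_SigmaD[OF s])
    show "((\<lambda>n. ?f (m, n)) has_sum (\<Sum>n. f m n)) UNIV" for m
      using norm_summable_imp_has_sum[OF f1[of m] summable_sums[OF summable_norm_cancel[OF f1[of m]]]] by simp
  qed
  moreover have "((\<lambda>n. \<Sum>m. f m n) has_sum s) UNIV"
  proof (rule has_sum_SigmaD[OF s'])
    show "((\<lambda>m. (\<lambda>(n, m). f m n) (n, m)) has_sum (\<Sum>m. f m n)) UNIV" for n
      using norm_summable_imp_has_sum[OF f3[of n] summable_sums[OF summable_norm_cancel[OF f3[of n]]]] by simp
  qed
  ultimately show ?thesis
    by (intro that has_sum_imp_sums)
qed

lemma tendsto_inverse_add_of_nat: "(\<lambda>n. 1 / (a + of_nat n :: complex)) \<longlonglongrightarrow> 0"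
  by (rule tendsto_divide_0[OF tendsto_const], rule tendsto_add_filterlim_at_infinity[OF tendsto_const],
      rule tendsto_of_nat)

lemma exp_over_sin:
  assumes "w \<notin> \<int>"
  shows "(of_real pi / sin (of_real pi * w))\<^sup>2 = - 4 * of_real pi ^ 2 * (nome w / (1 - nome w)\<^sup>2)"
proof -
  define y where "y = exp (\<i> * (of_real pi * w))"
  have y: "y \<noteq> 0" by (simp add: y_def)
  have s: "sin (of_real pi * w) \<noteq> 0" using assms by (auto simp: sin_eq_0 complex_is_Int_iff)
  have sy: "sin (of_real pi * w) = (y - inverse y) / (2 * \<i>)"
    by (simp add: y_def sin_exp_eq exp_minus)
  have ny: "nome w = y\<^sup>2"
    by (simp add: nome_def y_def power2_eq_square mult_ac flip: exp_add)
  have "y\<^sup>2 \<noteq> 1" using s y unfolding sy by (auto simp: field_simps power2_eq_square)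
  thus ?thesis using y unfolding sy ny
    by (simp add: divide_simps) (simp add: power2_eq_square algebra_simps)
qed

lemma cot_exp:
  assumes "sin w \<noteq> 0"
  shows "cot w = \<i> * (1 + exp (- (2 * \<i> * w))) / (1 - exp (- (2 * \<i> * w)))"
proof -
  define y where "y = exp (\<i> * w)"
  have y: "y \<noteq> 0" by (simp add: y_def)
  have sy: "sin w = (y - inverse y) / (2 * \<i>)" by (simp add: y_def sin_exp_eq exp_minus)
  have cy: "cos w = (y + inverse y) / 2" by (simp add: y_def cos_exp_eq exp_minus)
  have ey: "exp (- (2 * \<i> * w)) = inverse (y\<^sup>2)"
    by (simp add: y_def power2_eq_square exp_minus mult_ac flip: exp_add)
  have "y\<^sup>2 \<noteq> 1" using assms y unfolding sy by (auto simp: field_simps power2_eq_square)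
  thus ?thesis using y unfolding cot_def sy cy ey
    by (simp add: divide_simps) (simp add: power2_eq_square algebra_simps)
qed

lemma in_upper_half_plane [simp]: "z \<in> upper_half_plane \<longleftrightarrow> Im z > 0"
  by (simp add: upper_half_plane_def)

lemma Im_pos_not_Int: "Im w \<noteq> 0 \<Longrightarrow> w \<notin> \<int>"
  by (auto elim!: Ints_cases)

text \<open>The points (n + 1/2)/z run to infinity in the lower half-plane, where exp(-2 pi i w)
  tends to 0. This nonzero limit is what keeps the weight 2 Eisenstein series from being
  modular.\<close>

lemma tendsto_cot_lower:
  assumes z: "Im z > 0"
  shows "(\<lambda>n. cot (of_real pi * (of_real (real n + 1/2) / z))) \<longlonglongrightarrow> \<i>"
proof -
  define w where "w = (\<lambda>n. of_real (real n + 1/2) / z)"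
  define c where "c = Im z / (norm z)\<^sup>2"
  have "z \<noteq> 0" using z by auto
  hence c: "c > 0" using z by (auto simp: c_def)
  have imw: "Im (w n) = - (real n + 1/2) * c" for n
  proof -
    have "Im (of_real a / z) = - a * c" for a
      by (simp add: c_def Im_divide cmod_power2)
    from this[of "real n + 1/2"] show ?thesis unfolding w_def .
  qed
  define E where "E = (\<lambda>n. exp (- (2 * \<i> * (of_real pi * w n))))"
  have "E \<longlonglongrightarrow> 0"
  proof (rule tendsto_norm_zero_cancel)
    have "norm (E n) = exp (- (2 * pi * (real n + 1/2) * c))" for n
    proof -
      have "norm (E n) = exp (2 * (pi * Im (w n)))" by (simp add: E_def)
      also have "2 * (pi * Im (w n)) = - (2 * pi * (real n + 1/2) * c)"
        unfolding imw by (simp only: mult_minus_left mult_minus_right mult.assoc)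
      finally show ?thesis .
    qed
    moreover have "(\<lambda>n. exp (- (2 * pi * (real n + 1/2) * c))) \<longlonglongrightarrow> 0"
      using c by real_asymp
    ultimately show "(\<lambda>n. norm (E n)) \<longlonglongrightarrow> 0" by simp
  qed
  hence "(\<lambda>n. \<i> * (1 + E n) / (1 - E n)) \<longlonglongrightarrow> \<i> * (1 + 0) / (1 - 0)"
    by (intro tendsto_intros) auto
  moreover have "cot (of_real pi * w n) = \<i> * (1 + E n) / (1 - E n)" for n
  proof -
    have "Im (w n) \<noteq> 0" using c by (auto simp: imw)
    hence "sin (of_real pi * w n) \<noteq> 0"
      using Im_pos_not_Int[of "w n"] by (auto simp: sin_eq_0 complex_is_Int_iff)
    thus ?thesis by (subst cot_exp) (auto simp: E_def)
  qed
  ultimately show ?thesis by (simp add: w_def)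
qed

text \<open>The first bound comes from the imaginary part, the second from the imaginary part after
  division by \<open>z\<close>, which exchanges the roles of \<open>m\<close> and
  \<open>x\<close>.\<close>

lemma norm_lower_bounds:
  assumes z: "Im z > 0" and m: "m \<ge> 0"
  shows "norm (of_real m * z + of_real x) \<ge> Im z * m"
    and "norm (of_real m * z + of_real x) \<ge> Im z / norm z * \<bar>x\<bar>"
proof -
  show "norm (of_real m * z + of_real x) \<ge> Im z * m"
    using abs_Im_le_cmod[of "of_real m * z + of_real x"] z m by (simp add: mult.commute)
  have z0: "z \<noteq> 0" using z by auto
  have "norm (of_real m + of_real x / z) * norm z = norm (of_real m * z + of_real x)"
  proof -
    have "(of_real m + of_real x / z) * z = of_real m * z + of_real x"
      using z0 by (simp add: field_simps)
    thus ?thesis by (metis norm_mult)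
  qed
  moreover have "norm (of_real m + of_real x / z) \<ge> \<bar>x\<bar> * (Im z / (norm z)\<^sup>2)"
    using abs_Im_le_cmod[of "of_real m + of_real x / z"] z
    by (simp add: Im_divide cmod_power2 abs_mult)
  ultimately have "norm (of_real m * z + of_real x) \<ge> \<bar>x\<bar> * (Im z / (norm z)\<^sup>2) * norm z"
    by (metis mult_right_mono norm_ge_zero)
  thus "norm (of_real m * z + of_real x) \<ge> Im z / norm z * \<bar>x\<bar>"
    using z0 by (simp add: power2_eq_square field_simps)
qed

subsection \<open>The transformation of the weight 2 Eisenstein series\<close>

text \<open>This is the generating function of the divisor sum sigma_1, so that the weight 2
  Eisenstein series is \<open>1 - 24 * lambert_sum q\<close>.\<close>

definition lambert_sum :: "complex \<Rightarrow> complex" where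
  "lambert_sum q = (\<Sum>n. q ^ Suc n / (1 - q ^ Suc n)\<^sup>2)"

lemma Im_pos_nonzero: "Im z > 0 \<Longrightarrow> z \<noteq> 0"
  by auto

lemma Im_minus_inverse_pos:
  assumes "Im z > 0"
  shows "Im (- 1 / z) > 0"
proof -
  have "Im (- 1 / z) = Im z / (norm z)\<^sup>2"
    by (simp add: Im_divide cmod_power2)
  moreover have "z \<noteq> 0" using assms by auto
  ultimately show ?thesis using assms by (simp del: minus_divide_left)
qed

text \<open>The comparison term equals 1/(y^2 - 1/4), so the difference has a denominator of degree
  four in \<open>y\<close>. Bounding two of its factors through \<open>M\<close> and two through
  \<open>N\<close> gives summability in both indices.\<close>

lemma eisenstein_term_bound:
  fixes z :: complex and m n :: nat
  assumes z: "Im z > 0" and s: "s = 1 \<or> s = -1"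
  defines "M \<equiv> real (Suc m)" and "N \<equiv> real (Suc n)"
  defines "y \<equiv> of_real M * z + of_real (s * N)"
  shows "norm (1 / y\<^sup>2 - (1 / (y - 1/2) - 1 / (y + 1/2))) \<le>
           1 / (2 * ((Im z)\<^sup>2 / norm z)\<^sup>2) * (1 / M\<^sup>2) * (1 / N\<^sup>2)"
proof -
  define k where "k = Im z / norm z"
  have z0: "z \<noteq> 0" using z by auto
  have k: "k > 0" using z z0 by (simp add: k_def)
  have M: "M > 0" and N: "N \<ge> 1" by (auto simp: M_def N_def)
  have ge: "norm (of_real M * z + of_real x) \<ge> Im z * M"
       "norm (of_real M * z + of_real x) \<ge> k * \<bar>x\<bar>" for x
    using norm_lower_bounds[OF z, of M x] M by (auto simp: k_def)
  have IM: "Im z * M > 0" using z M by simp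
  have y1: "y - 1/2 = of_real M * z + of_real (s * N - 1/2)"
    and y2: "y + 1/2 = of_real M * z + of_real (s * N + 1/2)"
    by (simp_all add: y_def)
  have b1: "norm y \<ge> Im z * M" unfolding y_def by (rule ge)
  have b2: "norm y \<ge> k * N" using ge(2)[of "s * N"] s N by (auto simp: y_def abs_mult)
  have b3: "norm (y - 1/2) \<ge> Im z * M" unfolding y1 by (rule ge)
  have b4: "norm (y + 1/2) \<ge> k * (N / 2)"
  proof -
    have "N / 2 \<le> \<bar>s * N + 1/2\<bar>" using s N by auto
    hence "k * (N / 2) \<le> k * \<bar>s * N + 1/2\<bar>" using k by (intro mult_left_mono) auto
    also have "\<dots> \<le> norm (y + 1/2)" unfolding y2 by (rule ge)
    finally show ?thesis .
  qed
  have b5: "norm (y + 1/2) \<ge> Im z * M" unfolding y2 by (rule ge)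
  have nz: "y \<noteq> 0" "y - 1/2 \<noteq> 0" "y + 1/2 \<noteq> 0"
    using b1 b3 b5 IM by (metis norm_zero not_less)+
  have "1 / y\<^sup>2 - (1 / (y - 1/2) - 1 / (y + 1/2)) = - (1/4) / ((y * y) * ((y - 1/2) * (y + 1/2)))"
  proof -
    have "1 / (y - 1/2) - 1 / (y + 1/2) = 1 / ((y - 1/2) * (y + 1/2))"
      using nz(2,3) by (subst diff_frac_eq) auto
    moreover have "1 / (y * y) - 1 / ((y - 1/2) * (y + 1/2)) = ((y - 1/2) * (y + 1/2) - y * y) / ((y * y) * ((y - 1/2) * (y + 1/2)))"
      using nz by (subst diff_frac_eq) auto
    moreover have "(y - 1/2) * (y + 1/2) - y * y = - (1/4)" by (simp add: algebra_simps)
    ultimately show ?thesis by (simp add: power2_eq_square)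
  qed
  hence "norm (1 / y\<^sup>2 - (1 / (y - 1/2) - 1 / (y + 1/2))) =
      (1/4) / ((norm y * norm y) * (norm (y - 1/2) * norm (y + 1/2)))"
    by (simp add: norm_divide norm_mult)
  also have "\<dots> \<le> (1/4) / (((Im z * M) * (k * N)) * ((Im z * M) * (k * (N / 2))))"
  proof (intro divide_left_mono mult_mono)
    have "norm y > 0" "norm (y - 1/2) > 0" "norm (y + 1/2) > 0" using nz by auto
    thus "0 < (norm y * norm y * (norm (y - 1 / 2) * norm (y + 1 / 2))) * (Im z * M * (k * N) * (Im z * M * (k * (N / 2))))"
      using IM k N by (auto intro!: mult_pos_pos)
  qed (use IM k N b1 b2 b3 b4 in auto)
  also have "\<dots> = 1 / (2 * ((Im z)\<^sup>2 / norm z)\<^sup>2) * (1 / M\<^sup>2) * (1 / N\<^sup>2)"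
    by (simp add: k_def power2_eq_square)
  finally show ?thesis .
qed

lemma summable_inverse_squares_Suc: "summable (\<lambda>n. 1 / (real (Suc n))\<^sup>2)"
  using inverse_squares_sums by (auto simp: sums_iff add_ac)

lemma nome_power: "nome z ^ n = nome (of_nat n * z)"
  by (simp add: nome_def mult_ac flip: exp_of_nat_mult)

lemma norm_nome: "norm (nome z) = exp (- 2 * pi * Im z)"
  by (simp add: nome_def)

text \<open>\<open>exp_over_sin\<close> turns each squared cosecant into a term of the Lambert
  series; the subtracted terms add up to zeta(2)/z^2.\<close>

lemma sums_lambert_sum_aux:
  assumes z: "Im z > 0"
    and s: "(\<lambda>m. (of_real pi / sin (of_real pi * (of_nat (Suc m) * z)))\<^sup>2 - 1 / (of_nat (Suc m) * z)\<^sup>2) sums s"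
  shows "s = - 4 * of_real pi ^ 2 * lambert_sum (nome z) - of_real pi ^ 2 / (6 * z\<^sup>2)"
proof -
  have "(\<lambda>n. complex_of_real (1 / (real n + 1)\<^sup>2)) sums complex_of_real (pi\<^sup>2 / 6)"
    using inverse_squares_sums by (intro sums_of_real) (simp add: add_ac)
  hence "(\<lambda>n. complex_of_real (1 / (real n + 1)\<^sup>2) / z\<^sup>2) sums (complex_of_real (pi\<^sup>2 / 6) / z\<^sup>2)"
    by (rule sums_divide)
  hence *: "(\<lambda>n. 1 / (of_nat (Suc n) * z)\<^sup>2) sums (of_real pi ^ 2 / (6 * z\<^sup>2))"
    by (simp add: power_mult_distrib add_ac)
  have ni: "of_nat (Suc m) * z \<notin> \<int>" for m
    by (rule Im_pos_not_Int) (use z in \<open>simp del: of_nat_Suc\<close>)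
  from sums_add[OF s *]
  have "(\<lambda>m. (of_real pi / sin (of_real pi * (of_nat (Suc m) * z)))\<^sup>2) sums (s + of_real pi ^ 2 / (6 * z\<^sup>2))"
    by simp
  also have "(\<lambda>m. (of_real pi / sin (of_real pi * (of_nat (Suc m) * z)))\<^sup>2) =
      (\<lambda>m. - 4 * of_real pi ^ 2 * (nome z ^ Suc m / (1 - nome z ^ Suc m)\<^sup>2))"
    by (intro ext) (simp only: exp_over_sin[OF ni] nome_power)
  finally have "(\<lambda>m. (- 4 * of_real pi ^ 2 * (nome z ^ Suc m / (1 - nome z ^ Suc m)\<^sup>2)) * inverse (- 4 * of_real pi ^ 2)) sums
      ((s + of_real pi ^ 2 / (6 * z\<^sup>2)) * inverse (- 4 * of_real pi ^ 2))"
    by (rule sums_mult2)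
  moreover have "(- 4 * of_real pi ^ 2 * x) * inverse (- 4 * of_real pi ^ 2) = x" for x :: complex
    by simp
  ultimately have "(\<lambda>m. nome z ^ Suc m / (1 - nome z ^ Suc m)\<^sup>2) sums
      ((s + of_real pi ^ 2 / (6 * z\<^sup>2)) * inverse (- 4 * of_real pi ^ 2))"
    by (simp only:)
  hence "lambert_sum (nome z) = (s + of_real pi ^ 2 / (6 * z\<^sup>2)) * inverse (- 4 * of_real pi ^ 2)"
    unfolding lambert_sum_def by (rule sums_unique[symmetric])
  hence "- 4 * of_real pi ^ 2 * lambert_sum (nome z) = s + of_real pi ^ 2 / (6 * z\<^sup>2)"
    by simp
  thus ?thesis by (simp add: algebra_simps)
qed

text \<open>
  The double series \<open>\<Sum> 1/(mz + n)\<^sup>2 + 1/(mz - n)\<^sup>2\<close> converges only conditionally.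
  Subtracting the telescoping terms \<open>1/((mz + n)\<^sup>2 - 1/4) + 1/((mz - n)\<^sup>2 - 1/4)\<close> makes
  it absolutely convergent; the two orders of summation of the telescoping part differ by
  \<open>\<pi>\<i>/z\<close>.
\<close>

lemma lambert_sum_transformation:
  assumes z: "Im z > 0"
  shows "- 4 * of_real pi ^ 2 * lambert_sum (nome z) - of_real pi ^ 2 / (6 * z\<^sup>2) -
         (- 4 * of_real pi ^ 2 * lambert_sum (nome (- 1 / z)) / z\<^sup>2 - of_real pi ^ 2 / 6) = of_real pi * \<i> / z"
proof -
  have z0: "z \<noteq> 0" using z by auto
  define M :: "nat \<Rightarrow> complex" where "M = (\<lambda>m. of_nat (Suc m))"
  define b where "b = (\<lambda>m n. 1 / (M m * z + M n)\<^sup>2 + 1 / (M m * z - M n)\<^sup>2)"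
  define v where "v = (\<lambda>m x. 1 / (M m * z + x) - 1 / (M m * z - x))"
  \<comment> \<open>The comparison terms of both signs together, arranged as a difference in
    \<open>n\<close> so that they telescope.\<close>
  define c where "c = (\<lambda>m n. v m (of_nat n + 1/2) - v m (of_nat (Suc n) + 1/2))"
  define d where "d = (\<lambda>m n. b m n - c m n)"
  define K where "K = ((Im z)\<^sup>2 / norm z)\<^sup>2"
  have M0: "M m \<noteq> 0" for m by (simp add: M_def del: of_nat_Suc)
  have ImM: "Im (M m * z) > 0" for m using z by (simp add: M_def del: of_nat_Suc)
  have nzM: "M m * z + of_real x \<noteq> 0" "M m * z - of_real x \<noteq> 0" for m x
    using ImM[of m] by (metis Im_complex_of_real add.right_neutral add_eq_0_iff2 less_irrefl neg_equal_0_iff_equal plus_complex.sel(2) zero_complex.sel(2),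
     metis Im_complex_of_real eq_iff_diff_eq_0 less_irrefl)
  have d_bound: "norm (d m n) \<le> 1 / K * (1 / (real (Suc m))\<^sup>2) * (1 / (real (Suc n))\<^sup>2)" for m n
  proof -
    define y1 where "y1 = of_real (real (Suc m)) * z + of_real (1 * real (Suc n))"
    define y2 where "y2 = of_real (real (Suc m)) * z + of_real (-1 * real (Suc n))"
    have "d m n = (1 / y1\<^sup>2 - (1 / (y1 - 1/2) - 1 / (y1 + 1/2))) + (1 / y2\<^sup>2 - (1 / (y2 - 1/2) - 1 / (y2 + 1/2)))"
      by (simp add: d_def b_def c_def v_def y1_def y2_def M_def algebra_simps)
    also have "norm \<dots> \<le> norm (1 / y1\<^sup>2 - (1 / (y1 - 1/2) - 1 / (y1 + 1/2))) + norm (1 / y2\<^sup>2 - (1 / (y2 - 1/2) - 1 / (y2 + 1/2)))"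
      by (rule norm_triangle_ineq)
    also have "\<dots> \<le> 1 / (2 * K) * (1 / (real (Suc m))\<^sup>2) * (1 / (real (Suc n))\<^sup>2) + 1 / (2 * K) * (1 / (real (Suc m))\<^sup>2) * (1 / (real (Suc n))\<^sup>2)"
      unfolding K_def y1_def y2_def by (intro add_mono eisenstein_term_bound z) auto
    finally show ?thesis by simp
  qed
  note sq = summable_inverse_squares_Suc
  have d1: "summable (\<lambda>n. norm (d m n))" for m
    by (rule summable_comparison_test'[OF summable_mult[OF sq], of 0 _ "1 / K * (1 / (real (Suc m))\<^sup>2)"])
       (use d_bound in auto)
  have d2: "summable (\<lambda>m. \<Sum>n. norm (d m n))"
  proof (rule summable_comparison_test'[of "\<lambda>m. 1 / K * (\<Sum>n. 1 / (real (Suc n))\<^sup>2) * (1 / (real (Suc m))\<^sup>2)" 0])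
    show "summable (\<lambda>m. 1 / K * (\<Sum>n. 1 / (real (Suc n))\<^sup>2) * (1 / (real (Suc m))\<^sup>2))"
      by (intro summable_mult sq)
    fix m
    have "(\<Sum>n. norm (d m n)) \<le> (\<Sum>n. 1 / K * (1 / (real (Suc m))\<^sup>2) * (1 / (real (Suc n))\<^sup>2))"
      by (intro suminf_le d_bound d1 summable_mult sq)
    also have "\<dots> = 1 / K * (1 / (real (Suc m))\<^sup>2) * (\<Sum>n. (1 / (real (Suc n))\<^sup>2))"
      by (rule suminf_mult[OF sq])
    finally show "norm (\<Sum>n. norm (d m n)) \<le> 1 / K * (\<Sum>n. 1 / (real (Suc n))\<^sup>2) * (1 / (real (Suc m))\<^sup>2)"
      using suminf_nonneg[OF d1[of m]] by (simp add: mult_ac)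
  qed
  from double_sums_swap[OF d1 d2] obtain s where
    s: "(\<lambda>m. \<Sum>n. d m n) sums s" "(\<lambda>n. \<Sum>m. d m n) sums s" .

  \<comment> \<open>The sum of \<open>v m x\<close> over all \<open>m\<close>, evaluated by the
    cotangent series at \<open>x / z\<close>.\<close>
  define V where "V = (\<lambda>x. (of_real pi * cot (of_real pi * (x / z)) - z / x) / z)"
  have v_alt: "v m x = 2 * x / (x\<^sup>2 - (M m * z)\<^sup>2)" if "M m * z + x \<noteq> 0" "M m * z - x \<noteq> 0" for m x
  proof -
    have "v m x = (- 2 * x) / ((M m * z + x) * (M m * z - x))"
      unfolding v_def using that by (subst diff_frac_eq) auto
    also have "(M m * z + x) * (M m * z - x) = - (x\<^sup>2 - (M m * z)\<^sup>2)"
      by (simp add: power2_eq_square algebra_simps)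
    finally show ?thesis by (simp only: minus_mult_left[symmetric] divide_minus_left divide_minus_right minus_minus)
  qed
  have V_sums: "(\<lambda>m. v m (of_real x)) sums V (of_real x)" if x: "x > 0" for x
  proof -
    define w where "w = of_real x / z"
    have "Im w \<noteq> 0" using z z0 x by (simp add: w_def Im_divide)
    hence "(\<lambda>k. 2 * w / (w\<^sup>2 - of_nat (Suc k) ^ 2)) sums (of_real pi * cot (of_real pi * w) - 1 / w)"
      by (intro cot_partial_fractions Im_pos_not_Int)
    hence "(\<lambda>k. 2 * w / (w\<^sup>2 - of_nat (Suc k) ^ 2) / z) sums ((of_real pi * cot (of_real pi * w) - 1 / w) / z)"
      by (rule sums_divide)
    moreover have "2 * w / (w\<^sup>2 - of_nat (Suc k) ^ 2) / z = v k (of_real x)" for k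
    proof -
      have "w\<^sup>2 - of_nat (Suc k) ^ 2 = ((of_real x)\<^sup>2 - (M k * z)\<^sup>2) / z\<^sup>2"
        using z0 by (simp add: w_def M_def power_mult_distrib field_simps del: of_nat_Suc)
      thus ?thesis
        using z0 by (subst v_alt[OF nzM]) (simp add: w_def power2_eq_square)
    qed
    ultimately show ?thesis by (simp add: V_def w_def)
  qed
  have c_sums_n: "(\<lambda>n. c m n) sums v m (1/2)" for m
  proof -
    have "(\<lambda>n. v m (of_nat n + 1/2)) \<longlonglongrightarrow> 0 - 0"
      unfolding v_def
    proof (intro tendsto_diff)
      show "(\<lambda>n. 1 / (M m * z + (of_nat n + 1 / 2))) \<longlonglongrightarrow> 0"
        using tendsto_inverse_add_of_nat[of "M m * z + 1/2"] by (simp add: add_ac)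
      show "(\<lambda>n. 1 / (M m * z - (of_nat n + 1 / 2))) \<longlonglongrightarrow> 0"
        using tendsto_minus[OF tendsto_inverse_add_of_nat[of "1/2 - M m * z"]]
        by (simp add: algebra_simps flip: divide_minus_right)
    qed
    hence "(\<lambda>n. v m (of_nat n + 1/2) - v m (of_nat (Suc n) + 1/2)) sums (v m (of_nat 0 + 1/2) - 0)"
      by (intro telescope_sums') simp
    thus ?thesis by (simp add: c_def)
  qed
  have c_sums_m: "(\<lambda>m. c m n) sums (V (of_nat n + 1/2) - V (of_nat (Suc n) + 1/2))" for n
    using sums_diff[OF V_sums[of "real n + 1/2"] V_sums[of "real (Suc n) + 1/2"]]
    by (simp add: c_def)
  \<comment> \<open>When \<open>m\<close> is summed first, the telescoping sum over \<open>n\<close>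
    loses this limit; in the other order the boundary term at infinity is 0.\<close>
  have V_lim: "(\<lambda>n. V (of_nat n + 1/2)) \<longlonglongrightarrow> of_real pi * \<i> / z"
  proof -
    have "(\<lambda>n. z / (of_nat n + 1/2)) \<longlonglongrightarrow> 0"
      using tendsto_mult[OF tendsto_const tendsto_inverse_add_of_nat[of "1/2"], of z] by (simp add: add_ac)
    hence "(\<lambda>n. (of_real pi * cot (of_real pi * (of_real (real n + 1/2) / z)) - z / (of_nat n + 1/2)) / z)
        \<longlonglongrightarrow> (of_real pi * \<i> - 0) / z"
      using z0 by (intro tendsto_intros tendsto_cot_lower[OF z]) auto
    thus ?thesis by (simp add: V_def)
  qed
  have b_sums_n: "(\<lambda>n. b m n) sums ((of_real pi / sin (of_real pi * (M m * z)))\<^sup>2 - 1 / (M m * z)\<^sup>2)" for m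
    unfolding b_def M_def
    by (intro csc_squared_partial_fractions Im_pos_not_Int) (use z in \<open>simp del: of_nat_Suc\<close>)
  define z' where "z' = - 1 / z"
  have z': "Im z' > 0" unfolding z'_def using z by (rule Im_minus_inverse_pos)
  \<comment> \<open>Up to the factor \<open>z\<^sup>2\<close>, the term \<open>b m n\<close> at
    \<open>z\<close> is the term with \<open>m\<close> and \<open>n\<close> exchanged at
    \<open>- 1 / z\<close>. So this inner sum is again a cosecant series.\<close>
  have b_sums_m: "(\<lambda>m. b m n) sums (((of_real pi / sin (of_real pi * (M n * z')))\<^sup>2 - 1 / (M n * z')\<^sup>2) / z\<^sup>2)" for n
  proof -
    have "(\<lambda>m. (1 / (M n * z' + M m)\<^sup>2 + 1 / (M n * z' - M m)\<^sup>2) / z\<^sup>2) sums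
        (((of_real pi / sin (of_real pi * (M n * z')))\<^sup>2 - 1 / (M n * z')\<^sup>2) / z\<^sup>2)"
      unfolding M_def
      by (intro sums_divide csc_squared_partial_fractions Im_pos_not_Int) (use z' in \<open>simp del: of_nat_Suc\<close>)
    moreover have "(1 / (M n * z' + M m)\<^sup>2 + 1 / (M n * z' - M m)\<^sup>2) / z\<^sup>2 = b m n" for m
    proof -
      have "(M n * z' + M m)\<^sup>2 * z\<^sup>2 = (M m * z - M n)\<^sup>2" "(M n * z' - M m)\<^sup>2 * z\<^sup>2 = (M m * z + M n)\<^sup>2"
        unfolding power_mult_distrib[symmetric] using z0
        by (simp_all add: z'_def ring_distribs, simp_all add: power2_eq_square algebra_simps)
      thus ?thesis by (simp add: b_def add_divide_distrib)
    qed
    ultimately show ?thesis by simp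
  qed
  have "(\<lambda>m. suminf (b m) - v m (1/2)) sums s"
  proof -
    have "suminf (d m) = suminf (b m) - v m (1/2)" for m
      unfolding d_def using sums_diff[OF b_sums_n c_sums_n, of m m] b_sums_n[of m] by (simp add: sums_iff)
    thus ?thesis using s(1) by simp
  qed
  moreover have "(\<lambda>m. v m (1/2)) sums V (1/2)"
    using V_sums[of "1/2"] by simp
  ultimately have "(\<lambda>m. suminf (b m) - v m (1/2) + v m (1/2)) sums (s + V (1/2))"
    by (rule sums_add)
  hence 1: "(\<lambda>m. suminf (b m)) sums (s + V (1/2))" by simp
  have "(\<lambda>n. suminf (\<lambda>m. b m n) - (V (of_nat n + 1/2) - V (of_nat (Suc n) + 1/2))) sums s"
  proof -
    have "(\<Sum>m. d m n) = suminf (\<lambda>m. b m n) - (V (of_nat n + 1/2) - V (of_nat (Suc n) + 1/2))" for n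
      unfolding d_def using sums_diff[OF b_sums_m c_sums_m, of n n] b_sums_m[of n] by (simp add: sums_iff)
    thus ?thesis using s(2) by simp
  qed
  moreover have "(\<lambda>n. V (of_nat n + 1/2) - V (of_nat (Suc n) + 1/2)) sums (V (of_nat 0 + 1/2) - of_real pi * \<i> / z)"
    by (rule telescope_sums'[OF V_lim])
  ultimately have "(\<lambda>n. suminf (\<lambda>m. b m n) - (V (of_nat n + 1/2) - V (of_nat (Suc n) + 1/2)) + (V (of_nat n + 1/2) - V (of_nat (Suc n) + 1/2)))
      sums (s + (V (of_nat 0 + 1/2) - of_real pi * \<i> / z))"
    by (rule sums_add)
  hence 2: "(\<lambda>n. suminf (\<lambda>m. b m n)) sums (s + (V (1/2) - of_real pi * \<i> / z))" by simp
  have 3: "s + V (1/2) = - 4 * of_real pi ^ 2 * lambert_sum (nome z) - of_real pi ^ 2 / (6 * z\<^sup>2)"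
  proof (rule sums_lambert_sum_aux[OF z])
    show "(\<lambda>m. (of_real pi / sin (of_real pi * (of_nat (Suc m) * z)))\<^sup>2 - 1 / (of_nat (Suc m) * z)\<^sup>2) sums (s + V (1/2))"
      using 1 b_sums_n by (simp add: sums_iff M_def)
  qed
  have "(\<lambda>n. suminf (\<lambda>m. b m n) * z\<^sup>2) sums ((s + (V (1/2) - of_real pi * \<i> / z)) * z\<^sup>2)"
    using 2 by (rule sums_mult2)
  moreover have "suminf (\<lambda>m. b m n) * z\<^sup>2 = (of_real pi / sin (of_real pi * (M n * z')))\<^sup>2 - 1 / (M n * z')\<^sup>2" for n
    using b_sums_m[of n] z0 by (simp add: sums_iff)
  ultimately have 4: "(s + (V (1/2) - of_real pi * \<i> / z)) * z\<^sup>2 =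
        - 4 * of_real pi ^ 2 * lambert_sum (nome z') - of_real pi ^ 2 / (6 * z'\<^sup>2)"
    by (intro sums_lambert_sum_aux[OF z']) (simp add: M_def)
  have "s + (V (1/2) - of_real pi * \<i> / z) = (- 4 * of_real pi ^ 2 * lambert_sum (nome z') - of_real pi ^ 2 / (6 * z'\<^sup>2)) / z\<^sup>2"
    using 4 z0 by (simp add: field_simps)
  also have "\<dots> = - 4 * of_real pi ^ 2 * lambert_sum (nome z') / z\<^sup>2 - of_real pi ^ 2 / 6"
    using z0 by (simp add: z'_def power_divide diff_divide_distrib)
  finally have 5: "s + (V (1/2) - of_real pi * \<i> / z) = \<dots>" .
  show ?thesis
    unfolding 3[symmetric] 5[symmetric, unfolded z'_def] by simp
qed

subsection \<open>Euler's function and the square of the eta function\<close>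

definition euler_fun :: "complex \<Rightarrow> complex" where
  "euler_fun q = (\<Prod>n. 1 - q ^ Suc n)"

lemma convergent_prod_euler: "norm q < 1 \<Longrightarrow> convergent_prod (\<lambda>n. 1 - q ^ Suc n)" for q :: complex
  by (intro abs_convergent_prod_imp_convergent_prod summable_imp_abs_convergent_prod)
     (simp add: norm_power norm_mult summable_mult summable_geometric)

lemma power_Suc_neq_1: "norm q < 1 \<Longrightarrow> q ^ Suc n \<noteq> 1" for q :: complex
  by (metis less_irrefl nat.simps(3) norm_ge_zero norm_one norm_power power_less_one_iff zero_less_Suc)

lemma euler_fun_nonzero: "norm q < 1 \<Longrightarrow> euler_fun q \<noteq> 0"
  unfolding euler_fun_def
  by (intro prodinf_nonzero convergent_prod_euler) (use power_Suc_neq_1 in auto)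

lemma euler_fun_uniform_limit:
  assumes "r < 1"
  shows "uniform_limit (ball 0 r) (\<lambda>N q. \<Prod>n<N. 1 - q ^ Suc n) euler_fun sequentially"
proof (cases "r > 0")
  case True
  have "uniformly_convergent_on (cball 0 r) (\<lambda>N q::complex. \<Prod>n<N. 1 - q ^ Suc n)"
  proof (rule uniformly_convergent_on_prod')
    show "uniformly_convergent_on (cball 0 r) (\<lambda>N q::complex. \<Sum>n<N. norm (1 - q ^ Suc n - 1))"
    proof (rule Weierstrass_m_test'_ev)
      show "\<forall>\<^sub>F n in sequentially. \<forall>q\<in>cball 0 r. norm (norm (1 - q ^ Suc n - 1 :: complex)) \<le> r ^ Suc n"
        using True by (intro always_eventually allI ballI) (auto simp: norm_power norm_mult intro!: mult_mono power_mono)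
      show "summable (\<lambda>n. r ^ Suc n)"
        using assms True by (simp add: summable_mult)
    qed
  qed (auto intro!: continuous_intros)
  then obtain P where P: "uniform_limit (cball 0 r) (\<lambda>N q::complex. \<Prod>n<N. 1 - q ^ Suc n) P sequentially"
    by (auto simp: uniformly_convergent_on_def)
  have "P q = euler_fun q" if "q \<in> ball 0 r" for q
  proof -
    have "(\<lambda>N. \<Prod>n<N. 1 - q ^ Suc n) \<longlonglongrightarrow> P q"
      using that by (intro tendsto_uniform_limitI[OF P]) auto
    moreover have "(\<lambda>N. \<Prod>n\<le>N. 1 - q ^ Suc n) \<longlonglongrightarrow> euler_fun q"
      unfolding euler_fun_def
      by (intro convergent_prod_LIMSEQ convergent_prod_euler) (use that assms in auto)
    hence "(\<lambda>N. \<Prod>n<N. 1 - q ^ Suc n) \<longlonglongrightarrow> euler_fun q"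
      by (simp only: LIMSEQ_lessThan_iff_atMost)
    ultimately show ?thesis by (rule LIMSEQ_unique)
  qed
  thus ?thesis
    using uniform_limit_on_subset[OF P, of "ball 0 r"]
    by (subst uniform_limit_cong'[where g = "\<lambda>N q. \<Prod>n<N. 1 - q ^ Suc n" and i = P]) auto
qed (simp add: ball_empty)

lemma holomorphic_euler_fun: "euler_fun holomorphic_on ball 0 1"
proof (rule holomorphic_uniform_sequence[where f = "\<lambda>N q. \<Prod>n<N. 1 - q ^ Suc n"])
  fix x :: complex assume "x \<in> ball 0 1"
  then obtain d where d: "d > 0" "cball x d \<subseteq> ball 0 1"
    by (metis open_ball open_contains_cball_eq)
  define r where "r = (norm x + 1) / 2"
  have x: "norm x < r" "r < 1" using \<open>x \<in> ball 0 1\<close> by (auto simp: r_def)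
  have "cball x ((r - norm x) / 2) \<subseteq> ball 0 r"
  proof
    fix y assume "y \<in> cball x ((r - norm x) / 2)"
    hence "norm (y - x) \<le> (r - norm x) / 2" by (simp add: dist_norm norm_minus_commute)
    moreover have "norm y \<le> norm x + norm (y - x)" using norm_triangle_ineq[of x "y - x"] by simp
    ultimately have "norm y < r" using x by argo
    thus "y \<in> ball 0 r" by simp
  qed
  moreover have "cball x ((r - norm x) / 2) \<subseteq> ball 0 1"
    using calculation x by (meson dual_order.trans subset_ball less_imp_le)
  ultimately show "\<exists>d>0. cball x d \<subseteq> ball 0 1 \<and>
       uniform_limit (cball x d) (\<lambda>N q. \<Prod>n<N. 1 - q ^ Suc n) euler_fun sequentially"
    using x uniform_limit_on_subset[OF euler_fun_uniform_limit[OF x(2)]]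
    by (intro exI[of _ "(r - norm x) / 2"]) auto
qed (auto intro!: holomorphic_intros)

lemma geometric_sums_Suc: "norm x < 1 \<Longrightarrow> (\<lambda>m. x ^ Suc m) sums (x / (1 - x))"
  for x :: "'a :: real_normed_field"
  using sums_mult[OF geometric_sums[of x], of x] by simp

text \<open>Both series are the double sum of n q^(n m) over positive n and m, taken in the two
  orders.\<close>

lemma lambert_sum_alt:
  assumes q: "norm q < 1"
  shows "(\<lambda>n. of_nat (Suc n) * q ^ Suc n / (1 - q ^ Suc n)) sums lambert_sum q"
proof -
  define f where "f = (\<lambda>n m. of_nat (Suc n) * (q ^ Suc n) ^ Suc m)"
  have qn: "norm (q ^ Suc n) < 1" for n
    using q by (simp add: norm_power power_less_one_iff del: power_Suc)
  have qn': "norm (q ^ Suc n) \<le> norm q" for n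
  proof -
    have "norm q * norm q ^ n \<le> norm q * 1" using q by (intro mult_left_mono power_le_one) auto
    thus ?thesis by (simp add: norm_mult norm_power)
  qed
  have f_sums: "(\<lambda>m. f n m) sums (of_nat (Suc n) * (q ^ Suc n / (1 - q ^ Suc n)))" for n
    unfolding f_def by (rule sums_mult[OF geometric_sums_Suc[OF qn]])
  have norm_f: "norm (f n m) = real (Suc n) * norm (q ^ Suc n) ^ Suc m" for n m
    unfolding f_def by (simp only: norm_mult norm_power norm_of_nat)
  have nf_sums: "(\<lambda>m. norm (f n m)) sums (real (Suc n) * (norm (q ^ Suc n) / (1 - norm (q ^ Suc n))))" for n
    unfolding norm_f by (rule sums_mult[OF geometric_sums_Suc]) (use qn in simp)
  have "summable (\<lambda>n. \<Sum>m. norm (f n m))"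
  proof (rule summable_comparison_test'[where N = 0 and g = "\<lambda>n. real (Suc n) * norm q ^ n * (norm q / (1 - norm q))"])
    show "summable (\<lambda>n. real (Suc n) * norm q ^ n * (norm q / (1 - norm q)))"
      by (rule summable_mult2[OF sums_summable[OF geometric_deriv_sums]]) (use q in simp)
    fix n :: nat
    have eq: "(\<Sum>m. norm (f n m)) = real (Suc n) * (norm (q ^ Suc n) / (1 - norm (q ^ Suc n)))"
      by (rule sums_unique[symmetric, OF nf_sums])
    have "norm (\<Sum>m. norm (f n m)) = real (Suc n) * (norm (q ^ Suc n) / (1 - norm (q ^ Suc n)))"
      unfolding eq real_norm_def using qn[of n] by (intro abs_of_nonneg mult_nonneg_nonneg divide_nonneg_nonneg) auto
    also have "\<dots> \<le> real (Suc n) * (norm (q ^ Suc n) / (1 - norm q))"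
      using q qn'[of n] qn[of n] by (intro mult_left_mono divide_left_mono mult_pos_pos) auto
    also have "\<dots> = real (Suc n) * norm q ^ n * (norm q / (1 - norm q))"
      by (simp add: norm_power norm_mult)
    finally show "norm (\<Sum>m. norm (f n m)) \<le> real (Suc n) * norm q ^ n * (norm q / (1 - norm q))" .
  qed
  from double_sums_swap[OF sums_summable[OF nf_sums] this] obtain s where
    s: "(\<lambda>n. \<Sum>m. f n m) sums s" "(\<lambda>m. \<Sum>n. f n m) sums s" .
  have "(\<Sum>n. f n m) = q ^ Suc m / (1 - q ^ Suc m)\<^sup>2" for m
  proof -
    have "(\<lambda>n. of_nat (Suc n) * (q ^ Suc m) ^ n * q ^ Suc m) sums (1 / (1 - q ^ Suc m)\<^sup>2 * q ^ Suc m)"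
      by (intro sums_mult2 geometric_deriv_sums qn)
    moreover have "of_nat (Suc n) * (q ^ Suc m) ^ n * q ^ Suc m = f n m" for n
    proof -
      have "(q ^ Suc m) ^ n * q ^ Suc m = (q ^ Suc m) ^ Suc n" by (rule power_Suc2[symmetric])
      also have "\<dots> = (q ^ Suc n) ^ Suc m" by (simp only: power_mult[symmetric] mult.commute)
      finally show ?thesis unfolding f_def by (simp only: mult.assoc)
    qed
    ultimately have "(\<lambda>n. f n m) sums (1 / (1 - q ^ Suc m)\<^sup>2 * q ^ Suc m)" by (simp only:)
    from sums_unique[OF this] show ?thesis by simp
  qed
  hence "s = lambert_sum q" using sums_unique[OF s(2)] unfolding lambert_sum_def by (simp only:)
  thus ?thesis using s(1) sums_unique[OF f_sums, symmetric] by (simp only: times_divide_eq_right)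
qed

lemma logderiv_euler_fun:
  assumes q: "norm q < 1"
  shows "q * deriv euler_fun q / euler_fun q = - lambert_sum q"
proof -
  define r where "r = (norm q + 1) / 2"
  have r: "norm q < r" "r < 1" using q by (auto simp: r_def)
  have "(\<lambda>k. deriv (\<lambda>q. 1 - q ^ Suc k) q / (1 - q ^ Suc k)) sums (deriv euler_fun q / euler_fun q)"
    by (rule logderiv_prodinf_complex_uniform_limit[OF euler_fun_uniform_limit[OF r(2)]])
       (use r euler_fun_nonzero[OF q] in \<open>auto intro!: holomorphic_intros\<close>)
  hence "(\<lambda>k. - q * (deriv (\<lambda>q. 1 - q ^ Suc k) q / (1 - q ^ Suc k))) sums (- q * (deriv euler_fun q / euler_fun q))"
    by (rule sums_mult)
  moreover have "- q * (deriv (\<lambda>q. 1 - q ^ Suc k) q / (1 - q ^ Suc k)) = of_nat (Suc k) * q ^ Suc k / (1 - q ^ Suc k)" for k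
  proof -
    have "deriv (\<lambda>q. 1 - q ^ Suc k) q = - (of_nat (Suc k) * q ^ k)"
      by (rule DERIV_imp_deriv) (auto intro!: derivative_eq_intros simp del: power_Suc)
    thus ?thesis by simp
  qed
  ultimately have "- q * (deriv euler_fun q / euler_fun q) = lambert_sum q"
    using lambert_sum_alt[OF q] by (simp add: sums_iff)
  thus ?thesis by (simp add: minus_equation_iff)
qed

definition q12 :: "complex \<Rightarrow> complex" where "q12 z = exp (2 * of_real pi * \<i> * z / 12)"

lemma q12_power: "q12 z ^ n = q12 (of_nat n * z)"
  by (simp add: q12_def mult_ac flip: exp_of_nat_mult)

lemma q12_nome: "q12 z ^ 12 = nome z"
  unfolding q12_def nome_def exp_of_nat_mult[symmetric] by (simp add: mult_ac)

lemma norm_q12: "norm (q12 z) = exp (- (pi * Im z / 6))"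
  by (simp add: q12_def)

lemma norm_q12_less: "Im z > 0 \<Longrightarrow> norm (q12 z) < 1"
  by (simp add: norm_q12)

lemma q12_nonzero [simp]: "q12 z \<noteq> 0"
  by (simp add: q12_def)

lemma norm_nome_less: "Im z > 0 \<Longrightarrow> norm (nome z) < 1"
  by (simp add: norm_nome)

lemma has_field_derivative_q12: "(q12 has_field_derivative of_real pi * \<i> / 6 * q12 z) (at z)"
proof -
  have "((\<lambda>z. 2 * of_real pi * \<i> * z / 12) has_field_derivative 2 * of_real pi * \<i> / 12) (at z)"
    by (intro DERIV_cdivide DERIV_cmult_Id)
  from DERIV_chain2[OF DERIV_exp this] show ?thesis
    unfolding q12_def[abs_def] by (simp add: mult.commute)
qed

text \<open>The square of \<open>dedekind_eta\<close>, of weight 1.\<close>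

definition eta2 :: "complex \<Rightarrow> complex" where "eta2 z = q12 z * euler_fun (nome z) ^ 2"

lemma eta2_nonzero: "Im z > 0 \<Longrightarrow> eta2 z \<noteq> 0"
  using euler_fun_nonzero[OF norm_nome_less] by (simp add: eta2_def)

lemma DERIV_eta2:
  assumes z: "Im z > 0"
  shows "(eta2 has_field_derivative
    eta2 z * (of_real pi * \<i> / 6 - 4 * of_real pi * \<i> * lambert_sum (nome z))) (at z)"
proof -
  define P where "P = euler_fun (nome z)"
  define P' where "P' = deriv euler_fun (nome z)"
  have q: "norm (nome z) < 1" using norm_nome_less z by auto
  have P0: "P \<noteq> 0" using euler_fun_nonzero[OF q] by (simp add: P_def)
  have P': "(euler_fun has_field_derivative P') (at (nome z))"
    unfolding P'_def by (rule holomorphic_derivI[OF holomorphic_euler_fun]) (use q in auto)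
  have "((\<lambda>z. 2 * of_real pi * \<i> * z) has_field_derivative 2 * of_real pi * \<i>) (at z)"
    by (rule DERIV_cmult_Id)
  from DERIV_chain2[OF DERIV_exp this]
  have n: "(nome has_field_derivative 2 * of_real pi * \<i> * nome z) (at z)"
    unfolding nome_def[abs_def] by (simp only: mult.commute)
  have "((\<lambda>z. q12 z * euler_fun (nome z) ^ 2) has_field_derivative
     of_real pi * \<i> / 6 * q12 z * P\<^sup>2 + of_nat 2 * (P' * (2 * of_real pi * \<i> * nome z) * P ^ (2 - 1)) * q12 z) (at z)"
  proof -
    have d: "((\<lambda>z. euler_fun (nome z)) has_field_derivative P' * (2 * of_real pi * \<i> * nome z)) (at z)"
      by (rule DERIV_chain2[OF P' n])
    have "((\<lambda>z. euler_fun (nome z) ^ 2) has_field_derivative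
        of_nat 2 * (P' * (2 * of_real pi * \<i> * nome z) * P ^ (2 - Suc 0))) (at z)"
      unfolding P_def by (rule DERIV_power[OF d])
    from DERIV_mult[OF has_field_derivative_q12 this] show ?thesis unfolding P_def by simp
  qed
  moreover have lam: "lambert_sum (nome z) = - (nome z * P' / P)"
    using logderiv_euler_fun[OF q] by (simp add: P_def P'_def)
  have "eta2 z * (of_real pi * \<i> / 6 - 4 * of_real pi * \<i> * lambert_sum (nome z)) =
    of_real pi * \<i> / 6 * q12 z * P\<^sup>2 + of_nat 2 * (P' * (2 * of_real pi * \<i> * nome z) * P ^ (2 - 1)) * q12 z"
    unfolding lam eta2_def P_def[symmetric] using P0 by (simp add: field_simps power2_eq_square)
  ultimately show ?thesis unfolding eta2_def[abs_def] by simp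
qed

text \<open>By \<open>lambert_sum_transformation\<close> the quotient \<open>\<phi>\<close> has
  derivative 0. Its constant value is read off at the fixed point \<open>\<i>\<close>, where it is
  \<open>1 / \<i>\<close>.\<close>

lemma eta2_transformation:
  assumes z: "Im z > 0"
  shows "eta2 (- 1 / z) = - \<i> * z * eta2 z"
proof -
  define L where "L = (\<lambda>z. of_real pi * \<i> / 6 - 4 * of_real pi * \<i> * lambert_sum (nome z))"
  define \<phi> where "\<phi> = (\<lambda>z. eta2 (- 1 / z) / (z * eta2 z))"
  note Im' = Im_minus_inverse_pos
  have L: "L z - L (- 1 / z) / z\<^sup>2 = - 1 / z" if "Im z > 0" for z
  proof -
    have z0: "z \<noteq> 0" using that by auto
    define S S' where "S = lambert_sum (nome z)" and "S' = lambert_sum (nome (- 1 / z))"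
    have "\<i> / of_real pi * (- 4 * of_real pi ^ 2 * S - of_real pi ^ 2 / (6 * z\<^sup>2) -
         (- 4 * of_real pi ^ 2 * S' / z\<^sup>2 - of_real pi ^ 2 / 6)) = \<i> / of_real pi * (of_real pi * \<i> / z)"
      unfolding S_def S'_def by (subst lambert_sum_transformation[OF that]) simp
    moreover have "\<i> / of_real pi * (- 4 * of_real pi ^ 2 * S - of_real pi ^ 2 / (6 * z\<^sup>2) -
         (- 4 * of_real pi ^ 2 * S' / z\<^sup>2 - of_real pi ^ 2 / 6)) = L z - L (- 1 / z) / z\<^sup>2"
      unfolding L_def S_def[symmetric] S'_def[symmetric]
      using z0 by (simp add: divide_simps) (simp add: power2_eq_square algebra_simps)
    moreover have "\<i> / of_real pi * (of_real pi * \<i> / z) = - 1 / z" by simp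
    ultimately show ?thesis by simp
  qed
  have "(\<phi> has_field_derivative 0) (at z)" if "Im z > 0" for z
  proof -
    have z0: "z \<noteq> 0" using that by auto
    have e0: "eta2 z \<noteq> 0" using eta2_nonzero that by auto
    have d1: "((\<lambda>z. eta2 (- 1 / z)) has_field_derivative eta2 (- 1 / z) * L (- 1 / z) * (1 / z\<^sup>2)) (at z)"
      unfolding L_def
      by (rule DERIV_chain2[where f = eta2 and g = "\<lambda>z. - 1 / z", OF DERIV_eta2[OF Im'[OF that]]])
         (use z0 in \<open>auto intro!: derivative_eq_intros simp: power2_eq_square\<close>)
    have d2: "((\<lambda>z. z * eta2 z) has_field_derivative (z * (eta2 z * L z) + 1 * eta2 z)) (at z)"
      unfolding L_def by (intro DERIV_mult' DERIV_eta2 that DERIV_ident)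
    have "z * eta2 z \<noteq> 0" using z0 e0 by simp
    note D = DERIV_divide[OF d1 d2 this]
    have "eta2 (- 1 / z) * L (- 1 / z) * (1 / z\<^sup>2) * (z * eta2 z) - eta2 (- 1 / z) * (z * (eta2 z * L z) + 1 * eta2 z)
      = eta2 (- 1 / z) * eta2 z * z * (L (- 1 / z) / z\<^sup>2 - L z - 1 / z)"
      using z0 by (simp add: field_simps)
    also have "L (- 1 / z) / z\<^sup>2 - L z - 1 / z = 0"
      using L[OF that] by (simp add: algebra_simps)
    finally show ?thesis using D unfolding \<phi>_def by simp
  qed
  hence "\<exists>c. \<forall>z\<in>upper_half_plane. \<phi> z = c"
    by (intro has_field_derivative_zero_constant)
       (auto simp: upper_half_plane_def convex_halfspace_Im_gt intro: DERIV_subset)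
  then obtain c where c: "\<And>z. Im z > 0 \<Longrightarrow> \<phi> z = c" by auto
  have "\<phi> \<i> = - \<i>"
    using eta2_nonzero[of \<i>] by (simp add: \<phi>_def)
  hence "\<phi> z = - \<i>" using c[of \<i>] c[OF z] by simp
  moreover have "z \<noteq> 0" using z by auto
  ultimately show ?thesis using eta2_nonzero[OF z] by (simp add: \<phi>_def field_simps)
qed

definition euler_fps :: "complex fps" where "euler_fps = fps_expansion euler_fun 0"

lemma euler_fps_conv_radius: "fps_conv_radius euler_fps \<ge> 1"
  unfolding euler_fps_def
  by (rule conv_radius_fps_expansion) (use holomorphic_euler_fun in \<open>simp add: one_ereal_def\<close>)

lemma eval_euler_fps: "norm q < 1 \<Longrightarrow> eval_fps euler_fps q = euler_fun q"
  unfolding euler_fps_def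
  using eval_fps_expansion'[of euler_fun 0 1 q] holomorphic_euler_fun by (simp add: one_ereal_def)

lemma euler_fps_nth_0: "fps_nth euler_fps 0 = 1"
  using eval_euler_fps[of 0] by (simp add: eval_fps_at_0 euler_fun_def)

text \<open>The finite products have integral coefficients. These converge to the coefficients of
  \<open>euler_fun\<close>, because derivatives converge under uniform limits, and the set of
  integers is closed.\<close>

lemma euler_fps_nth_Ints: "fps_nth euler_fps n \<in> \<int>"
proof -
  define f where "f = (\<lambda>N (q::complex). \<Prod>n<N. 1 - q ^ Suc n)"
  define F where "F = (\<lambda>N. \<Prod>n<N. 1 - (fps_X :: complex fps) ^ Suc n)"
  have F: "f N has_fps_expansion F N" for N
    unfolding f_def F_def by (intro fps_expansion_intros)
  have F_Ints: "fps_nth (F N) n \<in> \<int>" for N n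
  proof (induction N arbitrary: n)
    case (Suc N)
    have "F (Suc N) = F N * (1 - fps_X ^ Suc N)"
      unfolding F_def by (rule prod.lessThan_Suc)
    thus ?case
      by (auto simp: fps_mult_nth simp del: power_Suc intro!: Ints_sum Ints_mult Suc Ints_diff)
  qed (auto simp: F_def)
  have "(\<lambda>N. (deriv ^^ n) (f N) 0) \<longlonglongrightarrow> (deriv ^^ n) euler_fun 0"
  proof (rule higher_deriv_complex_uniform_limit)
    show "uniform_limit (ball 0 (1/2)) f euler_fun sequentially"
      unfolding f_def by (rule euler_fun_uniform_limit) simp
    show "\<forall>\<^sub>F N in sequentially. f N holomorphic_on ball 0 (1/2)"
      unfolding f_def by (intro always_eventually allI holomorphic_intros)
  qed auto
  hence lim: "(\<lambda>N. (deriv ^^ n) (f N) 0 / fact n) \<longlonglongrightarrow> (deriv ^^ n) euler_fun 0 / fact n"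
    by (intro tendsto_intros) auto
  have ints: "(deriv ^^ n) (f N) 0 / fact n \<in> \<int>" for N
    using fps_nth_fps_expansion[OF F[of N], of n] F_Ints[of N n] by simp
  have "(deriv ^^ n) euler_fun 0 / fact n \<in> \<int>"
    by (rule closed_sequentially[OF closed_Ints ints lim])
  thus ?thesis by (simp add: euler_fps_def fps_expansion_def)
qed

subsection \<open>Integral Laurent series\<close>

notation fls_nth (infixl "$$" 75)

definition int_fls :: "complex fls set" where "int_fls = {A. \<forall>n. A $$ n \<in> \<int>}"

lemma int_flsD: "A \<in> int_fls \<Longrightarrow> A $$ n \<in> \<int>"
  by (simp add: int_fls_def)

lemma int_flsI: "(\<And>n. A $$ n \<in> \<int>) \<Longrightarrow> A \<in> int_fls"
  by (simp add: int_fls_def)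

lemma int_fls_0 [intro, simp]: "0 \<in> int_fls"
  and int_fls_1 [intro, simp]: "1 \<in> int_fls"
  and int_fls_add [intro]: "A \<in> int_fls \<Longrightarrow> B \<in> int_fls \<Longrightarrow> A + B \<in> int_fls"
  and int_fls_diff [intro]: "A \<in> int_fls \<Longrightarrow> B \<in> int_fls \<Longrightarrow> A - B \<in> int_fls"
  and int_fls_uminus [intro]: "A \<in> int_fls \<Longrightarrow> - A \<in> int_fls"
  by (auto simp: int_fls_def)

lemma int_fls_mult [intro]: "A \<in> int_fls \<Longrightarrow> B \<in> int_fls \<Longrightarrow> A * B \<in> int_fls"
  by (auto simp: int_fls_def fls_times_nth(2) intro!: Ints_sum Ints_mult)

lemma int_fls_power [intro]: "A \<in> int_fls \<Longrightarrow> A ^ n \<in> int_fls"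
  by (induction n) auto

lemma int_fls_sum [intro]: "(\<And>x. x \<in> X \<Longrightarrow> f x \<in> int_fls) \<Longrightarrow> sum f X \<in> int_fls"
  by (induction X rule: infinite_finite_induct) auto

lemma int_fls_of_int [intro, simp]: "of_int c \<in> int_fls"
  by (auto simp: int_fls_def fls_of_int_nth)

lemma int_fls_of_nat [intro, simp]: "of_nat c \<in> int_fls"
  using int_fls_of_int[of "int c"] by (simp del: int_fls_of_int)

lemma int_fls_compose_power [intro]: "A \<in> int_fls \<Longrightarrow> fls_compose_power A d \<in> int_fls"
  by (cases "d = 0") (auto simp: int_fls_def fls_nth_compose_power)

section \<open>Values of Laurent series as unordered sums\<close>

lemma has_sum_finite_sum:
  fixes f :: "'a \<Rightarrow> 'b \<Rightarrow> complex"
  assumes "\<And>j. j \<in> J \<Longrightarrow> (f j has_sum s j) X"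
  shows "((\<lambda>x. \<Sum>j\<in>J. f j x) has_sum (\<Sum>j\<in>J. s j)) X"
  using assms by (induction J rule: infinite_finite_induct) (auto intro!: has_sum_add has_sum_0)

text \<open>An unordered sum over all integers allows exponents to be selected and reindexed without
  keeping track of the pole order.\<close>

lemma has_sum_eval_fls:
  assumes A: "fls_conv_radius A \<ge> 1" and x: "0 < norm x" "norm x < 1"
  shows "((\<lambda>n. A $$ n * x powi n) has_sum eval_fls A x) UNIV"
proof -
  define N where "N = fls_subdegree A"
  have x0: "x \<noteq> 0" using x by auto
  have r: "ereal (norm x) < fls_conv_radius A"
    using A x(2) by (meson ereal_less(3) less_le_trans)
  have "summable (\<lambda>n. norm (A $$ (int n + N) * x ^ n) * norm (x powi N))"
    unfolding N_def by (intro summable_mult2 norm_summable_fls' r)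
  also have "(\<lambda>n. norm (A $$ (int n + N) * x ^ n) * norm (x powi N)) = (\<lambda>n. norm (A $$ (int n + N) * x powi (int n + N)))"
    using x0 by (simp add: power_int_add norm_mult fun_eq_iff)
  finally have "((\<lambda>k. A $$ (int k + N) * x powi (int k + N)) has_sum eval_fls A x) UNIV"
    using x0 sums_eval_fls[OF r] unfolding N_def by (intro norm_summable_imp_has_sum) auto
  also have "?this \<longleftrightarrow> ((\<lambda>n. A $$ n * x powi n) has_sum eval_fls A x) {N..}"
    by (rule has_sum_reindex_bij_betw[of "\<lambda>k. int k + N"])
       (rule bij_betwI[where g = "\<lambda>n. nat (n - N)"], auto)
  also have "\<dots> \<longleftrightarrow> ?thesis"
    by (rule has_sum_cong_neutral) (auto simp: N_def)
  finally show ?thesis .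
qed

lemma fls_conv_radius_ge_1I:
  assumes "\<And>x. 0 < norm x \<Longrightarrow> norm x < 1 \<Longrightarrow> (\<lambda>n. A $$ n * x powi n) summable_on UNIV"
  shows "fls_conv_radius A \<ge> 1"
  unfolding fls_conv_radius_def fps_conv_radius_def
proof (rule conv_radius_geI_ex')
  fix r :: real assume r: "0 < r" "ereal r < 1"
  have "(\<lambda>n. A $$ n * of_real r powi n) summable_on UNIV"
    using r by (intro assms) auto
  hence "(\<lambda>n. A $$ n * of_real r powi n) summable_on {0..}"
    by (rule summable_on_subset_banach) auto
  also have "?this \<longleftrightarrow> (\<lambda>k. A $$ int k * of_real r powi int k) summable_on UNIV"
    by (rule summable_on_reindex_bij_betw[symmetric], rule bij_betwI[where g = nat]) auto
  finally have "summable (\<lambda>k. A $$ int k * of_real r powi int k)"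
    by (rule summable_on_imp_summable)
  thus "summable (\<lambda>n. fps_nth (fls_regpart A) n * of_real r ^ n)"
    by simp
qed

lemma eval_flsI:
  assumes "\<And>x. 0 < norm x \<Longrightarrow> norm x < 1 \<Longrightarrow> ((\<lambda>n. A $$ n * x powi n) has_sum f x) UNIV"
  shows "fls_conv_radius A \<ge> 1" and "0 < norm x \<Longrightarrow> norm x < 1 \<Longrightarrow> eval_fls A x = f x"
proof -
  show *: "fls_conv_radius A \<ge> 1"
    using assms by (intro fls_conv_radius_ge_1I) (auto simp: summable_on_def)
  show "eval_fls A x = f x" if "0 < norm x" "norm x < 1"
    using has_sum_unique[OF has_sum_eval_fls[OF * that] assms[OF that]] .
qed

lemma
  assumes A: "fls_conv_radius A \<ge> 1" and d: "d > 0"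
  shows fls_conv_radius_compose_power: "fls_conv_radius (fls_compose_power A d) \<ge> 1"
    and eval_fls_compose_power:
      "0 < norm x \<Longrightarrow> norm x < 1 \<Longrightarrow> eval_fls (fls_compose_power A d) x = eval_fls A (x ^ d)"
proof -
  have *: "((\<lambda>n. fls_compose_power A d $$ n * x powi n) has_sum eval_fls A (x ^ d)) UNIV"
    if x: "0 < norm x" "norm x < 1" for x
  proof -
    have xd: "0 < norm (x ^ d)" "norm (x ^ d) < 1"
      using x d by (auto simp: norm_power power_less_one_iff)
    have "((\<lambda>n. A $$ n * (x ^ d) powi n) has_sum eval_fls A (x ^ d)) UNIV"
      by (rule has_sum_eval_fls[OF A xd])
    also have "(\<lambda>n. A $$ n * (x ^ d) powi n) = (\<lambda>n. fls_compose_power A d $$ (int d * n) * x powi (int d * n))"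
      using d by (simp add: fls_nth_compose_power power_int_mult)
    also have "(\<dots> has_sum eval_fls A (x ^ d)) UNIV \<longleftrightarrow>
        ((\<lambda>n. fls_compose_power A d $$ n * x powi n) has_sum eval_fls A (x ^ d)) (range (\<lambda>n. int d * n))"
      by (rule has_sum_reindex_bij_betw[of "\<lambda>n. int d * n"])
         (use d in \<open>auto simp: bij_betw_def inj_on_def\<close>)
    also have "\<dots> \<longleftrightarrow> ?thesis"
      by (rule has_sum_cong_neutral) (use d in \<open>auto simp: fls_nth_compose_power\<close>)
    finally show ?thesis .
  qed
  show "fls_conv_radius (fls_compose_power A d) \<ge> 1"
    by (rule eval_flsI(1)[OF *])
  show "0 < norm x \<Longrightarrow> norm x < 1 \<Longrightarrow> eval_fls (fls_compose_power A d) x = eval_fls A (x ^ d)"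
    by (rule eval_flsI(2)[OF *])
qed

section \<open>The operator U on Laurent series\<close>

lemma sum_roots_of_unity_powi:
  fixes n :: int
  assumes m: "m > 0"
  shows "(\<Sum>j<m. exp (2 * of_real pi * \<i> * of_nat j / of_nat m) powi n) = (if int m dvd n then of_nat m else 0)"
proof -
  define w where "w = exp (2 * of_real pi * \<i> * of_int n / of_nat m)"
  have eq: "exp (2 * of_real pi * \<i> * of_nat j / of_nat m) powi n = w ^ j" for j
  proof -
    have "exp (2 * of_real pi * \<i> * of_nat j / of_nat m) powi n = exp (of_int n * (2 * of_real pi * \<i> * of_nat j / of_nat m))"
      by (simp add: exp_power_int)
    also have "\<dots> = exp (of_nat j * (2 * of_real pi * \<i> * of_int n / of_nat m))"
      by (simp add: mult_ac)
    finally show ?thesis by (simp only: w_def exp_of_nat_mult)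
  qed
  have int1: "exp (2 * of_real pi * \<i> * of_int k) = 1" for k :: int
    by (auto simp: exp_eq_1 intro!: exI[of _ k])
  have "w ^ m = exp (of_nat m * (2 * of_real pi * \<i> * of_int n / of_nat m))"
    by (simp only: w_def exp_of_nat_mult)
  hence wm: "w ^ m = 1"
    using m int1[of n] by simp
  have w1: "w = 1 \<longleftrightarrow> int m dvd n"
  proof
    assume "w = 1"
    then obtain k :: int where k: "2 * pi * n / m = of_int (2 * k) * pi"
      unfolding w_def exp_eq_1 by (auto simp: Im_divide_of_nat)
    hence "real_of_int n = of_int (k * int m)" using m by (simp add: field_simps)
    hence "n = k * int m" by (simp only: of_int_eq_iff)
    thus "int m dvd n" by simp
  next
    assume "int m dvd n"
    then obtain k where "n = int m * k" by auto
    thus "w = 1" unfolding w_def using m int1[of k] by (simp add: mult_ac)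
  qed
  show ?thesis
  proof (cases "int m dvd n")
    case True
    thus ?thesis using w1 by (simp add: eq)
  next
    case False
    hence "w \<noteq> 1" using w1 by simp
    thus ?thesis using False wm by (simp add: eq sum_gp_strict)
  qed
qed

definition fls_U :: "nat \<Rightarrow> complex fls \<Rightarrow> complex fls" where
  "fls_U m A = Abs_fls (\<lambda>n. A $$ (int m * n))"

lemma fls_U_nth [simp]:
  assumes "m > 0"
  shows "fls_U m A $$ n = A $$ (int m * n)"
  unfolding fls_U_def
proof (rule nth_Abs_fls_lower_bound)
  show "\<forall>n < min 0 (fls_subdegree A). A $$ (int m * n) = 0"
  proof safe
    fix n assume n: "n < min 0 (fls_subdegree A)"
    have "int m * n \<le> 1 * n" using assms n by (intro mult_right_mono_neg) auto
    hence "int m * n < fls_subdegree A" using n by linarith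
    thus "A $$ (int m * n) = 0" by (rule fls_eq0_below_subdegree)
  qed
qed

lemma int_fls_U [intro]: "m > 0 \<Longrightarrow> A \<in> int_fls \<Longrightarrow> fls_U m A \<in> int_fls"
  by (auto simp: int_fls_def)

text \<open>Averaging over the \<open>m\<close>th roots of unity kills all exponents not divisible
  by \<open>m\<close>. This expresses U through translates of the argument, the form in which its
  transformation law can be proved.\<close>

lemma
  assumes A: "fls_conv_radius A \<ge> 1" and m: "m > 0"
  shows fls_conv_radius_U: "fls_conv_radius (fls_U m A) \<ge> 1"
    and eval_fls_U: "0 < norm y \<Longrightarrow> norm y < 1 \<Longrightarrow>
      (\<Sum>j<m. eval_fls A (y * exp (2 * of_real pi * \<i> * of_nat j / of_nat m))) = of_nat m * eval_fls (fls_U m A) (y ^ m)"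
proof -
  have *: "((\<lambda>n. fls_U m A $$ n * (y ^ m) powi n) has_sum
      (\<Sum>j<m. eval_fls A (y * exp (2 * of_real pi * \<i> * of_nat j / of_nat m))) / of_nat m) UNIV"
    if y: "0 < norm y" "norm y < 1" for y
  proof -
    define z where "z = (\<lambda>j. exp (2 * of_real pi * \<i> * of_nat j / of_nat m))"
    have nz: "norm (z j) = 1" for j by (simp add: z_def Re_divide_of_nat)
    define S where "S = (\<Sum>j<m. eval_fls A (y * z j)) / of_nat m"
    have "((\<lambda>n. \<Sum>j<m. A $$ n * (y * z j) powi n) has_sum (\<Sum>j<m. eval_fls A (y * z j))) UNIV"
      by (intro has_sum_finite_sum has_sum_eval_fls A) (use y nz in \<open>auto simp: norm_mult\<close>)
    hence "((\<lambda>n. (\<Sum>j<m. A $$ n * (y * z j) powi n) * (1 / of_nat m)) has_sum (\<Sum>j<m. eval_fls A (y * z j)) * (1 / of_nat m)) UNIV"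
      by (rule has_sum_cmult_left)
    also have "(\<lambda>n. (\<Sum>j<m. A $$ n * (y * z j) powi n) * (1 / of_nat m)) = (\<lambda>n. if int m dvd n then A $$ n * y powi n else 0)"
    proof
      fix n :: int
      have "(\<Sum>j<m. A $$ n * (y * z j) powi n) = A $$ n * y powi n * (\<Sum>j<m. z j powi n)"
        by (simp add: power_int_mult_distrib sum_distrib_left mult_ac)
      thus "(\<Sum>j<m. A $$ n * (y * z j) powi n) * (1 / of_nat m) = (if int m dvd n then A $$ n * y powi n else 0)"
        using sum_roots_of_unity_powi[OF m, of n] m by (simp add: z_def)
    qed
    finally have "((\<lambda>n. if int m dvd n then A $$ n * y powi n else 0) has_sum S) UNIV"
      by (simp add: S_def)
    also have "?this \<longleftrightarrow> ((\<lambda>n. A $$ n * y powi n) has_sum S) (range (\<lambda>n. int m * n))"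
      by (rule has_sum_cong_neutral) auto
    also have "\<dots> \<longleftrightarrow> ((\<lambda>n. A $$ (int m * n) * y powi (int m * n)) has_sum S) UNIV"
      by (rule has_sum_reindex_bij_betw[of "\<lambda>n. int m * n", symmetric])
         (use m in \<open>auto simp: bij_betw_def inj_on_def\<close>)
    finally show ?thesis using m by (simp add: S_def z_def power_int_mult)
  qed
  show conv: "fls_conv_radius (fls_U m A) \<ge> 1"
  proof (rule fls_conv_radius_ge_1I)
    fix x :: complex assume x: "0 < norm x" "norm x < 1"
    define y where "y = exp (Ln x / of_nat m)"
    have ym: "y ^ m = x" using m x unfolding y_def by (simp flip: exp_of_nat_mult)
    hence "norm y ^ m = norm x" by (metis norm_power)
    hence "norm y < 1" using x m by (metis norm_ge_zero power_less_one_iff)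
    moreover have "0 < norm y" by (simp add: y_def)
    ultimately show "(\<lambda>n. fls_U m A $$ n * x powi n) summable_on UNIV"
      using *[of y] unfolding ym by (auto simp: summable_on_def)
  qed
  show "(\<Sum>j<m. eval_fls A (y * exp (2 * of_real pi * \<i> * of_nat j / of_nat m))) = of_nat m * eval_fls (fls_U m A) (y ^ m)"
    if y: "0 < norm y" "norm y < 1"
  proof -
    have "0 < norm (y ^ m)" "norm (y ^ m) < 1" using y m by (auto simp: norm_power power_less_one_iff)
    from has_sum_unique[OF has_sum_eval_fls[OF conv this] *[OF y]] m show ?thesis by simp
  qed
qed

subsection \<open>Transformation under the modular group\<close>

definition e12 :: "int \<Rightarrow> complex" where "e12 n = exp (2 * of_real pi * \<i> * of_int n / 12)"

lemma e12_0 [simp]: "e12 0 = 1"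
  by (simp add: e12_def)

lemma e12_add: "e12 (m + n) = e12 m * e12 n"
  by (simp add: e12_def ring_distribs add_divide_distrib flip: exp_add)

lemma e12_nonzero [simp]: "e12 n \<noteq> 0"
  by (simp add: e12_def)

lemma e12_powi: "e12 m powi n = e12 (m * n)"
  by (simp add: e12_def exp_power_int mult_ac)

lemma e12_12: "e12 (12 * k) = 1"
  by (auto simp: e12_def exp_eq_1 intro!: exI[of _ k])

lemma e12_cong: "[m = n] (mod 12) \<Longrightarrow> e12 m = e12 n"
proof -
  assume "[m = n] (mod 12)"
  then obtain k where "m = n + 12 * k"
    by (metis cong_iff_lin mult.commute add.commute cong_sym)
  thus ?thesis by (simp add: e12_add e12_12)
qed

lemma e12_6: "e12 6 = - 1"
  by (simp add: e12_def exp_eq_polar)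

lemma e12_minus_3: "e12 (- 3) = - \<i>"
proof -
  have "e12 (- 3) = cis (- (pi / 2))"
    by (simp add: e12_def cis_conv_exp mult_ac)
  thus ?thesis by (simp add: complex_eq_iff)
qed

text \<open>The multiplier of \<open>\<eta>\<^sup>2\<close> at the matrix with rows \<open>a b\<close> and \<open>c d\<close> is the 12th root of unity with this exponent.\<close>
definition eta_exponent :: "int \<Rightarrow> int \<Rightarrow> int \<Rightarrow> int \<Rightarrow> int" where
  "eta_exponent a b c d = (1 - c * c) * (b * d + 3 * (c - 1) * d + c + 3) + c * (a + d - 3)"

text \<open>Once \<open>c\<close> and \<open>d\<close> are numerals, all expressions are linear in
  \<open>a\<close> and \<open>b\<close>, so linear arithmetic can use the determinant
  condition.\<close>

lemma eta_exponent_mod_3: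
  assumes "c \<in> {0..<3}" "d \<in> {0..<3}" "(a * d - b * c) mod 3 = 1"
  shows "(eta_exponent a (a + b) c (c + d) - eta_exponent a b c d - 1) mod 3 = 0"
    and "(eta_exponent b (- a) d (- c) - eta_exponent a b c d + 3) mod 3 = 0"
proof -
  have "c = 0 \<or> c = 1 \<or> c = 2" "d = 0 \<or> d = 1 \<or> d = 2" using assms by auto
  thus "(eta_exponent a (a + b) c (c + d) - eta_exponent a b c d - 1) mod 3 = 0"
    and "(eta_exponent b (- a) d (- c) - eta_exponent a b c d + 3) mod 3 = 0"
    using assms(3) by (elim disjE; simp add: eta_exponent_def; presburger)+
qed

lemma eta_exponent_mod_4:
  assumes "c \<in> {0..<4}" "d \<in> {0..<4}" "(a * d - b * c) mod 4 = 1"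
  shows "(eta_exponent a (a + b) c (c + d) - eta_exponent a b c d - 1) mod 4 = 0"
    and "(eta_exponent b (- a) d (- c) - eta_exponent a b c d + 3) mod 4 = 0"
proof -
  have "c = 0 \<or> c = 1 \<or> c = 2 \<or> c = 3" "d = 0 \<or> d = 1 \<or> d = 2 \<or> d = 3" using assms by auto
  thus "(eta_exponent a (a + b) c (c + d) - eta_exponent a b c d - 1) mod 4 = 0"
    and "(eta_exponent b (- a) d (- c) - eta_exponent a b c d + 3) mod 4 = 0"
    using assms(3) by (elim disjE; simp add: eta_exponent_def; presburger)+
qed
text \<open>The behaviour of the multiplier under right multiplication by T (rows \<open>1 1\<close>
  and \<open>0 1\<close>) and S (rows \<open>0 -1\<close> and \<open>1 0\<close>). Replacing
  \<open>c\<close> and \<open>d\<close> by residues leaves the finite checks above.\<close>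

lemma eta_exponent_mod:
  assumes n: "n = 3 \<or> n = (4 :: int)" and det: "a * d - b * c = 1"
  shows "(eta_exponent a (a + b) c (c + d) - eta_exponent a b c d - 1) mod n = 0"
    and "(eta_exponent b (- a) d (- c) - eta_exponent a b c d + 3) mod n = 0"
proof -
  define c' d' where "c' = c mod n" and "d' = d mod n"
  have r: "c' \<in> {0..<n}" "d' \<in> {0..<n}"
    using n by (auto simp: c'_def d'_def)
  have c: "[c' = c] (mod n)" "[d' = d] (mod n)"
    by (simp_all add: c'_def d'_def cong_def)
  have "[a * d' - b * c' = a * d - b * c] (mod n)"
    by (intro cong_diff cong_mult c cong_refl)
  hence "(a * d' - b * c') mod n = 1"
    using n unfolding det by (auto simp: cong_def)
  hence *: "(eta_exponent a (a + b) c' (c' + d') - eta_exponent a b c' d' - 1) mod n = 0"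
     "(eta_exponent b (- a) d' (- c') - eta_exponent a b c' d' + 3) mod n = 0"
    using eta_exponent_mod_3[of c' d'] eta_exponent_mod_4[of c' d'] n r by blast+
  have "[eta_exponent a (a + b) c' (c' + d') - eta_exponent a b c' d' - 1 =
    eta_exponent a (a + b) c (c + d) - eta_exponent a b c d - 1] (mod n)"
    unfolding eta_exponent_def by (intro cong_add cong_diff cong_mult c cong_refl)
  thus "(eta_exponent a (a + b) c (c + d) - eta_exponent a b c d - 1) mod n = 0"
    using * by (simp add: cong_def)
  have "[eta_exponent b (- a) d' (- c') - eta_exponent a b c' d' + 3 =
    eta_exponent b (- a) d (- c) - eta_exponent a b c d + 3] (mod n)"
    unfolding eta_exponent_def by (intro cong_add cong_diff cong_mult c cong_refl cong_minus_minus_iff[THEN iffD2])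
  thus "(eta_exponent b (- a) d (- c) - eta_exponent a b c d + 3) mod n = 0"
    using * by (simp add: cong_def)
qed

lemma cong_12I:
  fixes x y :: int
  assumes "(x - y) mod 3 = 0" "(x - y) mod 4 = 0"
  shows "[x = y] (mod 12)"
  using assms unfolding cong_iff_dvd_diff by presburger

lemma eta_exponent_T:
  assumes "a * d - b * c = 1"
  shows "[eta_exponent a (a + b) c (c + d) = eta_exponent a b c d + 1] (mod 12)"
  using eta_exponent_mod(1)[OF _ assms, of 3] eta_exponent_mod(1)[OF _ assms, of 4]
  by (intro cong_12I) (simp_all add: diff_diff_eq)

lemma eta_exponent_S:
  assumes "a * d - b * c = 1"
  shows "[eta_exponent b (- a) d (- c) = eta_exponent a b c d - 3] (mod 12)"
  using eta_exponent_mod(2)[OF _ assms, of 3] eta_exponent_mod(2)[OF _ assms, of 4]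
  by (intro cong_12I) (simp_all add: algebra_simps)

section \<open>Transformation laws from the generators S and T\<close>

definition transforms :: "(complex \<Rightarrow> complex) \<Rightarrow> int \<Rightarrow> int \<Rightarrow> int \<Rightarrow> int \<Rightarrow> int \<Rightarrow> int \<Rightarrow> bool" where
  "transforms f k t a b c d \<longleftrightarrow> (\<forall>z. Im z > 0 \<longrightarrow>
     f ((of_int a * z + of_int b) / (of_int c * z + of_int d)) =
     e12 (t * eta_exponent a b c d) * (of_int c * z + of_int d) powi k * f z)"

context
  fixes f :: "complex \<Rightarrow> complex" and k t :: int
  assumes T: "\<And>z. Im z > 0 \<Longrightarrow> f (z + 1) = e12 t * f z"
    and S: "\<And>z. Im z > 0 \<Longrightarrow> f (- 1 / z) = e12 (- 3 * t) * z powi k * f z"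
begin

lemma e12_eta_exponent_T:
  assumes "a * d - b * c = 1"
  shows "e12 (t * eta_exponent a (a + b) c (c + d)) = e12 (t * eta_exponent a b c d) * e12 t"
proof -
  have "[t * eta_exponent a (a + b) c (c + d) = t * (eta_exponent a b c d + 1)] (mod 12)"
    by (intro cong_mult eta_exponent_T assms cong_refl)
  from e12_cong[OF this] show ?thesis by (simp add: ring_distribs e12_add)
qed

lemma e12_eta_exponent_S:
  assumes "a * d - b * c = 1"
  shows "e12 (t * eta_exponent b (- a) d (- c)) = e12 (t * eta_exponent a b c d) * e12 (- 3 * t)"
proof -
  have "[t * eta_exponent b (- a) d (- c) = t * (eta_exponent a b c d - 3)] (mod 12)"
    by (intro cong_mult eta_exponent_S assms cong_refl)
  from e12_cong[OF this] show ?thesis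
    by (simp add: algebra_simps flip: e12_add)
qed

lemma transforms_T_iff:
  assumes det: "a * d - b * c = 1"
  shows "transforms f k t a (a + b) c (c + d) \<longleftrightarrow> transforms f k t a b c d"
proof
  assume *: "transforms f k t a b c d"
  show "transforms f k t a (a + b) c (c + d)"
    unfolding transforms_def
  proof safe
    fix z assume z: "Im z > 0"
    have "f ((of_int a * (z + 1) + of_int b) / (of_int c * (z + 1) + of_int d)) =
     e12 (t * eta_exponent a b c d) * (of_int c * (z + 1) + of_int d) powi k * f (z + 1)"
      using * z unfolding transforms_def by simp
    thus "f ((of_int a * z + of_int (a + b)) / (of_int c * z + of_int (c + d))) =
      e12 (t * eta_exponent a (a + b) c (c + d)) * (of_int c * z + of_int (c + d)) powi k * f z"
      unfolding e12_eta_exponent_T[OF det] T[OF z] by (simp add: algebra_simps)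
  qed
next
  assume *: "transforms f k t a (a + b) c (c + d)"
  show "transforms f k t a b c d"
    unfolding transforms_def
  proof safe
    fix z assume z: "Im z > 0"
    hence z': "Im (z - 1) > 0" by simp
    have "f ((of_int a * (z - 1) + of_int (a + b)) / (of_int c * (z - 1) + of_int (c + d))) =
     e12 (t * eta_exponent a (a + b) c (c + d)) * (of_int c * (z - 1) + of_int (c + d)) powi k * f (z - 1)"
      using * z' unfolding transforms_def by blast
    moreover have "f z = e12 t * f (z - 1)" using T[OF z'] by simp
    ultimately show "f ((of_int a * z + of_int b) / (of_int c * z + of_int d)) =
      e12 (t * eta_exponent a b c d) * (of_int c * z + of_int d) powi k * f z"
      unfolding e12_eta_exponent_T[OF det] by (simp add: algebra_simps)
  qed
qed

lemma transforms_S: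
  assumes det: "a * d - b * c = 1" and *: "transforms f k t a b c d"
  shows "transforms f k t b (- a) d (- c)"
  unfolding transforms_def
proof safe
  fix z assume z: "Im z > 0"
  have z0: "z \<noteq> 0" using z by auto
  have "f ((of_int a * (- 1 / z) + of_int b) / (of_int c * (- 1 / z) + of_int d)) =
     e12 (t * eta_exponent a b c d) * (of_int c * (- 1 / z) + of_int d) powi k * f (- 1 / z)"
    using * Im_minus_inverse_pos[OF z] unfolding transforms_def by blast
  moreover have "of_int c * (- 1 / z) + of_int d = (of_int d * z + of_int (- c)) / z"
    "of_int a * (- 1 / z) + of_int b = (of_int b * z + of_int (- a)) / z"
    using z0 by (simp_all add: field_simps)
  ultimately have "f ((of_int b * z + of_int (- a)) / (of_int d * z + of_int (- c))) =
      e12 (t * eta_exponent a b c d) * ((of_int d * z + of_int (- c)) / z) powi k * (e12 (- 3 * t) * z powi k * f z)"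
    unfolding S[OF z] using z0 by simp
  also have "\<dots> = e12 (t * eta_exponent b (- a) d (- c)) * (of_int d * z + of_int (- c)) powi k * f z"
    unfolding e12_eta_exponent_S[OF det] power_int_divide_distrib using z0 by simp
  finally show "f ((of_int b * z + of_int (- a)) / (of_int d * z + of_int (- c))) = \<dots>" .
qed

text \<open>S has order four, so three more applications lead back to the original matrix.\<close>

lemma transforms_S_iff:
  assumes det: "a * d - b * c = 1"
  shows "transforms f k t b (- a) d (- c) \<longleftrightarrow> transforms f k t a b c d"
proof
  assume 1: "transforms f k t b (- a) d (- c)"
  from transforms_S[OF _ this] have 2: "transforms f k t (- a) (- b) (- c) (- d)"
    using det by (simp add: algebra_simps)
  from transforms_S[OF _ this] have 3: "transforms f k t (- b) a (- d) c"
    using det by (simp add: algebra_simps)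
  from transforms_S[OF _ this] show "transforms f k t a b c d"
    using det by (simp add: algebra_simps)
qed (rule transforms_S[OF det])

lemma transforms_T_power_iff:
  assumes det: "a * d - b * c = 1"
  shows "transforms f k t a (b + n * a) c (d + n * c) \<longleftrightarrow> transforms f k t a b c d"
proof (induction n rule: int_induct[where k = 0])
  case (step1 i)
  have "a * (d + i * c) - (b + i * a) * c = 1" using det by (simp add: algebra_simps)
  from transforms_T_iff[OF this] step1 show ?case by (simp add: algebra_simps)
next
  case (step2 i)
  have "a * (d + (i - 1) * c) - (b + (i - 1) * a) * c = 1" using det by (simp add: algebra_simps)
  from transforms_T_iff[OF this] step2 show ?case by (simp add: algebra_simps)
qed simp

text \<open>Euclid's algorithm on the bottom row.\<close>
lemma transforms_all:
  assumes "a * d - b * c = 1"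
  shows "transforms f k t a b c d"
  using assms
proof (induction "nat \<bar>c\<bar>" arbitrary: a b c d rule: less_induct)
  case less
  show ?case
  proof (cases "c = 0")
    case True
    have 1: "transforms f k t 1 b' 0 1" for b'
      using transforms_T_power_iff[of 1 1 0 0 b'] by (simp add: transforms_def eta_exponent_def)
    have "a * d = 1" using less.prems True by simp
    hence "a = 1 \<and> d = 1 \<or> a = -1 \<and> d = -1" by (auto simp: zmult_eq_1_iff)
    thus ?thesis
    proof
      \<comment> \<open>Minus the identity is the square of S, so two applications of S to the
        translation by \<open>- b\<close> give this matrix.\<close>
      assume "a = -1 \<and> d = -1"
      thus ?thesis
        using True transforms_S[OF _ transforms_S[OF _ 1[of "- b"]]] by simp
    qed (use True 1 in simp)
  next
    case False
    define n where "n = - (d div c)"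
    have dn: "d + n * c = d mod c"
      by (simp add: n_def algebra_simps minus_mult_div_eq_mod)
    have det: "a * (d + n * c) - (b + n * a) * c = 1" using less.prems by (simp add: algebra_simps)
    have "\<bar>d mod c\<bar> < \<bar>c\<bar>" using False by (rule abs_mod_less)
    hence lt: "nat \<bar>d + n * c\<bar> < nat \<bar>c\<bar>" unfolding dn by simp
    have "transforms f k t (b + n * a) (- a) (d + n * c) (- c)"
      by (rule less.hyps[OF lt]) (use det in \<open>simp add: algebra_simps\<close>)
    hence "transforms f k t a (b + n * a) c (d + n * c)"
      using transforms_S_iff[OF det] by simp
    thus ?thesis using transforms_T_power_iff[OF less.prems] by simp
  qed
qed

end

section \<open>Integral forms with the multiplier of a power of eta^2\<close>

definition ev :: "complex fls \<Rightarrow> complex \<Rightarrow> complex" where "ev A z = eval_fls A (q12 z)"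

text \<open>
  Weakly holomorphic integral forms of weight \<open>k\<close> with the multiplier of \<open>\<eta>\<^bsup>2t\<^esup>\<close>, as Laurent series in
  \<open>q\<^bsup>1/12\<^esup>\<close>. The transformation under \<open>z \<mapsto> z + 1\<close> is the condition on the exponents.
\<close>
definition eta_forms :: "int \<Rightarrow> int \<Rightarrow> complex fls set" where
  "eta_forms k t = {A \<in> int_fls. fls_conv_radius A \<ge> 1 \<and> (\<forall>n. A $$ n \<noteq> 0 \<longrightarrow> [n = t] (mod 12)) \<and>
     (\<forall>z. Im z > 0 \<longrightarrow> ev A (- 1 / z) = e12 (- 3 * t) * z powi k * ev A z)}"

lemma eta_formsD:
  assumes "A \<in> eta_forms k t"
  shows "A \<in> int_fls" "fls_conv_radius A \<ge> 1" "A $$ n \<noteq> 0 \<Longrightarrow> [n = t] (mod 12)"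
    "Im z > 0 \<Longrightarrow> ev A (- 1 / z) = e12 (- 3 * t) * z powi k * ev A z"
  using assms by (auto simp: eta_forms_def)

lemma norm_q12_less_radius: "Im z > 0 \<Longrightarrow> R \<ge> 1 \<Longrightarrow> ereal (norm (q12 z)) < R"
  using norm_q12_less[of z] by (meson ereal_less(3) less_le_trans)

lemma has_sum_ev:
  assumes "fls_conv_radius A \<ge> 1" "Im z > 0"
  shows "((\<lambda>n. A $$ n * q12 z powi n) has_sum ev A z) UNIV"
  unfolding ev_def using assms norm_q12_less[of z] by (intro has_sum_eval_fls) auto

lemma q12_add: "q12 (z + w) = q12 z * q12 w"
  by (simp add: q12_def ring_distribs add_divide_distrib flip: exp_add)

lemma ev_shift:
  assumes A: "A \<in> eta_forms k t" and z: "Im z > 0"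
  shows "ev A (z + 1) = e12 t * ev A z"
proof -
  have z1: "Im (z + 1) > 0" using z by simp
  have "((\<lambda>n. A $$ n * q12 (z + 1) powi n) has_sum ev A (z + 1)) UNIV"
    by (rule has_sum_ev[OF eta_formsD(2)[OF A] z1])
  moreover have "A $$ n * q12 (z + 1) powi n = e12 t * (A $$ n * q12 z powi n)" for n
  proof (cases "A $$ n = 0")
    case False
    have "q12 1 = e12 1" by (simp add: q12_def e12_def)
    hence "q12 (z + 1) powi n = q12 z powi n * e12 n"
      by (simp add: q12_add power_int_mult_distrib e12_powi)
    also have "e12 n = e12 t" by (rule e12_cong[OF eta_formsD(3)[OF A False]])
    finally show ?thesis by simp
  qed simp
  ultimately have "((\<lambda>n. e12 t * (A $$ n * q12 z powi n)) has_sum ev A (z + 1)) UNIV" by simp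
  moreover have "((\<lambda>n. e12 t * (A $$ n * q12 z powi n)) has_sum e12 t * ev A z) UNIV"
    by (intro has_sum_cmult_right has_sum_ev eta_formsD(2)[OF A] z)
  ultimately show ?thesis by (rule has_sum_unique)
qed

lemma ev_transforms:
  assumes A: "A \<in> eta_forms k t" and det: "a * d - b * c = 1"
  shows "transforms (ev A) k t a b c d"
  by (rule transforms_all[OF ev_shift[OF A] eta_formsD(4)[OF A] det])

lemma ev_mult:
  assumes "fls_conv_radius A \<ge> 1" "fls_conv_radius B \<ge> 1" "Im z > 0"
  shows "ev (A * B) z = ev A z * ev B z"
  unfolding ev_def by (rule eval_fls_mult) (use assms in \<open>auto intro: norm_q12_less_radius\<close>)

lemma ev_add:
  assumes "fls_conv_radius A \<ge> 1" "fls_conv_radius B \<ge> 1" "Im z > 0"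
  shows "ev (A + B) z = ev A z + ev B z"
  unfolding ev_def by (rule eval_fls_add) (use assms in \<open>auto intro: norm_q12_less_radius\<close>)

lemma eta_forms_mult:
  assumes A: "A \<in> eta_forms k s" and B: "B \<in> eta_forms l t"
  shows "A * B \<in> eta_forms (k + l) (s + t)"
  unfolding eta_forms_def
proof (intro CollectI conjI allI impI)
  note a = eta_formsD[OF A] and b = eta_formsD[OF B]
  show "A * B \<in> int_fls" using a(1) b(1) by (rule int_fls_mult)
  show "fls_conv_radius (A * B) \<ge> 1"
    by (rule fls_conv_radius_mult_ge[OF a(2) b(2)])
  show "[n = s + t] (mod 12)" if n: "(A * B) $$ n \<noteq> 0" for n
  proof -
    obtain i where i: "A $$ i * B $$ (n - i) \<noteq> 0"
      using sum.not_neutral_contains_not_neutral[OF n[unfolded fls_times_nth(2)]] by blast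
    hence "A $$ i \<noteq> 0" "B $$ (n - i) \<noteq> 0" by auto
    from a(3)[OF this(1)] b(3)[OF this(2)] have "[i = s] (mod 12)" "[n - i = t] (mod 12)" by this+
    hence "[i + (n - i) = s + t] (mod 12)" by (rule cong_add)
    thus ?thesis by simp
  qed
  fix z :: complex assume z: "Im z > 0"
  have z0: "z \<noteq> 0" using z by (rule Im_pos_nonzero)
  show "ev (A * B) (- 1 / z) = e12 (- 3 * (s + t)) * z powi (k + l) * ev (A * B) z"
    unfolding ev_mult[OF a(2) b(2) Im_minus_inverse_pos[OF z]] ev_mult[OF a(2) b(2) z] a(4)[OF z] b(4)[OF z]
    unfolding distrib_left e12_add power_int_add[OF disjI1[OF z0]] by (simp only: mult_ac)
qed

lemma eta_forms_add:
  assumes A: "A \<in> eta_forms k t" and B: "B \<in> eta_forms k t"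
  shows "A + B \<in> eta_forms k t"
  unfolding eta_forms_def
proof (intro CollectI conjI allI impI)
  note a = eta_formsD[OF A] and b = eta_formsD[OF B]
  show "A + B \<in> int_fls" using a(1) b(1) by auto
  show "fls_conv_radius (A + B) \<ge> 1"
    by (rule fls_conv_radius_add_ge[OF a(2) b(2)])
  show "[n = t] (mod 12)" if "(A + B) $$ n \<noteq> 0" for n
    using that a(3)[of n] b(3)[of n] by (cases "A $$ n = 0") auto
  fix z :: complex assume z: "Im z > 0"
  show "ev (A + B) (- 1 / z) = e12 (- 3 * t) * z powi k * ev (A + B) z"
    using z Im_minus_inverse_pos[OF z] a(4)[OF z] b(4)[OF z]
    by (simp add: ev_add a(2) b(2) ring_distribs)
qed

lemma fls_conv_radius_of_int [simp]: "fls_conv_radius (of_int c) = \<infinity>"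
  using fls_conv_radius_fps_to_fls[of "of_int c"] by (simp add: fps_of_int fps_to_fls_of_int)

lemma ev_of_int [simp]: "ev (of_int c) z = of_int c"
  using eval_fps_to_fls[of "q12 z" "of_int c"] by (simp add: ev_def fps_to_fls_of_int)

lemma eta_forms_of_int: "of_int c \<in> eta_forms 0 0"
  by (auto simp: eta_forms_def fls_of_int_nth split: if_splits)

lemma eta_forms_cong: "[s = t] (mod 12) \<Longrightarrow> eta_forms k s = eta_forms k t"
proof -
  assume *: "[s = t] (mod 12)"
  hence "e12 (- 3 * s) = e12 (- 3 * t)" by (intro e12_cong cong_mult) auto
  moreover have "[n = s] (mod 12) \<longleftrightarrow> [n = t] (mod 12)" for n using * by (metis cong_sym cong_trans)
  ultimately show ?thesis by (simp add: eta_forms_def)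
qed

lemma eta_forms_1: "1 \<in> eta_forms 0 0"
  using eta_forms_of_int[of 1] by simp

lemma eta_forms_0: "0 \<in> eta_forms k t"
  by (auto simp: eta_forms_def ev_def)

lemma eta_forms_of_int_mult: "A \<in> eta_forms k t \<Longrightarrow> of_int c * A \<in> eta_forms k t"
  using eta_forms_mult[OF eta_forms_of_int[of c]] by fastforce

lemma eta_forms_power: "A \<in> eta_forms k t \<Longrightarrow> A ^ n \<in> eta_forms (int n * k) (int n * t)"
proof (induction n)
  case (Suc n)
  thus ?case using eta_forms_mult[OF Suc.prems Suc.IH] by (simp add: ring_distribs)
qed (simp add: eta_forms_1)

subsection \<open>Hecke operators\<close>

lemma fls_of_int_mult_nth: "(of_int c * A) $$ n = of_int c * A $$ n"
  by (simp add: fls_of_int)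

lemma ev_compose_power:
  assumes "fls_conv_radius A \<ge> 1" "m > 0" "Im z > 0"
  shows "ev (fls_compose_power A m) z = ev A (of_nat m * z)"
  unfolding ev_def using assms norm_q12_less[of z]
  by (subst eval_fls_compose_power) (auto simp: q12_power)

text \<open>The translates are by \<open>12 * j / m\<close> because U acts on exponents of q^(1/12),
  a function of period 12.\<close>

lemma ev_U:
  assumes "fls_conv_radius A \<ge> 1" and m: "m > 0" and z: "Im z > 0"
  shows "of_nat m * ev (fls_U m A) z = (\<Sum>j<m. ev A ((z + 12 * of_nat j) / of_nat m))"
proof -
  define y where "y = q12 (z / of_nat m)"
  have Im: "Im (z / of_nat m) > 0" using m z by (simp add: Im_divide_of_nat)
  have y: "0 < norm y" "norm y < 1"
    unfolding y_def using norm_q12_less[OF Im] by auto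
  have ym: "y ^ m = q12 z" using m unfolding y_def q12_power by simp
  have "y * exp (2 * of_real pi * \<i> * of_nat j / of_nat m) = q12 ((z + 12 * of_nat j) / of_nat m)" for j
  proof -
    have "exp (2 * of_real pi * \<i> * of_nat j / of_nat m) = q12 (12 * of_nat j / of_nat m)"
      by (simp add: q12_def mult_ac)
    thus ?thesis by (simp add: y_def add_divide_distrib q12_add)
  qed
  with eval_fls_U[OF assms(1) m y] show ?thesis
    by (simp add: ev_def ym)
qed

lemma square_mod_24:
  assumes "coprime (m :: nat) 12"
  shows "odd m" and "[m * m = 1] (mod 24)"
proof -
  have nd: "\<not> p dvd m" if "p dvd 12" "p \<noteq> 1" for p
    using assms that coprime_common_divisor_nat by blast
  have m: "odd m" "\<not> 3 dvd m" by (intro nd; simp)+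
  show "odd m" by fact
  define a where "a = m mod 24"
  have "a = 1 \<or> a = 5 \<or> a = 7 \<or> a = 11 \<or> a = 13 \<or> a = 17 \<or> a = 19 \<or> a = 23"
    using m unfolding a_def by presburger
  hence "(a * a) mod 24 = 1" by auto
  moreover have "(m * m) mod 24 = (a * a) mod 24" unfolding a_def by (simp add: mod_mult_eq)
  ultimately show "[m * m = 1] (mod 24)" by (simp add: cong_def)
qed

lemma coprime_12_dvd:
  assumes "coprime (m :: nat) 12"
  shows "12 dvd (1 - int m * int m)"
proof -
  have "[int (m * m) = int 1] (mod int 24)"
    using square_mod_24(2)[OF assms] by (simp only: cong_int_iff)
  hence "24 dvd (int m * int m - 1)" by (simp add: cong_iff_dvd_diff)
  thus ?thesis by presburger
qed

text \<open>With \<open>144 * j * j' + 1 = m * e\<close>, the matrix with rows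
  \<open>12 * j\<close>, \<open>- e\<close> and \<open>m\<close>, \<open>- 12 * j'\<close> has
  determinant 1. It maps \<open>(z + 12 * j') / m\<close> to \<open>(- 1 / z + 12 * j) / m\<close>
  with automorphy factor \<open>z\<close>. Its diagonal is 0 and \<open>m * m\<close> is 1 modulo
  12, so the multiplier depends on \<open>m\<close> and \<open>t\<close> only.\<close>

lemma ev_S_translate:
  fixes j j' m :: nat
  assumes A: "A \<in> eta_forms k t" and m: "m > 0" "coprime m 12"
    and j: "int m dvd 144 * int j * int j' + 1" and z: "Im z > 0"
  shows "ev A ((- 1 / z + 12 * of_nat j) / of_nat m) =
         e12 (- 3 * (int m * t)) * z powi k * ev A ((z + 12 * of_nat j') / of_nat m)"
proof -
  have z0: "z \<noteq> 0" using z by (rule Im_pos_nonzero)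
  obtain e where e: "144 * int j * int j' + 1 = int m * e" using j by blast
  define w where "w = (z + 12 * of_nat j') / of_nat m"
  have w: "Im w > 0" using m z by (simp add: w_def Im_divide_of_nat)
  have "(12 * int j) * (- 12 * int j') - (- e) * int m = 1"
    using e by (simp add: algebra_simps)
  from ev_transforms[OF A this]
  have "ev A ((of_int (12 * int j) * w + of_int (- e)) / (of_int (int m) * w + of_int (- 12 * int j'))) =
     e12 (t * eta_exponent (12 * int j) (- e) (int m) (- 12 * int j')) *
       (of_int (int m) * w + of_int (- 12 * int j')) powi k * ev A w"
    using w unfolding transforms_def by blast
  moreover have den: "of_int (int m) * w + of_int (- 12 * int j') = z"
    using m by (simp add: w_def field_simps)
  moreover have "(of_int (12 * int j) * w + of_int (- e)) / z = (- 1 / z + 12 * of_nat j) / of_nat m"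
  proof -
    have e': "of_nat m * of_int e = 144 * of_nat j * of_nat j' + (1 :: complex)"
      using arg_cong[OF e, of "of_int :: int \<Rightarrow> complex"] by simp
    have "of_nat m * (of_int (12 * int j) * w + of_int (- e)) = 12 * of_nat j * (z + 12 * of_nat j') - of_nat m * of_int e"
      using m by (simp add: w_def field_simps)
    also have "\<dots> = 12 * of_nat j * z - 1" unfolding e' by (simp add: algebra_simps)
    finally have eq: "of_nat m * (of_int (12 * int j) * w + of_int (- e)) = 12 * of_nat j * z - 1" .
    have "of_int (12 * int j) * w + of_int (- e) = of_nat m * (of_int (12 * int j) * w + of_int (- e)) / of_nat m"
      using m by simp
    also have "\<dots> = (12 * of_nat j * z - 1) / of_nat m" by (simp only: eq)
    finally show ?thesis using z0 m by (simp add: divide_simps)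
  qed
  moreover have "e12 (t * eta_exponent (12 * int j) (- e) (int m) (- 12 * int j')) = e12 (- 3 * (int m * t))"
  proof (rule e12_cong)
    have "[(1 - int m * int m) * (- e * (- 12 * int j') + 3 * (int m - 1) * (- 12 * int j') + int m + 3) = 0] (mod 12)"
      using coprime_12_dvd[OF m(2)] by (simp add: cong_0_iff)
    moreover have "[int m * (12 * int j + (- 12 * int j') - 3) = int m * (0 + 0 - 3)] (mod 12)"
      by (intro cong_mult cong_add cong_diff cong_refl) (auto simp: cong_0_iff)
    ultimately have "[eta_exponent (12 * int j) (- e) (int m) (- 12 * int j') = 0 + int m * (0 + 0 - 3)] (mod 12)"
      unfolding eta_exponent_def by (rule cong_add)
    hence "[t * eta_exponent (12 * int j) (- e) (int m) (- 12 * int j') = t * (0 + int m * (0 + 0 - 3))] (mod 12)"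
      by (intro cong_mult cong_refl)
    thus "[t * eta_exponent (12 * int j) (- e) (int m) (- 12 * int j') = - 3 * (int m * t)] (mod 12)"
      by (simp add: mult_ac)
  qed
  ultimately show ?thesis unfolding w_def[symmetric] by simp
qed

lemma reindex_negative_inverses:
  fixes m :: nat
  assumes m: "prime m" "coprime m 12"
  obtains \<sigma> where "bij_betw \<sigma> {1..<m} {1..<m}"
    "\<And>j. j \<in> {1..<m} \<Longrightarrow> int m dvd 144 * int j * int (\<sigma> j) + 1"
proof -
  have m1: "m > 1" using m(1) by (rule prime_gt_1_nat)
  have cop: "coprime (144 * j) m" if "j \<in> {1..<m}" for j
  proof -
    have "coprime j m" using that m(1) by (metis atLeastLessThan_iff coprime_commute less_le_trans
      not_le nat_dvd_not_less prime_imp_coprime_nat zero_less_one)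
    moreover have "coprime (12 * 12) m" using m(2) unfolding coprime_mult_left_iff by (simp add: coprime_commute)
    ultimately show ?thesis by simp
  qed
  have ex: "\<exists>s. s \<in> {1..<m} \<and> int m dvd 144 * int j * int s + 1" if j: "j \<in> {1..<m}" for j
  proof -
    obtain x where x: "[144 * j * x = 1] (mod m)"
      using cong_solve_coprime_nat[OF cop[OF j]] by auto
    \<comment> \<open>The factor \<open>m - 1\<close> stands for -1 in natural numbers, so
      \<open>s\<close> represents the negative inverse of \<open>144 * j\<close>.\<close>
    define s where "s = (x * (m - 1)) mod m"
    have "[144 * j * s = 144 * j * (x * (m - 1))] (mod m)"
      by (intro cong_mult cong_refl) (simp add: s_def cong_def)
    also have "144 * j * (x * (m - 1)) = 144 * j * x * (m - 1)" by (simp only: mult.assoc)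
    also have "[144 * j * x * (m - 1) = 1 * (m - 1)] (mod m)"
      by (intro cong_mult x cong_refl)
    finally have "[144 * j * s + 1 = 1 * (m - 1) + 1] (mod m)"
      by (rule cong_add[OF _ cong_refl])
    hence *: "m dvd 144 * j * s + 1" using m1 by (simp add: cong_def dvd_eq_mod_eq_0)
    have "s \<noteq> 0"
    proof
      assume "s = 0"
      hence "m dvd 1" using * by simp
      thus False using m1 by simp
    qed
    moreover have "s < m" using m1 by (simp add: s_def)
    moreover have "int m dvd 144 * int j * int s + 1"
    proof -
      have "144 * int j * int s + 1 = int (144 * j * s + 1)" by simp
      thus ?thesis using * by (simp only: of_nat_dvd_iff)
    qed
    ultimately show ?thesis by (intro exI[of _ s]) simp
  qed
  then obtain \<sigma> where \<sigma>: "\<And>j. j \<in> {1..<m} \<Longrightarrow> \<sigma> j \<in> {1..<m} \<and> int m dvd 144 * int j * int (\<sigma> j) + 1"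
    by metis
  have "inj_on \<sigma> {1..<m}"
  proof (rule inj_onI)
    fix i j assume i: "i \<in> {1..<m}" and j: "j \<in> {1..<m}" and eq: "\<sigma> i = \<sigma> j"
    have "int m dvd (144 * int i * int (\<sigma> i) + 1) - (144 * int j * int (\<sigma> i) + 1)"
      using \<sigma>[OF i] \<sigma>[OF j] unfolding eq by (intro dvd_diff) auto
    also have "\<dots> = int (144 * \<sigma> i) * (int i - int j)" by (simp add: algebra_simps)
    finally have "int m dvd int i - int j"
      using cop[of "\<sigma> i"] \<sigma>[OF i] by (metis coprime_commute coprime_dvd_mult_right_iff coprime_int_iff)
    moreover have "\<bar>int i - int j\<bar> < int m" using i j by auto
    ultimately have "int i - int j = 0" using dvd_imp_le_int[of "int i - int j" "int m"] by fastforce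
    thus "i = j" by simp
  qed
  moreover have "\<sigma> ` {1..<m} = {1..<m}"
    by (rule endo_inj_surj) (use \<sigma> calculation in auto)
  ultimately show ?thesis using \<sigma> by (intro that[of \<sigma>]) (auto simp: bij_betw_def)
qed

text \<open>
  The Hecke operator \<open>T\<^sub>m\<close>. The sign comes from the value of the multiplier system at
  a matrix congruent to \<open>m\<close> times the identity modulo 12.
\<close>
theorem hecke:
  assumes A: "A \<in> eta_forms k t" and m: "prime m" "coprime m 12" and k: "k \<le> 1"
  obtains \<epsilon> :: int where "\<epsilon> \<in> {1, - 1}"
    "fls_compose_power A m + of_int (\<epsilon> * int m ^ nat (1 - k)) * fls_U m A \<in> eta_forms k (int m * t)"
proof -
  note a = eta_formsD[OF A]
  have m0: "m > 0" using m by (simp add: prime_gt_0_nat)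
  \<comment> \<open>The exponents \<open>- 3 * t\<close> before and \<open>- 3 * (int m * t)\<close>
    after the operator differ by \<open>6 * h\<close>, and \<open>e12 (6 * h)\<close> is a
    sign.\<close>
  define h where "h = ((int m - 1) div 2) * t"
  have h: "2 * h = (int m - 1) * t"
    using square_mod_24(1)[OF m(2)] by (simp add: h_def)
  define \<epsilon> :: int where "\<epsilon> = (if even h then 1 else - 1)"
  have eps_sq: "\<epsilon> * \<epsilon> = 1" by (simp add: \<epsilon>_def)
  have "of_int \<epsilon> = e12 (6 * h)"
  proof (cases "even h")
    case True
    then obtain g where "6 * h = 12 * g" by auto
    thus ?thesis using True by (simp add: \<epsilon>_def e12_12)
  next
    case False
    then obtain g where "6 * h = 12 * g + 6" by (auto elim!: oddE)
    thus ?thesis using False by (simp add: \<epsilon>_def e12_12 e12_add e12_6)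
  qed
  hence eps: "e12 (- 3 * t) = of_int \<epsilon> * e12 (- 3 * (int m * t))"
  proof -
    have "- 3 * t = 6 * h + - 3 * (int m * t)" using h by (simp add: algebra_simps)
    thus ?thesis by (simp only: e12_add \<open>of_int \<epsilon> = e12 (6 * h)\<close>)
  qed
  \<comment> \<open>The usual operator is scaled by m^(1-k): the composition with the
    \<open>m\<close>th power then has coefficient 1, and the factor in front of U is integral
    because \<open>k \<le> 1\<close>.\<close>
  define c where "c = int m ^ nat (1 - k)"
  define d where "d = \<epsilon> * c"
  define B where "B = fls_compose_power A m + of_int d * fls_U m A"
  define f where "f = ev A"
  define F where "F = (\<lambda>z. \<Sum>j<m. f ((z + 12 * of_nat j) / of_nat m))"
  have rV: "fls_conv_radius (fls_compose_power A m) \<ge> 1" by (rule fls_conv_radius_compose_power[OF a(2) m0])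
  have rU: "fls_conv_radius (fls_U m A) \<ge> 1" by (rule fls_conv_radius_U[OF a(2) m0])
  have rU': "fls_conv_radius (of_int d * fls_U m A) \<ge> 1"
    by (intro fls_conv_radius_mult_ge rU) simp
  have c_powi: "of_int c = of_nat m * of_nat m powi (- k :: int) * (1 :: complex)"
  proof -
    have "of_int c = (of_nat m powi (1 - k) :: complex)"
      using k by (simp add: c_def power_int_def)
    also have "\<dots> = of_nat m * of_nat m powi (- k)"
      using m0 power_int_add[of "of_nat m :: complex" 1 "- k"] by simp
    finally show ?thesis by simp
  qed
  have evB: "ev B z = f (of_nat m * z) + of_int \<epsilon> * of_nat m powi (- k) * F z" if z: "Im z > 0" for z
  proof -
    have "ev B z = ev (fls_compose_power A m) z + ev (of_int d * fls_U m A) z"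
      unfolding B_def by (rule ev_add[OF rV rU' z])
    also have "ev (of_int d * fls_U m A) z = of_int d * ev (fls_U m A) z"
      using ev_mult[OF _ rU z, of "of_int d"] by simp
    also have "of_int d = of_int \<epsilon> * (of_nat m * of_nat m powi (- k) :: complex)"
      using c_powi by (simp add: d_def)
    finally have "ev B z = f (of_nat m * z) + of_int \<epsilon> * of_nat m powi (- k) * (of_nat m * ev (fls_U m A) z)"
      using ev_compose_power[OF a(2) m0 z] by (simp add: f_def)
    also have "of_nat m * ev (fls_U m A) z = F z"
      unfolding F_def f_def by (rule ev_U[OF a(2) m0 z])
    finally show ?thesis .
  qed
  have "B \<in> eta_forms k (int m * t)"
    unfolding eta_forms_def
  proof (intro CollectI conjI allI impI)
    show "B \<in> int_fls" unfolding B_def using a(1) m0 by (intro int_fls_add int_fls_mult) auto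
    show "fls_conv_radius B \<ge> 1" unfolding B_def by (rule fls_conv_radius_add_ge[OF rV rU'])
    show "[n = int m * t] (mod 12)" if n: "B $$ n \<noteq> 0" for n
    proof -
      have "fls_compose_power A m $$ n \<noteq> 0 \<or> (of_int d * fls_U m A) $$ n \<noteq> 0"
        using n unfolding B_def by auto
      moreover have "(of_int d * fls_U m A) $$ n = of_int d * fls_U m A $$ n"
        by (rule fls_of_int_mult_nth)
      ultimately consider "fls_compose_power A m $$ n \<noteq> 0" | "A $$ (int m * n) \<noteq> 0"
        using m0 by auto
      thus ?thesis
      proof cases
        case 1
        then obtain i where i: "n = int m * i" "A $$ i \<noteq> 0"
          using m0 by (auto simp: fls_nth_compose_power split: if_splits)
        from cong_mult[OF cong_refl a(3)[OF i(2)]] show ?thesis unfolding i(1) .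
      next
        case 2
        have "[1 * n = int m * int m * n] (mod 12)"
          using coprime_12_dvd[OF m(2)] by (intro cong_mult cong_refl) (simp add: cong_iff_dvd_diff)
        also have "int m * int m * n = int m * (int m * n)" by simp
        also have "[int m * (int m * n) = int m * t] (mod 12)"
          by (intro cong_mult cong_refl a(3) 2)
        finally show ?thesis by simp
      qed
    qed
  next
    fix z :: complex assume z: "Im z > 0"
    have z0: "z \<noteq> 0" using z by (rule Im_pos_nonzero)
    define E where "E = e12 (- 3 * (int m * t))"
    \<comment> \<open>Under \<open>z \<mapsto> - 1 / z\<close> the summand at \<open>m * z\<close>
      and the one at \<open>z / m\<close>, which is the term \<open>j = 0\<close> of
      \<open>F\<close>, change places; the terms with \<open>j \<ge> 1\<close> are permuted by
      \<open>\<sigma>\<close>.\<close>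
    have f1: "f (of_nat m * (- 1 / z)) = of_int \<epsilon> * E * (z powi k * of_nat m powi (- k)) * f (z / of_nat m)"
    proof -
      have "Im (z / of_nat m) > 0" using m0 z by (simp add: Im_divide_of_nat)
      from a(4)[OF this] have "f (- 1 / (z / of_nat m)) = e12 (- 3 * t) * (z / of_nat m) powi k * f (z / of_nat m)"
        unfolding f_def .
      moreover have "- 1 / (z / of_nat m) = of_nat m * (- 1 / z)" by simp
      moreover have "(z / of_nat m) powi k = z powi k * of_nat m powi (- k)"
        by (subst power_int_divide_distrib, subst power_int_minus, rule divide_inverse)
      ultimately show ?thesis unfolding eps E_def by simp
    qed
    have f2: "f (- 1 / z / of_nat m) = of_int \<epsilon> * E * (of_nat m powi k * z powi k) * f (of_nat m * z)"
    proof -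
      have "Im (of_nat m * z) > 0" using m0 z by simp
      from a(4)[OF this] have "f (- 1 / (of_nat m * z)) = e12 (- 3 * t) * (of_nat m * z) powi k * f (of_nat m * z)"
        unfolding f_def .
      moreover have "- 1 / z / of_nat m = - 1 / (of_nat m * z)" by (simp add: mult.commute)
      ultimately show ?thesis unfolding eps E_def power_int_mult_distrib by (simp only: mult.assoc)
    qed
    have F_split: "F w = f (w / of_nat m) + (\<Sum>j\<in>{1..<m}. f ((w + 12 * of_nat j) / of_nat m))" for w
    proof -
      have "{..<m} = insert 0 {1..<m}" using m0 by auto
      thus ?thesis unfolding F_def by simp
    qed
    obtain \<sigma> where \<sigma>: "bij_betw \<sigma> {1..<m} {1..<m}"
      "\<And>j. j \<in> {1..<m} \<Longrightarrow> int m dvd 144 * int j * int (\<sigma> j) + 1"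
      using reindex_negative_inverses[OF m] by metis
    have "(\<Sum>j\<in>{1..<m}. f ((- 1 / z + 12 * of_nat j) / of_nat m)) =
       (\<Sum>j\<in>{1..<m}. E * z powi k * f ((z + 12 * of_nat (\<sigma> j)) / of_nat m))"
      unfolding f_def E_def by (intro sum.cong ev_S_translate[OF A m0 m(2)] \<sigma>(2) z refl)
    also have "\<dots> = E * z powi k * (\<Sum>j\<in>{1..<m}. f ((z + 12 * of_nat (\<sigma> j)) / of_nat m))"
      by (simp add: sum_distrib_left)
    also have "(\<Sum>j\<in>{1..<m}. f ((z + 12 * of_nat (\<sigma> j)) / of_nat m)) = (\<Sum>j\<in>{1..<m}. f ((z + 12 * of_nat j) / of_nat m))"
      by (rule sum.reindex_bij_betw[OF \<sigma>(1)])
    also have "\<dots> = F z - f (z / of_nat m)" using F_split[of z] by simp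
    finally have F_S: "F (- 1 / z) = of_int \<epsilon> * E * (of_nat m powi k * z powi k) * f (of_nat m * z)
        + E * z powi k * (F z - f (z / of_nat m))"
      unfolding F_split[of "- 1 / z"] f2 by simp
    have mk: "of_nat m powi (- k) * of_nat m powi k = (1 :: complex)"
      using m0 by (simp add: power_int_minus)
    have eps2: "of_int \<epsilon> * of_int \<epsilon> = (1 :: complex)" using eps_sq by (metis of_int_1 of_int_mult)
    have "ev B (- 1 / z) = of_int \<epsilon> * E * (z powi k * of_nat m powi (- k)) * f (z / of_nat m) +
       of_int \<epsilon> * of_nat m powi (- k) * (of_int \<epsilon> * E * (of_nat m powi k * z powi k) * f (of_nat m * z)
        + E * z powi k * (F z - f (z / of_nat m)))"
      unfolding evB[OF Im_minus_inverse_pos[OF z]] f1 F_S ..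
    also have "\<dots> = (of_int \<epsilon> * of_int \<epsilon>) * (of_nat m powi (- k) * of_nat m powi k) * (E * z powi k * f (of_nat m * z)) +
        E * z powi k * (of_int \<epsilon> * of_nat m powi (- k) * F z)"
      by (simp only: ring_distribs) (simp only: mult_ac right_diff_distrib, simp)
    also have "\<dots> = E * z powi k * ev B z"
      unfolding eps2 mk evB[OF z] by (simp only: ring_distribs mult_1_left)
    finally show "ev B (- 1 / z) = e12 (- 3 * (int m * t)) * z powi k * ev B z"
      unfolding E_def .
  qed
  thus ?thesis by (intro that[of \<epsilon>]) (auto simp: \<epsilon>_def B_def c_def d_def)
qed

subsection \<open>Forms of weight 2 and the eta function as a Laurent series\<close>

lemma holomorphic_ev:
  assumes "fls_conv_radius A \<ge> 1"
  shows "ev A holomorphic_on {z. Im z > 0}"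
proof -
  have "q12 holomorphic_on {z. Im z > 0}"
    unfolding q12_def[abs_def] by (intro holomorphic_intros) auto
  thus ?thesis unfolding ev_def[abs_def]
    by (rule holomorphic_on_eval_fls') (use norm_q12_less_radius[OF _ assms] in auto)
qed

lemma constant_on_upper_half_plane:
  assumes "\<And>z. Im z > 0 \<Longrightarrow> (f has_field_derivative 0) (at z)" "Im z > 0" "Im w > 0"
  shows "f z = f w"
proof -
  have "\<exists>c. \<forall>z\<in>{z. Im z > 0}. f z = c"
    by (intro has_field_derivative_zero_constant)
       (auto simp: convex_halfspace_Im_gt intro: DERIV_subset assms(1))
  thus ?thesis using assms(2,3) by auto
qed

text \<open>
  A primitive of a form of weight 2 is invariant under \<open>z \<mapsto> -1/z\<close>, because this map fixes
  \<open>\<i>\<close>, and then under \<open>z \<mapsto> z + 1\<close>, because \<open>\<rho> + 1 = -1/\<rho>\<close> for the third root of unity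
  \<open>\<rho>\<close>. A nonzero constant term would add a linear term to the primitive.
\<close>
theorem weight_2_constant_term:
  assumes A: "A \<in> eta_forms 2 0"
  shows "A $$ 0 = 0"
proof -
  note a = eta_formsD[OF A]
  let ?H = "{z. Im z > 0}"
  obtain \<Phi> where \<Phi>': "\<And>z. z \<in> ?H \<Longrightarrow> (\<Phi> has_field_derivative ev A z) (at z within ?H)"
    by (rule holomorphic_convex_primitive'[OF _ _ holomorphic_ev[OF a(2)]])
       (auto simp: convex_halfspace_Im_gt open_halfspace_Im_gt)
  have \<Phi>: "(\<Phi> has_field_derivative ev A z) (at z)" if "Im z > 0" for z
    using that \<Phi>'[of z] at_within_open[of z ?H] by (simp add: open_halfspace_Im_gt)
  have S: "\<Phi> (- 1 / z) = \<Phi> z" if z: "Im z > 0" for z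
  proof -
    have "((\<lambda>z. \<Phi> (- 1 / z) - \<Phi> z) has_field_derivative 0) (at w)" if w: "Im w > 0" for w
    proof -
      have w0: "w \<noteq> 0" using w by (rule Im_pos_nonzero)
      have "((\<lambda>z. - 1 / z) has_field_derivative 1 / w\<^sup>2) (at w)"
        using w0 by (auto intro!: derivative_eq_intros simp: power2_eq_square)
      from DERIV_chain2[where f = \<Phi> and g = "\<lambda>z. - 1 / z", OF \<Phi>[OF Im_minus_inverse_pos[OF w]] this]
      have "((\<lambda>z. \<Phi> (- 1 / z) - \<Phi> z) has_field_derivative ev A (- 1 / w) * (1 / w\<^sup>2) - ev A w) (at w)"
        by (rule DERIV_diff[OF _ \<Phi>[OF w]])
      moreover have "ev A (- 1 / w) * (1 / w\<^sup>2) - ev A w = 0"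
        using a(4)[OF w] w0 by simp
      ultimately show ?thesis by simp
    qed
    from constant_on_upper_half_plane[OF this z, of \<i>] show ?thesis by simp
  qed
  have T: "\<Phi> (z + 1) = \<Phi> z" if z: "Im z > 0" for z
  proof -
    define \<rho> where "\<rho> = Complex (- 1 / 2) (sqrt 3 / 2)"
    have \<rho>: "Im \<rho> > 0" by (simp add: \<rho>_def)
    have "\<rho> * (\<rho> + 1) = - 1" by (simp add: \<rho>_def complex_eq_iff)
    moreover have "\<rho> \<noteq> 0" using \<rho> by (rule Im_pos_nonzero)
    ultimately have \<rho>1: "- 1 / \<rho> = \<rho> + 1" by (metis nonzero_mult_div_cancel_left)
    have "((\<lambda>z. \<Phi> (z + 1) - \<Phi> z) has_field_derivative 0) (at w)" if w: "Im w > 0" for w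
    proof -
      have w1: "Im (w + 1) > 0" using w by simp
      have "((\<lambda>z. z + 1) has_field_derivative 1) (at w)"
        by (auto intro!: derivative_eq_intros)
      from DERIV_chain2[where f = \<Phi> and g = "\<lambda>z. z + 1", OF \<Phi>[OF w1] this]
      have "((\<lambda>z. \<Phi> (z + 1) - \<Phi> z) has_field_derivative ev A (w + 1) * 1 - ev A w) (at w)"
        by (rule DERIV_diff[OF _ \<Phi>[OF w]])
      thus ?thesis using ev_shift[OF A w] by simp
    qed
    from constant_on_upper_half_plane[OF this z \<rho>] S[OF \<rho>] show ?thesis unfolding \<rho>1 by simp
  qed
  have T12: "\<Phi> (z + of_nat n) = \<Phi> z" if z: "Im z > 0" for z n
  proof (induction n)
    case (Suc n)
    thus ?case using T[of "z + of_nat n"] z by (simp add: add_ac)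
  qed simp
  \<comment> \<open>A termwise primitive, up to a factor. Division by zero makes
    \<open>B $$ 0 = 0\<close>; the constant term of \<open>A\<close> becomes the linear term of
    \<open>\<Psi>\<close>.\<close>
  define B where "B = Abs_fls (\<lambda>n. A $$ n / of_int n)"
  have B: "B $$ n = A $$ n / of_int n" for n
    unfolding B_def by (rule nth_Abs_fls_lower_bound[of "fls_subdegree A"]) auto
  have rB: "fls_conv_radius B \<ge> 1"
  proof (rule fls_conv_radius_ge_1I)
    fix x :: complex assume x: "0 < norm x" "norm x < 1"
    have "(\<lambda>n. A $$ n * x powi n) summable_on UNIV"
      using has_sum_eval_fls[OF a(2) x] by (auto simp: summable_on_def)
    hence "(\<lambda>n. norm (A $$ n * x powi n)) summable_on UNIV"
      by (rule iffD1[OF summable_on_iff_abs_summable_on_complex])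
    hence "(\<lambda>n. norm (B $$ n * x powi n)) summable_on UNIV"
    proof (rule summable_on_comparison_test)
      fix n :: int
      have "norm (B $$ n) \<le> norm (A $$ n)"
      proof (cases "n = 0")
        case False
        hence "\<bar>real_of_int n\<bar> \<ge> 1" by linarith
        hence "norm (A $$ n) / \<bar>real_of_int n\<bar> \<le> norm (A $$ n) / 1" by (intro divide_left_mono) auto
        thus ?thesis by (simp add: B norm_divide)
      qed (simp add: B)
      thus "norm (B $$ n * x powi n) \<le> norm (A $$ n * x powi n)"
        by (simp add: norm_mult mult_right_mono)
    qed auto
    thus "(\<lambda>n. B $$ n * x powi n) summable_on UNIV"
      by (rule iffD2[OF summable_on_iff_abs_summable_on_complex])
  qed
  have XB: "fls_X * fls_deriv B = A - fls_const (A $$ 0)"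
    by (rule fls_eqI) (auto simp: B fls_X_times_conv_shift)
  \<comment> \<open>The factor \<open>6 / (of_real pi * \<i>)\<close> compensates the factor in the
    derivative of \<open>q12\<close>.\<close>
  define \<Psi> where "\<Psi> = (\<lambda>z. A $$ 0 * z + 6 / (of_real pi * \<i>) * ev B z)"
  have \<Psi>: "(\<Psi> has_field_derivative ev A z) (at z)" if z: "Im z > 0" for z
  proof -
    have r: "ereal (norm (q12 z)) < R" if "R \<ge> 1" for R by (rule norm_q12_less_radius[OF z that])
    have rC: "fls_conv_radius (fls_const c) = \<infinity>" for c
      using fls_conv_radius_fps_to_fls[of "fps_const c"] by simp
    have evC: "ev (fls_const c) z = c" for c
      using eval_fps_to_fls[of "q12 z" "fps_const c"] by (simp add: ev_def)
    have rX: "fls_conv_radius fls_X = \<infinity>"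
      using fls_conv_radius_fps_to_fls[of fps_X] by simp
    have evX: "ev fls_X z = q12 z"
      using eval_fps_to_fls[of "q12 z" fps_X] by (simp add: ev_def)
    have rD: "fls_conv_radius (fls_deriv B) \<ge> 1"
      using rB fls_conv_radius_deriv order_trans by blast
    have "(eval_fls B has_field_derivative eval_fls (fls_deriv B) (q12 z)) (at (q12 z))"
      by (rule has_field_derivative_eval_fls) (use r[OF rB] in auto)
    from DERIV_chain2[OF this has_field_derivative_q12]
    have "(ev B has_field_derivative ev (fls_deriv B) z * (of_real pi * \<i> / 6 * q12 z)) (at z)"
      unfolding ev_def .
    hence d: "(\<Psi> has_field_derivative A $$ 0 + 6 / (of_real pi * \<i>) * (ev (fls_deriv B) z * (of_real pi * \<i> / 6 * q12 z))) (at z)"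
      unfolding \<Psi>_def by (intro DERIV_add DERIV_cmult_Id DERIV_cmult)
    have e1: "6 / (of_real pi * \<i>) * (ev (fls_deriv B) z * (of_real pi * \<i> / 6 * q12 z)) = ev (fls_X * fls_deriv B) z"
    proof -
      have cancel: "c \<noteq> 0 \<Longrightarrow> 6 / c * (x * (c / 6 * y)) = y * x" for c x y :: complex by simp
      have "ev (fls_X * fls_deriv B) z = q12 z * ev (fls_deriv B) z"
        using ev_mult[of fls_X "fls_deriv B" z] rX rD z evX by simp
      thus ?thesis by (subst cancel) simp_all
    qed
    have e2: "ev (A - fls_const (A $$ 0)) z = ev A z - A $$ 0"
      unfolding ev_def by (subst eval_fls_diff) (use r[OF a(2)] evC in \<open>auto simp: rC ev_def\<close>)
    from d show ?thesis unfolding e1 XB e2 by simp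
  qed
  have "((\<lambda>z. \<Phi> z - \<Psi> z) has_field_derivative 0) (at z)" if "Im z > 0" for z
    using DERIV_diff[OF \<Phi>[OF that] \<Psi>[OF that]] by simp
  \<comment> \<open>Translation by 12 fixes \<open>q12\<close> and hence \<open>ev B\<close>, so
    only the linear term can change.\<close>
  from constant_on_upper_half_plane[OF this, of "\<i> + 12" \<i>]
  have "\<Phi> (\<i> + 12) - \<Psi> (\<i> + 12) = \<Phi> \<i> - \<Psi> \<i>" by simp
  moreover have "\<Phi> (\<i> + 12) = \<Phi> \<i>" using T12[of \<i> 12] by simp
  ultimately have "\<Psi> (\<i> + 12) = \<Psi> \<i>" by simp
  moreover have "q12 (\<i> + 12) = q12 \<i>"
  proof -
    have "q12 12 = e12 (12 * 1)" by (simp add: q12_def e12_def)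
    thus ?thesis by (simp only: q12_add e12_12)  simp
  qed
  ultimately have "A $$ 0 * (\<i> + 12) = A $$ 0 * \<i>" by (simp add: \<Psi>_def ev_def)
  thus ?thesis by (simp add: ring_distribs)
qed

section \<open>eta^2 and its inverse as integral forms\<close>

lemma fps_inverse_nth_Ints:
  fixes f :: "complex fps"
  assumes f: "\<And>n. fps_nth f n \<in> \<int>" and f0: "fps_nth f 0 = 1"
  shows "fps_nth (inverse f) n \<in> \<int>"
proof (induction n rule: less_induct)
  case (less n)
  show ?case
  proof (cases "n = 0")
    case False
    have "inverse f * f = 1" by (rule inverse_mult_eq_1) (use f0 in simp)
    hence "fps_nth (inverse f * f) n = 0" using False by simp
    hence "(\<Sum>i=0..n. fps_nth (inverse f) i * fps_nth f (n - i)) = 0" by (simp add: fps_mult_nth)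
    moreover have "{0..n} = insert n {0..<n}" by auto
    ultimately have "fps_nth (inverse f) n = - (\<Sum>i=0..<n. fps_nth (inverse f) i * fps_nth f (n - i))"
      using f0 by (simp add: eq_neg_iff_add_eq_0)
    thus ?thesis using less f by (auto intro!: Ints_minus Ints_sum Ints_mult)
  qed (simp add: f0)
qed

lemma
  shows fps_conv_radius_inverse_euler: "fps_conv_radius (inverse euler_fps) \<ge> 1"
    and eval_inverse_euler: "norm q < 1 \<Longrightarrow> eval_fps (inverse euler_fps) q = inverse (euler_fun q)"
proof -
  have e: "euler_fun has_fps_expansion euler_fps"
    unfolding euler_fps_def
    by (rule analytic_at_imp_has_fps_expansion_0)
       (use holomorphic_euler_fun in \<open>auto simp: analytic_on_def intro!: exI[of _ 1]\<close>)
  have inv: "(\<lambda>q. inverse (euler_fun q)) has_fps_expansion inverse euler_fps"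
    by (rule has_fps_expansion_inverse[OF e]) (simp add: euler_fps_nth_0)
  have holo: "(\<lambda>q. inverse (euler_fun q)) holomorphic_on ball 0 1"
    by (intro holomorphic_intros holomorphic_euler_fun) (use euler_fun_nonzero in auto)
  show "fps_conv_radius (inverse euler_fps) \<ge> 1"
    by (rule holomorphic_on_imp_fps_conv_radius_ge[OF inv]) (use holo in \<open>simp add: one_ereal_def\<close>)
  show "norm q < 1 \<Longrightarrow> eval_fps (inverse euler_fps) q = inverse (euler_fun q)"
    by (rule has_fps_expansion_imp_eval_fps_eq[OF inv _ holo])
qed

text \<open>Composition with the 12th power is the passage from q to q^(1/12); the shift supplies
  the factor \<open>q12\<close>.\<close>

definition eta2_fls :: "complex fls" where
  "eta2_fls = fls_shift (- 1) (fls_compose_power (fps_to_fls (euler_fps ^ 2)) 12)"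

definition eta2_inv_fls :: "complex fls" where
  "eta2_inv_fls = fls_shift 1 (fls_compose_power (fps_to_fls (inverse euler_fps ^ 2)) 12)"

lemma eta2_fls_inverse: "eta2_fls * eta2_inv_fls = 1"
proof -
  have "euler_fps ^ 2 * inverse euler_fps ^ 2 = 1"
    using inverse_mult_eq_1[of euler_fps] euler_fps_nth_0 
    by (simp add: power_mult_distrib[symmetric] mult.commute)
  hence "fps_to_fls (euler_fps ^ 2) * fps_to_fls (inverse euler_fps ^ 2) = 1"
    by (simp flip: fls_times_fps_to_fls)
  hence "fls_compose_power (fps_to_fls (euler_fps ^ 2)) 12 * fls_compose_power (fps_to_fls (inverse euler_fps ^ 2)) 12 = 1"
    by (simp flip: fls_compose_power_mult)
  thus ?thesis unfolding eta2_fls_def eta2_inv_fls_def by (simp add: fls_shifted_times_simps)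
qed

lemma fps_power_nth_Ints:
  fixes f :: "complex fps"
  assumes "\<And>n. fps_nth f n \<in> \<int>"
  shows "fps_nth (f ^ k) n \<in> \<int>"
  using assms by (induction k arbitrary: n) (auto simp: fps_mult_nth intro!: Ints_sum Ints_mult)

lemma fps_to_fls_int_fls: "(\<And>n. fps_nth f n \<in> \<int>) \<Longrightarrow> fps_to_fls f \<in> int_fls"
  by (auto simp: int_fls_def)

lemma eval_fps_power_1:
  fixes f :: "complex fps"
  assumes "fps_conv_radius f \<ge> 1" "norm q < 1"
  shows "eval_fps (f ^ n) q = eval_fps f q ^ n"
proof -
  have "ereal (norm q) < fps_conv_radius f" using assms by (meson ereal_less(3) less_le_trans)
  thus ?thesis by (intro eval_fps_power) auto
qed

text \<open>Serves for eta^2 and for its inverse. The exponents are \<open>t\<close> modulo 12 by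
  construction, so only the law under S has to be supplied.\<close>

lemma shift_compose_power_eta_forms:
  fixes f :: "complex fps"
  assumes f: "\<And>n. fps_nth f n \<in> \<int>" "fps_conv_radius f \<ge> 1"
    and g: "\<And>z. Im z > 0 \<Longrightarrow> g z = q12 z powi t * eval_fps f (nome z)"
    and S: "\<And>z. Im z > 0 \<Longrightarrow> g (- 1 / z) = e12 (- 3 * t) * z powi k * g z"
  shows "fls_shift (- t) (fls_compose_power (fps_to_fls f) 12) \<in> eta_forms k t"
    and "\<And>z. Im z > 0 \<Longrightarrow> ev (fls_shift (- t) (fls_compose_power (fps_to_fls f) 12)) z = g z"
proof -
  define A where "A = fls_shift (- t) (fls_compose_power (fps_to_fls f) 12)"
  have r: "fls_conv_radius (fls_compose_power (fps_to_fls f) 12) \<ge> 1"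
    by (rule fls_conv_radius_compose_power) (use f(2) in auto)
  have evA: "ev A z = g z" if z: "Im z > 0" for z
  proof -
    have n: "norm (nome z) < 1" using norm_nome_less[OF z] .
    have "ev A z = eval_fls (fls_compose_power (fps_to_fls f) 12) (q12 z) * q12 z powi t"
      unfolding ev_def A_def by (subst eval_fls_shift) auto
    also have "eval_fls (fls_compose_power (fps_to_fls f) 12) (q12 z) = eval_fls (fps_to_fls f) (q12 z ^ 12)"
      by (rule eval_fls_compose_power) (use f(2) norm_q12_less[OF z] in auto)
    also have "\<dots> = eval_fps f (nome z)"
      unfolding q12_nome by (rule eval_fps_to_fls) (use n f(2) in \<open>meson ereal_less(3) less_le_trans\<close>)
    finally show ?thesis using g[OF z] by simp
  qed
  show "\<And>z. Im z > 0 \<Longrightarrow> ev (fls_shift (- t) (fls_compose_power (fps_to_fls f) 12)) z = g z"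
    using evA unfolding A_def .
  have "A \<in> eta_forms k t"
    unfolding eta_forms_def
  proof (intro CollectI conjI allI impI)
    show "A \<in> int_fls" unfolding A_def
      using int_fls_compose_power[OF fps_to_fls_int_fls[OF f(1)], of 12] by (auto simp: int_fls_def)
    show "fls_conv_radius A \<ge> 1" unfolding A_def using r by simp
    show "[n = t] (mod 12)" if "A $$ n \<noteq> 0" for n
      using that unfolding A_def by (auto simp: fls_nth_compose_power cong_iff_dvd_diff split: if_splits)
    show "ev A (- 1 / z) = e12 (- 3 * t) * z powi k * ev A z" if "Im z > 0" for z
      unfolding evA[OF that] evA[OF Im_minus_inverse_pos[OF that]] by (rule S[OF that])
  qed
  thus "fls_shift (- t) (fls_compose_power (fps_to_fls f) 12) \<in> eta_forms k t" unfolding A_def .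
qed

lemma eta2_fls_eta_forms: "eta2_fls \<in> eta_forms 1 1"
  unfolding eta2_fls_def
proof (rule shift_compose_power_eta_forms(1)[where g = eta2])
  show "fps_conv_radius (euler_fps ^ 2) \<ge> 1"
    unfolding power2_eq_square by (intro fps_conv_radius_mult_ge euler_fps_conv_radius)
  show "eta2 z = q12 z powi 1 * eval_fps (euler_fps ^ 2) (nome z)" if "Im z > 0" for z
    using norm_nome_less[OF that] by (simp add: eta2_def eval_fps_power_1 euler_fps_conv_radius eval_euler_fps)
  show "eta2 (- 1 / z) = e12 (- 3 * 1) * z powi 1 * eta2 z" if "Im z > 0" for z
    using eta2_transformation[OF that] e12_minus_3 by simp
qed (rule fps_power_nth_Ints[OF euler_fps_nth_Ints])

lemma eta2_inv_fls_eta_forms: "eta2_inv_fls \<in> eta_forms (- 1) (- 1)"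
proof -
  have "fls_shift (- (- 1)) (fls_compose_power (fps_to_fls (inverse euler_fps ^ 2)) 12) \<in> eta_forms (- 1) (- 1)"
  proof (rule shift_compose_power_eta_forms(1)[where g = "\<lambda>z. inverse (eta2 z)"])
    show "fps_conv_radius (inverse euler_fps ^ 2) \<ge> 1"
      unfolding power2_eq_square by (intro fps_conv_radius_mult_ge fps_conv_radius_inverse_euler)
    show "inverse (eta2 z) = q12 z powi - 1 * eval_fps (inverse euler_fps ^ 2) (nome z)" if "Im z > 0" for z
      using norm_nome_less[OF that]
      by (simp add: eta2_def eval_fps_power_1 fps_conv_radius_inverse_euler eval_inverse_euler power_inverse power_int_minus)
    show "inverse (eta2 (- 1 / z)) = e12 (- 3 * - 1) * z powi - 1 * inverse (eta2 z)" if "Im z > 0" for z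
    proof -
      have "e12 (- 3) * e12 3 = 1" by (simp flip: e12_add)
      hence "e12 3 = inverse (- \<i>)" unfolding e12_minus_3 by (metis inverse_unique)
      thus ?thesis unfolding eta2_transformation[OF that]
        by (simp add: power_int_minus)
    qed
  qed (intro fps_power_nth_Ints fps_inverse_nth_Ints euler_fps_nth_Ints euler_fps_nth_0)
  thus ?thesis by (simp add: eta2_inv_fls_def)
qed

subsection \<open>Congruences of Laurent series\<close>

definition int_multiples :: "nat \<Rightarrow> complex set" where
  "int_multiples N = {of_nat N * of_int c |c. True}"

lemma int_multiplesI: "x = of_nat N * of_int c \<Longrightarrow> x \<in> int_multiples N"
  by (auto simp: int_multiples_def)

lemma int_multiples_0 [simp]: "0 \<in> int_multiples N"
  by (rule int_multiplesI[of _ _ 0]) simp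

lemma int_multiples_add: "x \<in> int_multiples N \<Longrightarrow> y \<in> int_multiples N \<Longrightarrow> x + y \<in> int_multiples N"
  unfolding int_multiples_def by clarsimp (metis distrib_left of_int_add)

lemma int_multiples_mult: "x \<in> int_multiples N \<Longrightarrow> y \<in> \<int> \<Longrightarrow> x * y \<in> int_multiples N"
  unfolding int_multiples_def by (auto elim!: Ints_cases) (metis mult.assoc of_int_mult)

lemma int_multiples_diff: "x \<in> int_multiples N \<Longrightarrow> y \<in> int_multiples N \<Longrightarrow> x - y \<in> int_multiples N"
  using int_multiples_add[of x N "y * - 1"] int_multiples_mult[of y N "- 1"] by simp

lemma int_multiples_sum: "(\<And>i. i \<in> I \<Longrightarrow> f i \<in> int_multiples N) \<Longrightarrow> sum f I \<in> int_multiples N"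
  by (induction I rule: infinite_finite_induct) (auto intro: int_multiples_add)

text \<open>Only the quotient of the difference by \<open>N\<close> is required to be integral;
  integrality of the series themselves is a separate assumption where products need it.\<close>

definition fls_cong :: "nat \<Rightarrow> complex fls \<Rightarrow> complex fls \<Rightarrow> bool" where
  "fls_cong N A B \<longleftrightarrow> (\<exists>C\<in>int_fls. A = B + of_nat N * C)"

lemma fls_of_nat_mult_nth: "(of_nat c * A) $$ n = of_nat c * A $$ n" for A :: "complex fls"
  using fls_of_int_mult_nth[of "int c" A n] by simp

lemma fls_congD: "fls_cong N A B \<Longrightarrow> A $$ n - B $$ n \<in> int_multiples N"
  unfolding fls_cong_def int_multiples_def int_fls_def
  by (auto simp: fls_of_nat_mult_nth elim!: Ints_cases) (metis Ints_cases)

lemma fls_congI: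
  assumes N: "N > 0" and "\<And>n. A $$ n - B $$ n \<in> int_multiples N"
  shows "fls_cong N A B"
proof -
  define C where "C = fls_const (1 / of_nat N) * (A - B)"
  have "C \<in> int_fls"
  proof (rule int_flsI)
    fix n
    obtain c where "A $$ n - B $$ n = of_nat N * of_int c"
      using assms(2)[of n] by (auto simp: int_multiples_def)
    thus "C $$ n \<in> \<int>" using N by (simp add: C_def)
  qed
  moreover have "A = B + of_nat N * C"
    by (rule fls_eqI) (use N in \<open>simp add: C_def fls_of_nat_mult_nth\<close>)
  ultimately show ?thesis unfolding fls_cong_def by blast
qed

lemma fls_cong_refl [simp]: "fls_cong N A A"
  unfolding fls_cong_def by (rule bexI[of _ 0]) auto

lemma fls_cong_sym: "fls_cong N A B \<Longrightarrow> fls_cong N B A"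
  unfolding fls_cong_def by (force intro!: bexI[of _ "- _"])

lemma fls_cong_trans [trans]:
  assumes "fls_cong N A B" "fls_cong N B C"
  shows "fls_cong N A C"
proof -
  obtain D E where "D \<in> int_fls" "A = B + of_nat N * D" "E \<in> int_fls" "B = C + of_nat N * E"
    using assms by (auto simp: fls_cong_def)
  thus ?thesis unfolding fls_cong_def
    by (intro bexI[of _ "E + D"]) (auto simp: algebra_simps)
qed

lemma fls_cong_int: "fls_cong N A B \<Longrightarrow> B \<in> int_fls \<Longrightarrow> A \<in> int_fls"
  unfolding fls_cong_def by (metis int_fls_add int_fls_mult int_fls_of_nat)

lemma fls_cong_mult:
  assumes "fls_cong N A A'" "fls_cong N B B'" and int: "A' \<in> int_fls" "B' \<in> int_fls"
  shows "fls_cong N (A * B) (A' * B')"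
proof -
  obtain C D where C: "C \<in> int_fls" "A = A' + of_nat N * C" and D: "D \<in> int_fls" "B = B' + of_nat N * D"
    using assms by (auto simp: fls_cong_def)
  have "A * B = A' * B' + of_nat N * (C * B' + A' * D + of_nat N * C * D)"
    unfolding C(2) D(2) by (simp add: algebra_simps)
  moreover have "C * B' + A' * D + of_nat N * C * D \<in> int_fls"
    using C(1) D(1) int by (intro int_fls_add int_fls_mult int_fls_of_nat)
  ultimately show ?thesis unfolding fls_cong_def by blast
qed

lemma fls_cong_power:
  assumes "fls_cong N A A'" "A' \<in> int_fls"
  shows "fls_cong N (A ^ n) (A' ^ n)"
  by (induction n) (auto intro: fls_cong_mult assms int_fls_power)

lemma fls_cong_compose_power:
  assumes "fls_cong N A B" "d > 0"
  shows "fls_cong N (fls_compose_power A d) (fls_compose_power B d)"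
proof -
  obtain C where C: "C \<in> int_fls" "A = B + of_nat N * C"
    using assms by (auto simp: fls_cong_def)
  have "fls_compose_power (of_nat N :: complex fls) d = of_nat N"
    using fls_compose_power_const_left[OF assms(2), of "of_nat N :: complex"] by (simp add: fls_of_nat)
  hence "fls_compose_power A d = fls_compose_power B d + of_nat N * fls_compose_power C d"
    unfolding C(2) by simp
  thus ?thesis unfolding fls_cong_def using C(1) by blast
qed

lemma fls_cong_dvd:
  assumes "fls_cong N A B" "M dvd N"
  shows "fls_cong M A B"
proof -
  obtain c where "N = M * c" using assms(2) by blast
  thus ?thesis using assms(1) unfolding fls_cong_def
    by (auto simp: mult.assoc intro!: bexI[of _ "of_nat c * _"])
qed

text \<open>Discards the U summand of a Hecke operator, \<open>c\<close> being the power m^(1-k) in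
  front of it.\<close>

lemma fls_cong_0I: "C \<in> int_fls \<Longrightarrow> N dvd c \<Longrightarrow> fls_cong N (A + of_int (\<epsilon> * int c) * C) A"
proof -
  assume C: "C \<in> int_fls" and "N dvd c"
  then obtain d where "c = N * d" by blast
  hence "of_int (\<epsilon> * int c) * C = of_nat N * (of_int (\<epsilon> * int d) * C)"
    by (simp add: mult_ac)
  moreover have "of_int (\<epsilon> * int d) * C \<in> int_fls" using C by (intro int_fls_mult int_fls_of_int)
  ultimately show ?thesis unfolding fls_cong_def by metis
qed

lemma binomial_second_order:
  assumes "y \<in> int_fls" "c \<in> int_fls"
  shows "\<exists>D\<in>int_fls. (y + c) ^ Suc n = y ^ Suc n + of_nat (Suc n) * y ^ n * c + c * c * D"
proof (induction n)
  case 0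
  show ?case by (rule bexI[of _ 0]) auto
next
  case (Suc n)
  then obtain D where D: "D \<in> int_fls" "(y + c) ^ Suc n = y ^ Suc n + of_nat (Suc n) * y ^ n * c + c * c * D"
    by blast
  have "(y + c) ^ Suc (Suc n) = (y + c) * (y ^ Suc n + of_nat (Suc n) * y ^ n * c + c * c * D)"
    unfolding D(2)[symmetric] by (rule power_Suc)
  also have "\<dots> = y ^ Suc (Suc n) + of_nat (Suc (Suc n)) * y ^ Suc n * c +
       c * c * (of_nat (Suc n) * y ^ n + y * D + c * D)"
    by (simp add: algebra_simps)
  finally show ?case
    using assms D(1) by (intro bexI[of _ "of_nat (Suc n) * y ^ n + y * D + c * D"])
      (auto intro!: int_fls_add int_fls_mult simp del: of_nat_Suc)
qed

text \<open>In the binomial expansion the linear term gains a factor \<open>m\<close>, and the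
  remainder carries \<open>m ^ (2 * j)\<close>, where \<open>2 * j \<ge> j + 1\<close>.\<close>

lemma fls_cong_power_lift:
  assumes "fls_cong (m ^ j) X Y" "Y \<in> int_fls" "j \<ge> 1" "m > 0"
  shows "fls_cong (m ^ Suc j) (X ^ m) (Y ^ m)"
proof -
  obtain C where C: "C \<in> int_fls" "X = Y + of_nat (m ^ j) * C"
    using assms by (auto simp: fls_cong_def)
  obtain n where n: "m = Suc n" using assms(4) by (cases m) auto
  obtain D where D: "D \<in> int_fls" "X ^ m = Y ^ m + of_nat m * Y ^ n * (of_nat (m ^ j) * C) +
       (of_nat (m ^ j) * C) * (of_nat (m ^ j) * C) * D"
    using binomial_second_order[OF assms(2), of "of_nat (m ^ j) * C" n] C
    by (metis int_fls_mult int_fls_of_nat n)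
  obtain i where i: "j = Suc i" using assms(3) by (cases j) auto
  have "X ^ m = Y ^ m + of_nat (m ^ Suc j) * (Y ^ n * C + of_nat (m ^ i) * C * C * D)"
    unfolding D(2) i by (simp add: algebra_simps)
  moreover have "Y ^ n * C + of_nat (m ^ i) * C * C * D \<in> int_fls"
    using assms(2) C(1) D(1) by (intro int_fls_add int_fls_mult int_fls_of_nat int_fls_power)
  ultimately show ?thesis unfolding fls_cong_def by blast
qed

lemma fls_cong_power_lift':
  assumes "fls_cong m X Y" "Y \<in> int_fls" "m > 0"
  shows "fls_cong (m ^ Suc j) (X ^ (m ^ j)) (Y ^ (m ^ j))"
proof (induction j)
  case (Suc j)
  have "fls_cong (m ^ Suc (Suc j)) ((X ^ (m ^ j)) ^ m) ((Y ^ (m ^ j)) ^ m)"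
    by (rule fls_cong_power_lift[OF Suc]) (use assms in auto)
  thus ?case by (simp add: power_mult[symmetric] mult.commute)
qed (use assms in simp)

section \<open>Frobenius congruences modulo prime powers\<close>

lemma fls_cong_freshman:
  assumes x: "x \<in> int_fls" and y: "y \<in> int_fls" and p: "prime p"
  shows "fls_cong p ((x + y) ^ p) (x ^ p + y ^ p)"
proof -
  have p0: "p > 0" using p by (rule prime_gt_0_nat)
  define D where "D = (\<Sum>k\<in>{1..<p}. of_nat ((p choose k) div p) * x ^ k * y ^ (p - k))"
  have "{..p} = insert 0 (insert p {1..<p})" using p0 by auto
  hence "(x + y) ^ p = x ^ p + y ^ p + (\<Sum>k\<in>{1..<p}. of_nat (p choose k) * x ^ k * y ^ (p - k))"
    using p0 unfolding binomial_ring by simp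
  also have "(\<Sum>k\<in>{1..<p}. of_nat (p choose k) * x ^ k * y ^ (p - k)) = of_nat p * D"
    unfolding D_def sum_distrib_left
  proof (intro sum.cong refl)
    fix k assume k: "k \<in> {1..<p}"
    hence "p dvd (p choose k)" using p by (intro dvd_choose_prime) auto
    hence "of_nat (p choose k) = (of_nat p * of_nat ((p choose k) div p) :: complex fls)"
      by (metis dvd_mult_div_cancel of_nat_mult)
    thus "of_nat (p choose k) * x ^ k * y ^ (p - k) =
          of_nat p * (of_nat ((p choose k) div p) * x ^ k * y ^ (p - k))"
      by (simp only: mult.assoc)
  qed
  finally show ?thesis unfolding fls_cong_def
    by (intro bexI[of _ D]) (use x y in \<open>auto simp: D_def intro!: int_fls_sum int_fls_mult\<close>)
qed

lemma fermat_int: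
  fixes a :: int
  assumes "prime p"
  shows "[a ^ p = a] (mod int p)"
proof -
  have p0: "p > 0" using assms by (rule prime_gt_0_nat)
  define b where "b = nat (a mod int p)"
  have b: "[int b = a] (mod int p)" using p0 by (simp add: b_def cong_def)
  have "[b ^ p = b] (mod p)"
  proof (cases "p dvd b")
    case True
    hence "p dvd b ^ p" using p0 dvd_trans[OF True dvd_power[of p b]] by simp
    thus ?thesis using True unfolding cong_0_iff[symmetric] by (metis cong_sym cong_trans)
  next
    case False
    have "[b ^ (p - 1) * b = 1 * b] (mod p)"
      by (intro cong_mult fermat_theorem assms False cong_refl)
    thus ?thesis unfolding power_minus_mult[OF p0] mult_1_left .
  qed
  hence "[int (b ^ p) = int b] (mod int p)" by (simp only: cong_int_iff)
  hence "[int b ^ p = int b] (mod int p)" by simp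
  from cong_trans[OF cong_pow[OF cong_sym[OF b]] cong_trans[OF this b]] show ?thesis .
qed

lemma power_nth_negative:
  fixes B :: "complex fls"
  assumes B: "\<And>i. i < 0 \<Longrightarrow> B $$ i = 0" and "i < 0" "p > 0"
  shows "(B ^ p) $$ i = 0"
proof (cases "B = 0")
  case False
  hence "fls_subdegree B \<ge> 0" using B by (metis fls_subdegree_geI)
  hence "fls_subdegree (B ^ p) \<ge> 0" by (simp add: fls_subdegree_pow)
  thus ?thesis using assms(2) by (intro fls_eq0_below_subdegree) linarith
qed (use assms(3) in \<open>simp add: zero_power\<close>)

lemma compose_power_nth_negative:
  assumes B: "\<And>i. i < 0 \<Longrightarrow> B $$ i = 0" and "i < 0" "d > 0"
  shows "fls_compose_power B d $$ i = 0"
  using assms(2,3) by (auto simp: fls_nth_compose_power div_neg_pos_less0 intro!: B)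

text \<open>The series is infinite, but the rule for \<open>p\<close>th powers handles only two
  summands. With \<open>A\<close> written as its constant term plus \<open>fls_X * B\<close>,
  coefficient \<open>n\<close> for \<open>A\<close> reduces to coefficient \<open>n - p\<close> for
  \<open>B\<close>, and the constant is covered by Fermat's little theorem.\<close>

lemma frobenius_nth:
  assumes p: "prime p"
  shows "A \<in> int_fls \<Longrightarrow> (\<And>i. i < 0 \<Longrightarrow> A $$ i = 0) \<Longrightarrow>
    (A ^ p) $$ int n - fls_compose_power A p $$ int n \<in> int_multiples p"
proof (induction n arbitrary: A rule: less_induct)
  case (less n)
  have p1: "p > 1" using p by (rule prime_gt_1_nat)
  define B where "B = fls_shift 1 (A - fls_const (A $$ 0))"
  have B: "B \<in> int_fls" "\<And>i. i < 0 \<Longrightarrow> B $$ i = 0"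
    using less.prems by (auto simp: B_def int_fls_def)
  have A: "A = fls_const (A $$ 0) + fls_X * B"
    by (rule fls_eqI) (auto simp: B_def fls_X_times_conv_shift)
  have c: "fls_const (A $$ 0) \<in> int_fls" using less.prems by (auto simp: int_fls_def)
  have "fls_X \<in> int_fls" by (auto simp: int_fls_def)
  hence "fls_cong p (A ^ p) (fls_const (A $$ 0) ^ p + (fls_X * B) ^ p)"
    by (subst A) (intro fls_cong_freshman c B p int_fls_mult)
  from fls_congD[OF this]
  have 1: "(A ^ p) $$ int n - (fls_const (A $$ 0) ^ p + (fls_X * B) ^ p) $$ int n \<in> int_multiples p" .
  have cp: "fls_const (A $$ 0) ^ p = fls_const ((A $$ 0) ^ p)"
    by (rule fls_const_power[symmetric])
  have XB: "(fls_X * B) ^ p = fls_shift (- int p) (B ^ p)"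
    by (simp add: power_mult_distrib fls_X_power_times_conv_shift)
  have VA: "fls_compose_power A p = fls_const (A $$ 0) + fls_shift (- int p) (fls_compose_power B p)"
    by (subst A) (use p1 in \<open>simp add: fls_X_times_conv_shift\<close>)
  have 2: "(A $$ 0) ^ p - A $$ 0 \<in> int_multiples p"
  proof -
    obtain a where a: "A $$ 0 = of_int a" using int_flsD[OF less.prems(1), of 0] by (auto elim: Ints_cases)
    have "int p dvd a ^ p - a" using fermat_int[OF p, of a] by (simp add: cong_iff_dvd_diff)
    then obtain b where "a ^ p - a = int p * b" by blast
    hence "of_int (a ^ p - a) = (of_nat p * of_int b :: complex)" by simp
    thus ?thesis by (intro int_multiplesI[of _ _ b]) (simp add: a)
  qed
  have 3: "(B ^ p) $$ (int n - int p) - fls_compose_power B p $$ (int n - int p) \<in> int_multiples p"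
  proof (cases "n \<ge> p")
    case True
    have "int n - int p = int (n - p)" using True by simp
    thus ?thesis using less.IH[OF _ B, of "n - p"] p1 True by simp
  next
    case False
    hence "int n - int p < 0" by simp
    thus ?thesis using power_nth_negative[OF B(2)] compose_power_nth_negative[OF B(2)] p1 by simp
  qed
  have 4: "(fls_const (A $$ 0) ^ p + (fls_X * B) ^ p) $$ int n - fls_compose_power A p $$ int n =
     (if n = 0 then (A $$ 0) ^ p - A $$ 0 else 0) + ((B ^ p) $$ (int n - int p) - fls_compose_power B p $$ (int n - int p))"
    unfolding cp XB VA by simp
  have "(fls_const (A $$ 0) ^ p + (fls_X * B) ^ p) $$ int n - fls_compose_power A p $$ int n \<in> int_multiples p"
    unfolding 4 using 2 3 by (intro int_multiples_add) auto
  from int_multiples_add[OF 1 this] show ?case by simp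
qed

lemma fls_shift_power: "fls_shift d A ^ n = fls_shift (int n * d) (A ^ n)"
  for A :: "complex fls"
proof (induction n)
  case (Suc n)
  have "fls_shift d A ^ Suc n = fls_shift d A * fls_shift (int n * d) (A ^ n)" by (simp add: Suc)
  also have "\<dots> = fls_shift (d + int n * d) (A * A ^ n)" by (simp add: fls_shifted_times_simps add.commute)
  finally show ?case by (simp add: algebra_simps)
qed simp

text \<open>A shift removes the pole; the \<open>p\<close>th power and the composition both turn a
  shift by \<open>s\<close> into one by \<open>p * s\<close>.\<close>

lemma frobenius:
  assumes p: "prime p" and A: "A \<in> int_fls"
  shows "fls_cong p (A ^ p) (fls_compose_power A p)"
proof -
  have p0: "p > 0" using p by (rule prime_gt_0_nat)
  define s where "s = min 0 (fls_subdegree A)"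
  define B where "B = fls_shift s A"
  have "A $$ (i + s) = 0" if "i < 0" for i
    by (rule fls_eq0_below_subdegree) (use that in \<open>simp add: s_def\<close>)
  hence B: "B \<in> int_fls" "\<And>i. i < 0 \<Longrightarrow> B $$ i = 0"
    using int_flsD[OF A] by (simp_all add: B_def int_fls_def)
  have A_eq: "A = fls_shift (- s) B" by (simp add: B_def)
  have Bn: "(B ^ p) $$ i - fls_compose_power B p $$ i \<in> int_multiples p" for i
  proof (cases "i \<ge> 0")
    case True
    thus ?thesis using frobenius_nth[OF p B, of "nat i"] by simp
  next
    case False
    thus ?thesis using power_nth_negative[OF B(2)] compose_power_nth_negative[OF B(2)] p0 by simp
  qed
  show ?thesis
  proof (rule fls_congI[OF p0])
    fix n
    have "A ^ p = fls_shift (int p * - s) (B ^ p)"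
      unfolding A_eq by (rule fls_shift_power)
    moreover have "fls_compose_power A p = fls_shift (int p * - s) (fls_compose_power B p)"
      unfolding A_eq using p0 by simp
    ultimately show "(A ^ p) $$ n - fls_compose_power A p $$ n \<in> int_multiples p"
      using Bn[of "n + int p * - s"] by (simp only: fls_shift_nth)
  qed
qed

lemma fls_compose_power_compose:
  assumes "a > 0" "b > 0"
  shows "fls_compose_power (fls_compose_power A a) b = fls_compose_power A (a * b)"
proof (rule fls_eqI)
  fix n :: int
  show "fls_compose_power (fls_compose_power A a) b $$ n = fls_compose_power A (a * b) $$ n"
  proof (cases "int b dvd n")
    case True
    then obtain i where "n = int b * i" by blast
    hence "fls_compose_power (fls_compose_power A a) b $$ n = fls_compose_power A a $$ i"
      using assms by (simp add: fls_nth_compose_power)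
    also have "\<dots> = fls_compose_power A (a * b) $$ n"
    proof (cases "int a dvd i")
      case True
      then obtain j where "i = int a * j" by blast
      hence "n = int (a * b) * j" using \<open>n = int b * i\<close> by simp
      thus ?thesis using assms \<open>i = int a * j\<close> by (simp add: fls_nth_compose_power del: of_nat_mult)
    next
      case False
      hence "\<not> int (a * b) dvd n" using assms \<open>n = int b * i\<close> by (simp add: mult.commute)
      thus ?thesis using False assms by (simp add: fls_nth_compose_power del: of_nat_mult)
    qed
    finally show ?thesis .
  next
    case False
    hence "\<not> int (a * b) dvd n" using dvd_mult_right[of "int a" "int b" n] by auto
    thus ?thesis using False assms by (simp add: fls_nth_compose_power del: of_nat_mult)
  qed
qed

text \<open>The exponent \<open>p ^ j\<close> lifts the Frobenius congruence from modulus
  \<open>p\<close> to \<open>p ^ Suc j\<close>. The modulus is the same for all \<open>i\<close>: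
  each step composes the previous congruence with the \<open>p\<close>th power and lifts one more
  Frobenius congruence.\<close>

lemma frobenius_prime_power:
  assumes p: "prime p" and A: "A \<in> int_fls"
  shows "fls_cong (p ^ Suc j) (fls_compose_power A (p ^ i) ^ (p ^ j)) (A ^ (p ^ i * p ^ j))"
proof (induction i)
  case 0
  have "fls_compose_power A 1 = A" by (rule fls_eqI) (simp add: fls_nth_compose_power)
  thus ?case by simp
next
  case (Suc i)
  have p0: "p > 0" using p by (rule prime_gt_0_nat)
  define B where "B = A ^ (p ^ i)"
  have B: "B \<in> int_fls" unfolding B_def using A by (rule int_fls_power)
  have "fls_compose_power A (p ^ Suc i) = fls_compose_power (fls_compose_power A (p ^ i)) p"
    using p0 by (simp only: fls_compose_power_compose zero_less_power power_Suc2)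
  hence 1: "fls_compose_power A (p ^ Suc i) ^ (p ^ j) = fls_compose_power (fls_compose_power A (p ^ i) ^ (p ^ j)) p"
    using p0 by simp
  have 2: "fls_compose_power (A ^ (p ^ i * p ^ j)) p = fls_compose_power B p ^ (p ^ j)"
    using p0 by (simp add: B_def power_mult)
  have 3: "(B ^ p) ^ (p ^ j) = A ^ (p ^ Suc i * p ^ j)"
    by (simp only: B_def power_mult[symmetric] power_Suc2)
  have "fls_cong (p ^ Suc j) ((B ^ p) ^ (p ^ j)) (fls_compose_power B p ^ (p ^ j))"
    by (rule fls_cong_power_lift'[OF frobenius[OF p B] int_fls_compose_power[OF B] p0])
  hence "fls_cong (p ^ Suc j) (fls_compose_power (A ^ (p ^ i * p ^ j)) p) (A ^ (p ^ Suc i * p ^ j))"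
    unfolding 2 3 by (rule fls_cong_sym)
  with fls_cong_compose_power[OF Suc p0] show ?case
    unfolding 1 by (rule fls_cong_trans)
qed

subsection \<open>Level one forms with prescribed leading exponents\<close>

definition monic_at :: "int \<Rightarrow> complex fls \<Rightarrow> bool" where
  "monic_at n A \<longleftrightarrow> fls_subdegree A = n \<and> A $$ n = 1"

lemma monic_atD: "monic_at n A \<Longrightarrow> A $$ n = 1" "monic_at n A \<Longrightarrow> i < n \<Longrightarrow> A $$ i = 0"
  by (auto simp: monic_at_def)

lemma monic_atI:
  assumes "A $$ n = 1" "\<And>i. i < n \<Longrightarrow> A $$ i = 0"
  shows "monic_at n A"
  unfolding monic_at_def using assms by (auto intro!: fls_subdegree_eqI)

lemma monic_at_mult:
  assumes "monic_at a A" "monic_at b B"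
  shows "monic_at (a + b) (A * B)"
proof (rule monic_atI)
  have s: "fls_subdegree A = a" "fls_subdegree B = b" using assms by (auto simp: monic_at_def)
  show "(A * B) $$ (a + b) = 1"
    unfolding fls_times_nth(2) s using assms by (simp add: monic_at_def)
  show "(A * B) $$ i = 0" if "i < a + b" for i
    using that by (intro fls_times_nth_eq0) (simp add: s)
qed

lemma monic_at_power: "monic_at a A \<Longrightarrow> monic_at (int n * a) (A ^ n)"
proof (induction n)
  case (Suc n)
  thus ?case using monic_at_mult[of a A "int n * a" "A ^ n"] by (simp add: ring_distribs)
qed (auto intro: monic_atI)

lemma monic_at_compose_power:
  assumes "monic_at a A" "d > 0"
  shows "monic_at (int d * a) (fls_compose_power A d)"
proof (rule monic_atI)
  show "fls_compose_power A d $$ (int d * a) = 1"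
    using assms by (simp add: fls_nth_compose_power monic_atD)
  fix i assume i: "i < int d * a"
  show "fls_compose_power A d $$ i = 0"
  proof (cases "int d dvd i")
    case True
    then obtain j where j: "i = int d * j" by blast
    hence "j < a" using i assms(2) by simp
    thus ?thesis using j assms by (simp add: fls_nth_compose_power monic_atD)
  qed (use assms in \<open>simp add: fls_nth_compose_power\<close>)
qed

lemma monic_at_eta2: "monic_at 1 eta2_fls" and monic_at_eta2_inv: "monic_at (- 1) eta2_inv_fls"
proof -
  have m: "monic_at 0 (fls_compose_power (fps_to_fls f) 12)" if "fps_nth f 0 = 1" for f :: "complex fps"
  proof -
    have "monic_at 0 (fps_to_fls f)" using that by (intro monic_atI) auto
    from monic_at_compose_power[OF this, of 12] show ?thesis by simp
  qed
  have "monic_at n (fls_shift (- n) A)" if "monic_at 0 A" for n A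
    by (rule monic_atI) (use that in \<open>auto simp: monic_atD\<close>)
  from this[OF m, of _ 1] this[OF m, of _ "- 1"]
  show "monic_at 1 eta2_fls" "monic_at (- 1) eta2_inv_fls"
    unfolding eta2_fls_def eta2_inv_fls_def
    by (simp_all add: power2_eq_square fps_mult_nth_0 euler_fps_nth_0)
qed

lemma eta2_inv_eta2_power: "eta2_inv_fls ^ n * eta2_fls ^ n = 1"
  using eta2_fls_inverse by (simp add: power_mult_distrib[symmetric] mult.commute)

lemma eta2_int: "eta2_fls \<in> int_fls" and eta2_inv_int: "eta2_inv_fls \<in> int_fls"
  using eta_formsD(1)[OF eta2_fls_eta_forms] eta_formsD(1)[OF eta2_inv_fls_eta_forms] by auto

text \<open>
  The form is \<open>T\<^sub>m(\<eta>\<^sup>-\<^sup>2\<^sup>M) \<eta>\<^sup>2\<^sup>m\<^sup>M\<close>, where \<open>M = m\<^bsup>k-1\<^esup>\<close>; it replaces the Eisenstein series of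
  weight \<open>(m - 1)M\<close>.
\<close>
lemma unit_form:
  assumes m: "prime m" "coprime m 12"
  shows "\<exists>H \<in> eta_forms ((int m - 1) * int (m ^ j)) 0. fls_cong (m ^ Suc j) H 1"
proof -
  have m1: "m > 1" using m(1) by (rule prime_gt_1_nat)
  define M where "M = m ^ j"
  define A where "A = eta2_inv_fls ^ M"
  have A: "A \<in> eta_forms (- int M) (- int M)"
    unfolding A_def using eta_forms_power[OF eta2_inv_fls_eta_forms, of M] by simp
  obtain \<epsilon> where B: "fls_compose_power A m + of_int (\<epsilon> * int m ^ nat (1 - (- int M))) * fls_U m A \<in>
      eta_forms (- int M) (int m * - int M)" (is "?B \<in> _")
    using hecke[OF A m] by (metis neg_le_0_iff_le of_nat_0_le_iff order_trans zero_le_one)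
  define H where "H = ?B * eta2_fls ^ (m * M)"
  have "H \<in> eta_forms (- int M + int (m * M) * 1) (int m * - int M + int (m * M) * 1)"
    unfolding H_def by (intro eta_forms_mult B eta_forms_power eta2_fls_eta_forms)
  hence H: "H \<in> eta_forms ((int m - 1) * int M) 0"
    by (simp add: algebra_simps)
  \<comment> \<open>In weight \<open>- M\<close> the U summand has the factor
    \<open>m ^ (1 + M)\<close>, which vanishes modulo \<open>m ^ Suc j\<close> as soon as
    \<open>j \<le> M\<close>.\<close>
  have "j < M" unfolding M_def using m1 by (intro power_gt_expt) simp
  hence "Suc j \<le> 1 + M" by simp
  hence dvd: "m ^ Suc j dvd m ^ nat (1 - (- int M))"
    by (intro le_imp_power_dvd) (simp add: nat_add_distrib)
  have 1: "fls_cong (m ^ Suc j) ?B (fls_compose_power A m)"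
    using fls_cong_0I[OF int_fls_U[OF _ eta_formsD(1)[OF A]] dvd] m1 by simp
  have "fls_compose_power A m = fls_compose_power eta2_inv_fls (m ^ 1) ^ (m ^ j)"
    using m1 by (simp add: A_def M_def)
  with frobenius_prime_power[OF m(1) eta2_inv_int, of j 1]
  have 2: "fls_cong (m ^ Suc j) (fls_compose_power A m) (eta2_inv_fls ^ (m * M))"
    by (simp only: M_def power_one_right)
  from 1 2 have "fls_cong (m ^ Suc j) ?B (eta2_inv_fls ^ (m * M))" by (rule fls_cong_trans)
  hence "fls_cong (m ^ Suc j) H (eta2_inv_fls ^ (m * M) * eta2_fls ^ (m * M))"
    unfolding H_def by (intro fls_cong_mult fls_cong_refl int_fls_power eta2_int eta2_inv_int)
  thus ?thesis using H unfolding eta2_inv_eta2_power M_def by blast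
qed

text \<open>The construction of \<open>unit_form\<close> with \<open>M = 1\<close>, now keeping
  track of the leading term: U of eta^(-2) has smaller pole order than the composition, whose pole
  of order \<open>m\<close> is cancelled by \<open>eta2_fls ^ m\<close>. The primes 5 and 7 give
  substitutes for the Eisenstein series of weights 4 and 6.\<close>

lemma monic_form_prime:
  assumes m: "prime m" "coprime m 12"
  shows "\<exists>H \<in> eta_forms (int m - 1) 0. monic_at 0 H"
proof -
  have m1: "m > 1" using m(1) by (rule prime_gt_1_nat)
  note A = eta2_inv_fls_eta_forms
  obtain \<epsilon> where B: "fls_compose_power eta2_inv_fls m + of_int (\<epsilon> * int m ^ nat (1 - (- 1))) * fls_U m eta2_inv_fls \<in>
      eta_forms (- 1) (int m * - 1)" (is "?B \<in> _")
    using hecke[OF A m] by auto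
  define H where "H = ?B * eta2_fls ^ m"
  have "H \<in> eta_forms (- 1 + int m * 1) (int m * - 1 + int m * 1)"
    unfolding H_def by (intro eta_forms_mult B eta_forms_power eta2_fls_eta_forms)
  hence H: "H \<in> eta_forms (int m - 1) 0" by simp
  have V: "monic_at (- int m) (fls_compose_power eta2_inv_fls m)"
    using monic_at_compose_power[OF monic_at_eta2_inv, of m] m1 by simp
  have "fls_U m eta2_inv_fls $$ i = 0" if "i \<le> - int m" for i
  proof -
    have "int m * i \<le> int m * - 1" using that m1 by (intro mult_left_mono) auto
    hence "int m * i < - 1" using m1 by linarith
    thus ?thesis using m1 monic_atD(2)[OF monic_at_eta2_inv] by simp
  qed
  hence "monic_at (- int m) ?B"
    using monic_atD[OF V] by (intro monic_atI) (simp_all add: fls_of_int_mult_nth del: of_int_mult of_int_power)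
  from monic_at_mult[OF this monic_at_power[OF monic_at_eta2, of m]]
  have "monic_at 0 H" unfolding H_def by simp
  thus ?thesis using H by blast
qed

text \<open>Every even \<open>w \<ge> 0\<close> other than 2 is \<open>4 * a + 6 * b\<close>, so
  products of the forms of weights 4 and 6 suffice.\<close>

lemma monic_form_0:
  assumes "even w" "w \<ge> 0" "w \<noteq> (2 :: int)"
  shows "\<exists>A \<in> eta_forms w 0. monic_at 0 A"
proof -
  have "coprime (5 :: nat) 12" "coprime (7 :: nat) 12" by (simp_all add: coprime_iff_gcd_eq_1 gcd_non_0_nat)
  moreover have "prime (5 :: nat)" "prime (7 :: nat)" by simp_all
  ultimately obtain E4 E6 where E: "E4 \<in> eta_forms 4 0" "monic_at 0 E4" "E6 \<in> eta_forms 6 0" "monic_at 0 E6"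
    using monic_form_prime[of 5] monic_form_prime[of 7] by auto
  have "\<exists>a b. w = 4 * int a + 6 * int b"
  proof (cases "4 dvd w")
    case True
    then obtain c where "w = 4 * c" by blast
    hence "w = 4 * int (nat c) + 6 * int 0" using assms(2) by simp
    thus ?thesis by blast
  next
    case False
    have "w \<ge> 6" "4 dvd w - 6" using False assms by presburger+
    then obtain c where "w - 6 = 4 * c" by blast
    hence "w = 4 * int (nat c) + 6 * int 1" using \<open>w \<ge> 6\<close> by simp
    thus ?thesis by blast
  qed
  then obtain a b where w: "w = 4 * int a + 6 * int b" by blast
  have "E4 ^ a * E6 ^ b \<in> eta_forms (int a * 4 + int b * 6) (int a * 0 + int b * 0)"
    by (intro eta_forms_mult eta_forms_power E)
  moreover have "monic_at (int a * 0 + int b * 0) (E4 ^ a * E6 ^ b)"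
    by (intro monic_at_mult monic_at_power E)
  ultimately show ?thesis unfolding w by (auto simp: mult.commute)
qed

text \<open>A form from \<open>monic_form_0\<close> times the \<open>n\<close>th power of the
  discriminant, which is \<open>eta2_fls ^ 12\<close>; for negative \<open>n\<close> the inverse is
  used. The exponent is \<open>12 * n\<close> because the variable is q^(1/12).\<close>

lemma monic_form:
  assumes "even w" "w - 12 * n \<ge> 0" "w - 12 * n \<noteq> (2 :: int)"
  shows "\<exists>A \<in> eta_forms w 0. monic_at (12 * n) A"
proof -
  obtain A where A: "A \<in> eta_forms (w - 12 * n) 0" "monic_at 0 A"
    using monic_form_0[of "w - 12 * n"] assms by auto
  have "\<exists>D \<in> eta_forms (12 * n) (12 * n). monic_at (12 * n) D"
  proof (cases "n \<ge> 0")
    case True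
    thus ?thesis using eta_forms_power[OF eta2_fls_eta_forms, of "nat (12 * n)"]
        monic_at_power[OF monic_at_eta2, of "nat (12 * n)"] by auto
  next
    case False
    thus ?thesis using eta_forms_power[OF eta2_inv_fls_eta_forms, of "nat (- (12 * n))"]
        monic_at_power[OF monic_at_eta2_inv, of "nat (- (12 * n))"] by auto
  qed
  moreover have "eta_forms (12 * n) (12 * n) = eta_forms (12 * n) 0"
    by (rule eta_forms_cong) (simp add: cong_0_iff)
  ultimately obtain D where D: "D \<in> eta_forms (12 * n) 0" "monic_at (12 * n) D" by auto
  have "A * D \<in> eta_forms (w - 12 * n + 12 * n) (0 + 0)" by (rule eta_forms_mult[OF A(1) D(1)])
  moreover have "monic_at (0 + 12 * n) (A * D)" by (rule monic_at_mult[OF A(2) D(2)])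
  ultimately show ?thesis by auto
qed

text \<open>The constant term of the product is \<open>f $$ n\<close> plus an integral combination
  of lower coefficients of \<open>f\<close>.\<close>

lemma constant_term_mult_monic:
  assumes g: "monic_at (- n) g" "g \<in> int_fls" and f: "\<And>i. i < n \<Longrightarrow> f $$ i \<in> int_multiples N"
    and 0: "(f * g) $$ 0 \<in> int_multiples N"
  shows "f $$ n \<in> int_multiples N"
proof (cases "fls_subdegree f \<le> n")
  case True
  have sg: "fls_subdegree g = - n" using g by (simp add: monic_at_def)
  have "{fls_subdegree f..n} = insert n {fls_subdegree f..<n}" using True by auto
  hence "(f * g) $$ 0 = f $$ n + (\<Sum>i=fls_subdegree f..<n. f $$ i * g $$ (- i))"
    unfolding fls_times_nth(2) sg using monic_atD(1)[OF g(1)] by simp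
  moreover have "(\<Sum>i=fls_subdegree f..<n. f $$ i * g $$ (- i)) \<in> int_multiples N"
    by (intro int_multiples_sum int_multiples_mult f int_flsD[OF g(2)]) simp
  ultimately show ?thesis using int_multiples_diff[OF 0] by fastforce
next
  case False
  thus ?thesis by simp
qed

text \<open>
  Duality: integral forms of weight \<open>w\<close> have the leading exponents \<open>n\<close> for which \<open>w - 12n\<close> is
  the weight of a form that does not vanish at infinity, and the remaining exponents are the
  pole orders of weakly holomorphic forms of weight \<open>2 - w\<close>.
\<close>

context
  fixes w :: int and N :: nat and F :: "complex fls"
  assumes w: "even w" and N: "N > 0"
    and F: "F \<in> int_fls" "\<And>n. n < 0 \<Longrightarrow> F $$ n = 0" "\<And>n. F $$ n \<noteq> 0 \<Longrightarrow> 12 dvd n"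
    and orth: "\<And>g. g \<in> eta_forms (2 - w) 0 \<Longrightarrow> (F * g) $$ 0 \<in> int_multiples N"
begin

text \<open>Both series have only exponents divisible by 12, so one more coefficient moves the bound
  by 12.\<close>

lemma congruent_step:
  assumes G: "G \<in> eta_forms w 0" and n: "\<And>i. i < 12 * n \<Longrightarrow> (F - G) $$ i \<in> int_multiples N"
    and c: "(F - G) $$ (12 * n) \<in> int_multiples N"
  shows "i < 12 * (n + 1) \<Longrightarrow> (F - G) $$ i \<in> int_multiples N"
proof -
  assume i: "i < 12 * (n + 1)"
  have "i < 12 * n \<or> i = 12 * n \<or> \<not> 12 dvd i" using i by presburger
  thus ?thesis
  proof (elim disjE)
    assume "\<not> 12 dvd i"
    hence "F $$ i = 0" "G $$ i = 0" using F(3)[of i] eta_formsD(3)[OF G, of i] by (auto simp: cong_0_iff)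
    thus ?thesis by simp
  qed (use n c in auto)
qed

text \<open>No monic form is available to correct this coefficient. But \<open>bad\<close> makes
  \<open>2 - w + 12 * n\<close> an admissible weight in \<open>monic_form\<close>, which gives a
  \<open>g\<close> of weight \<open>2 - w\<close> with a pole of exactly this order. As
  \<open>G * g\<close> has weight 2 and constant term 0, \<open>orth\<close> passes from
  \<open>F\<close> to \<open>F - G\<close>.\<close>

lemma congruent_pole:
  assumes G: "G \<in> eta_forms w 0" and n: "\<And>i. i < 12 * n \<Longrightarrow> (F - G) $$ i \<in> int_multiples N"
    and bad: "\<not> (w - 12 * n \<ge> 0 \<and> w - 12 * n \<noteq> 2)"
  shows "(F - G) $$ (12 * n) \<in> int_multiples N"
proof -
  have "(2 - w) - 12 * (- n) \<ge> 0" "(2 - w) - 12 * (- n) \<noteq> 2" using bad by presburger+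
  moreover have "even (2 - w)" using w by simp
  ultimately obtain g where g: "g \<in> eta_forms (2 - w) 0" "monic_at (12 * - n) g"
    using monic_form[of "2 - w" "- n"] by blast
  have "G * g \<in> eta_forms (w + (2 - w)) (0 + 0)" by (rule eta_forms_mult[OF G g(1)])
  hence "(G * g) $$ 0 = 0" using weight_2_constant_term[of "G * g"] by simp
  hence "((F - G) * g) $$ 0 = (F * g) $$ 0" by (simp add: algebra_simps)
  also have "\<dots> \<in> int_multiples N" by (rule orth[OF g(1)])
  finally have "((F - G) * g) $$ 0 \<in> int_multiples N" .
  thus ?thesis
    using constant_term_mult_monic[of "12 * n" g "F - G" N] g eta_formsD(1)[OF g(1)] n by auto
qed

text \<open>At an admissible exponent an integer multiple of a monic form is added, which leaves all
  lower coefficients alone; elsewhere \<open>congruent_pole\<close> shows that \<open>G\<close> is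
  already right.\<close>

lemma congruent_initial:
  "\<exists>G \<in> eta_forms w 0. (\<forall>i<0. G $$ i = 0) \<and> (\<forall>i < 12 * int n. (F - G) $$ i \<in> int_multiples N)"
proof (induction n)
  case 0
  show ?case using F(2) eta_forms_0 by (intro bexI[of _ 0]) auto
next
  case (Suc n)
  then obtain G where G: "G \<in> eta_forms w 0" "\<And>i. i < 0 \<Longrightarrow> G $$ i = 0"
    "\<And>i. i < 12 * int n \<Longrightarrow> (F - G) $$ i \<in> int_multiples N" by blast
  show ?case
  proof (cases "w - 12 * int n \<ge> 0 \<and> w - 12 * int n \<noteq> 2")
    case True
    then obtain f where f: "f \<in> eta_forms w 0" "monic_at (12 * int n) f"
      using monic_form[OF w, of "int n"] by blast
    have "(F - G) $$ (12 * int n) \<in> \<int>"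
      using F(1) eta_formsD(1)[OF G(1)] int_flsD by blast
    then obtain a where a: "(F - G) $$ (12 * int n) = of_int a" by (auto elim: Ints_cases)
    define G' where "G' = G + of_int a * f"
    have G': "G' \<in> eta_forms w 0"
      unfolding G'_def by (intro eta_forms_add eta_forms_of_int_mult G f)
    have nth: "G' $$ i = G $$ i + of_int a * f $$ i" for i
      by (simp add: G'_def fls_of_int_mult_nth)
    have low: "G' $$ i = G $$ i" if "i < 12 * int n" for i
      using monic_atD(2)[OF f(2) that] by (simp add: nth)
    have "(F - G') $$ (12 * int n) = (F - G) $$ (12 * int n) - of_int a * f $$ (12 * int n)"
      by (simp add: nth)
    hence "(F - G') $$ (12 * int n) = 0"
      unfolding a monic_atD(1)[OF f(2)] by simp
    hence "(F - G') $$ i \<in> int_multiples N" if "i < 12 * (int n + 1)" for i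
      using congruent_step[OF G', of "int n" i] G(3) low that by simp
    moreover have "G' $$ i = 0" if "i < 0" for i
      using low[of i] G(2)[of i] that by simp
    ultimately show ?thesis using G' by (intro bexI[of _ G']) (auto simp: algebra_simps)
  next
    case False
    have "(F - G) $$ i \<in> int_multiples N" if "i < 12 * (int n + 1)" for i
      by (rule congruent_step[OF G(1) G(3) congruent_pole[OF G(1) G(3) False] that])
    thus ?thesis using G by (intro bexI[of _ G]) (auto simp: algebra_simps)
  qed
qed

theorem congruent_to_form:
  "\<exists>G \<in> eta_forms w 0. (\<forall>i<0. G $$ i = 0) \<and> fls_cong N F G"
proof -
  \<comment> \<open>From here on \<open>w - 12 * n\<close> is negative, so
    \<open>congruent_pole\<close> settles all further coefficients with one fixed
    \<open>G\<close>.\<close>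
  define n0 where "n0 = nat w + 1"
  obtain G where G: "G \<in> eta_forms w 0" "\<And>i. i < 0 \<Longrightarrow> G $$ i = 0"
    "\<And>i. i < 12 * int n0 \<Longrightarrow> (F - G) $$ i \<in> int_multiples N" using congruent_initial[of n0] by blast
  have all: "i < 12 * (int n0 + int n) \<Longrightarrow> (F - G) $$ i \<in> int_multiples N" for n i
  proof (induction n arbitrary: i)
    case (Suc n)
    have bad: "\<not> (w - 12 * (int n0 + int n) \<ge> 0 \<and> w - 12 * (int n0 + int n) \<noteq> 2)"
      by (simp add: n0_def)
    have "i < 12 * (int n0 + int n + 1)" using Suc.prems by simp
    from congruent_step[OF G(1) Suc.IH congruent_pole[OF G(1) Suc.IH bad] this] show ?case .
  qed (use G(3) in simp)
  have "(F - G) $$ i \<in> int_multiples N" for i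
    by (rule all[of i "nat i + 1"]) (simp add: n0_def)
  hence "fls_cong N F G" using N by (intro fls_congI) auto
  thus ?thesis using G by blast
qed

end

subsection \<open>The congruence\<close>

text \<open>U and composition with the \<open>l\<close>th power are adjoint for the constant term
  pairing: both sides sum \<open>A $$ (l * n) * g $$ (- n)\<close>. This moves the operator from
  \<open>F\<close> to the test form.\<close>

lemma constant_term_U:
  assumes l: "l > 0"
  shows "(fls_U l A * g) $$ 0 = (A * fls_compose_power g l) $$ 0"
proof -
  have ct: "((\<lambda>i. f $$ i * h $$ (- i)) has_sum (f * h) $$ 0) UNIV" for f h :: "complex fls"
  proof -
    have "((\<lambda>i. f $$ i * h $$ (- i)) has_sum (f * h) $$ 0) {fls_subdegree f..0 - fls_subdegree h}"
      unfolding fls_times_nth(2) by (rule has_sum_finiteI) auto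
    also have "?this \<longleftrightarrow> ?thesis"
      by (rule has_sum_cong_neutral) (auto simp: not_le)
    finally show ?thesis .
  qed
  have "((\<lambda>i. A $$ i * fls_compose_power g l $$ (- i)) has_sum (A * fls_compose_power g l) $$ 0) UNIV"
    by (rule ct)
  also have "?this \<longleftrightarrow> ((\<lambda>i. A $$ i * fls_compose_power g l $$ (- i)) has_sum (A * fls_compose_power g l) $$ 0) (range (\<lambda>n. int l * n))"
    by (rule has_sum_cong_neutral) (use l in \<open>auto simp: fls_nth_compose_power\<close>)
  also have "\<dots> \<longleftrightarrow> ((\<lambda>n. A $$ (int l * n) * fls_compose_power g l $$ (- (int l * n))) has_sum (A * fls_compose_power g l) $$ 0) UNIV"
    by (rule has_sum_reindex_bij_betw[of "\<lambda>n. int l * n", symmetric])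
       (use l in \<open>auto simp: bij_betw_def inj_on_def\<close>)
  also have "(\<lambda>n. A $$ (int l * n) * fls_compose_power g l $$ (- (int l * n))) = (\<lambda>n. fls_U l A $$ n * g $$ (- n))"
  proof
    fix n
    have "- (int l * n) = int l * - n" by simp
    thus "A $$ (int l * n) * fls_compose_power g l $$ (- (int l * n)) = fls_U l A $$ n * g $$ (- n)"
      using l by (simp only: fls_nth_compose_power fls_U_nth dvd_triv_left if_True nonzero_mult_div_cancel_left)
  qed
  finally show ?thesis using ct[of "fls_U l A" g] has_sum_unique by blast
qed

text \<open>The operator preserves the weight, so in every step the U summand carries the same
  factor m^(1-k), a multiple of \<open>m ^ j\<close>. Only the multiplier exponent changes, by the
  factor \<open>m\<close>.\<close>

lemma iterated_hecke:
  assumes Y: "Y \<in> eta_forms k t" and m: "prime m" "coprime m 12" and k: "k \<le> 1 - int j"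
  shows "\<exists>h \<in> eta_forms k (int (m ^ i) * t). fls_cong (m ^ j) h (fls_compose_power Y (m ^ i))"
proof (induction i)
  case 0
  have "fls_compose_power Y 1 = Y" by (rule fls_eqI) (simp add: fls_nth_compose_power)
  thus ?case using Y by (intro bexI[of _ Y]) auto
next
  case (Suc i)
  have m0: "m > 0" using m(1) by (rule prime_gt_0_nat)
  obtain h where h: "h \<in> eta_forms k (int (m ^ i) * t)" "fls_cong (m ^ j) h (fls_compose_power Y (m ^ i))"
    using Suc by blast
  have k1: "k \<le> 1" using k by simp
  obtain \<epsilon> where B: "fls_compose_power h m + of_int (\<epsilon> * int m ^ nat (1 - k)) * fls_U m h \<in>
      eta_forms k (int m * (int (m ^ i) * t))" (is "?B \<in> _")
    using hecke[OF h(1) m k1] by blast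
  have "m ^ j dvd m ^ nat (1 - k)" using k by (intro le_imp_power_dvd) simp
  hence "fls_cong (m ^ j) ?B (fls_compose_power h m)"
    using fls_cong_0I[OF int_fls_U[OF m0 eta_formsD(1)[OF h(1)]], of "m ^ j" "m ^ nat (1 - k)"]
    by (simp only: of_nat_power)
  also have "fls_cong (m ^ j) \<dots> (fls_compose_power (fls_compose_power Y (m ^ i)) m)"
    by (rule fls_cong_compose_power[OF h(2) m0])
  also have "fls_compose_power (fls_compose_power Y (m ^ i)) m = fls_compose_power Y (m ^ Suc i)"
    using m0 by (simp only: fls_compose_power_compose zero_less_power power_Suc2)
  finally have "fls_cong (m ^ j) ?B (fls_compose_power Y (m ^ Suc i))" .
  thus ?case using B by (intro bexI[of _ ?B]) (simp_all add: mult.assoc)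
qed

text \<open>
  The weight of \<open>V\<^sub>l g\<close> would be far too large for the product with \<open>\<eta>\<^sup>2\<^sup>e\<close> to have weight at
  most 2. Multiplying \<open>g\<close> by \<open>\<eta>\<^sup>2\<^sup>s\<close> before the Hecke operators, and dividing by \<open>\<eta>\<^sup>2\<^sup>l\<^sup>s\<close> afterwards,
  lowers it.
\<close>
lemma constant_term_compose_eta_power:
  fixes m k s e n :: nat and w :: int
  assumes m: "prime m" "coprime m 12" and k: "k \<ge> 1"
    and s: "m ^ (k - 1) dvd s" "int s + int k + 1 \<le> w"
    and e: "12 dvd e"
    and weight: "int e + (int m - 1) * int (m ^ (k - 1)) * int n = w + int s * (int (m ^ k) - 1)"
    and g: "g \<in> eta_forms (2 - w) 0"
  shows "(fls_compose_power g (m ^ k) * eta2_fls ^ e) $$ 0 \<in> int_multiples (m ^ k)"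
proof -
  define l where "l = m ^ k"
  have m0: "m > 0" using m(1) by (rule prime_gt_0_nat)
  have l0: "l > 0" using m0 by (simp add: l_def)
  define Y where "Y = g * eta2_fls ^ s"
  have "Y \<in> eta_forms (2 - w + int s * 1) (0 + int s * 1)"
    unfolding Y_def by (intro eta_forms_mult eta_forms_power g eta2_fls_eta_forms)
  hence Y: "Y \<in> eta_forms (2 - w + int s) (int s)" by simp
  \<comment> \<open>This is the purpose of the upper bound on \<open>s\<close>: the weight of
    \<open>Y\<close> is low enough for the Hecke operators modulo \<open>m ^ k\<close>.\<close>
  have "2 - w + int s \<le> 1 - int k" using s(2) by simp
  from iterated_hecke[OF Y m this, of k] obtain h where
    h: "h \<in> eta_forms (2 - w + int s) (int l * int s)" "fls_cong l h (fls_compose_power Y l)"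
    unfolding l_def by blast
  obtain H where H: "H \<in> eta_forms ((int m - 1) * int (m ^ (k - 1))) 0" "fls_cong (m ^ Suc (k - 1)) H 1"
    using unit_form[OF m] by blast
  have Hl: "fls_cong l H 1" using H(2) k by (simp add: l_def)
  \<comment> \<open>By \<open>weight\<close> the weights of the four factors add up to exactly
    2.\<close>
  define Z where "Z = h * eta2_inv_fls ^ (l * s) * eta2_fls ^ e * H ^ n"
  have "Z \<in> eta_forms (2 - w + int s + int (l * s) * - 1 + int e * 1 + int n * ((int m - 1) * int (m ^ (k - 1))))
     (int l * int s + int (l * s) * - 1 + int e * 1 + int n * 0)"
    unfolding Z_def by (intro eta_forms_mult eta_forms_power h H eta2_fls_eta_forms eta2_inv_fls_eta_forms)
  also have "2 - w + int s + int (l * s) * - 1 + int e * 1 + int n * ((int m - 1) * int (m ^ (k - 1))) = 2"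
    using weight unfolding l_def[symmetric] by (simp add: algebra_simps)
  also have "int l * int s + int (l * s) * - 1 + int e * 1 + int n * 0 = int e" by simp
  also have "eta_forms 2 (int e) = eta_forms 2 0"
    by (rule eta_forms_cong) (use e in \<open>auto simp: cong_0_iff\<close>)
  finally have Z0: "Z $$ 0 = 0" by (rule weight_2_constant_term)
  \<comment> \<open>The factor \<open>m ^ (k - 1)\<close> of \<open>s\<close> lifts the Frobenius
    congruence for eta^2 from modulus \<open>m\<close> to \<open>m ^ k\<close>.\<close>
  obtain u where u: "s = m ^ (k - 1) * u" using s(1) by blast
  have "fls_cong l (fls_compose_power eta2_fls l ^ (m ^ (k - 1))) (eta2_fls ^ (l * m ^ (k - 1)))"
    using frobenius_prime_power[OF m(1) eta2_int, of "k - 1" k] k by (simp add: l_def)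
  hence "fls_cong l ((fls_compose_power eta2_fls l ^ (m ^ (k - 1))) ^ u) ((eta2_fls ^ (l * m ^ (k - 1))) ^ u)"
    by (rule fls_cong_power) (intro int_fls_power eta2_int)
  hence X: "fls_cong l (fls_compose_power eta2_fls l ^ s) (eta2_fls ^ (l * s))"
    by (simp only: u power_mult[symmetric] mult.assoc)
  have gi: "fls_compose_power g l \<in> int_fls" using eta_formsD(1)[OF g] by (rule int_fls_compose_power)
  have "fls_compose_power Y l = fls_compose_power g l * fls_compose_power eta2_fls l ^ s"
    using l0 by (simp add: Y_def)
  hence "fls_cong l (fls_compose_power Y l) (fls_compose_power g l * eta2_fls ^ (l * s))"
    by (simp only:) (intro fls_cong_mult X fls_cong_refl gi int_fls_power eta2_int)
  with h(2) have hg: "fls_cong l h (fls_compose_power g l * eta2_fls ^ (l * s))" by (rule fls_cong_trans)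
  have "fls_cong l Z (fls_compose_power g l * eta2_fls ^ (l * s) * eta2_inv_fls ^ (l * s) * eta2_fls ^ e * 1 ^ n)"
    unfolding Z_def
    by (intro fls_cong_mult fls_cong_power hg Hl fls_cong_refl gi int_fls_mult int_fls_power int_fls_1 eta2_int eta2_inv_int)
  also have "fls_compose_power g l * eta2_fls ^ (l * s) * eta2_inv_fls ^ (l * s) * eta2_fls ^ e * 1 ^ n =
     fls_compose_power g l * eta2_fls ^ e * (eta2_inv_fls ^ (l * s) * eta2_fls ^ (l * s))"
    by (simp add: mult_ac)
  also have "\<dots> = fls_compose_power g l * eta2_fls ^ e"
    unfolding eta2_inv_eta2_power by simp
  finally have "fls_cong l (fls_compose_power g l * eta2_fls ^ e) Z" by (rule fls_cong_sym)
  from fls_congD[OF this, of 0] show ?thesis unfolding Z0 l_def by simp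
qed

section \<open>Arithmetic of the weights\<close>

lemma odd_square_mod_4: "odd (a :: int) \<Longrightarrow> [a ^ 2 = 1] (mod 4)"
  by (elim oddE) (simp add: cong_iff_dvd_diff power2_eq_square algebra_simps)

lemma power_5_ge: "j \<ge> 1 \<Longrightarrow> 5 ^ j \<ge> int j + 4"
  by (induction j rule: dec_induct) auto

text \<open>Solves the weight balance of \<open>constant_term_compose_eta_power\<close> for its free
  parameters \<open>s\<close> and \<open>n\<close>. Equations are doubled throughout, since the
  weight and \<open>e\<close> are defined by halving.\<close>

lemma weight_arithmetic:
  assumes m: "prime m" "m \<ge> 5" and k: "k \<ge> 1" and r: "r \<ge> 1"
  defines "e \<equiv> r * (m ^ k * m ^ k - 1) div 2"
  obtains s n :: nat where "m ^ (k - 1) dvd s" "int s + int k + 1 \<le> weight m k r"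
    "int e + (int m - 1) * int (m ^ (k - 1)) * int n = weight m k r + int s * (int (m ^ k) - 1)"
    "even (weight m k r)"
proof -
  define L M a R where "L = int m ^ k" and "M = int m ^ (k - 1)" and "a = int m" and "R = int r"
  define w where "w = weight m k r"
  have "odd m" using m prime_odd_nat by auto
  hence oda: "odd a" by (simp add: a_def)
  have a5: "a \<ge> 5" using m by (simp add: a_def)
  have R1: "R \<ge> 1" using r by (simp add: R_def)
  have LM: "L = a * M" unfolding L_def M_def a_def using k by (cases k) auto
  have w2: "2 * w = (if odd k then (2 * L - M - 1) * R else (3 * L - 2 * M - 1) * R)"
    unfolding w_def L_def M_def R_def by (rule weight_exact) fact
  have odL: "odd L" and odM: "odd M" using oda by (auto simp: L_def M_def a_def)
  have M1: "M \<ge> 1" unfolding M_def using a5 by (simp add: a_def)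
  have "m ^ k * m ^ k \<ge> 1" using m by (simp add: Suc_leI)
  hence "int (m ^ k * m ^ k - 1) = L * L - 1" by (simp add: L_def of_nat_diff)
  moreover have "even (m ^ k * m ^ k - 1)" using \<open>odd m\<close> by simp
  hence "2 * e = r * (m ^ k * m ^ k - 1)" unfolding e_def by simp
  hence "2 * int e = int r * int (m ^ k * m ^ k - 1)" by (metis of_nat_mult of_nat_numeral)
  ultimately have e2: "2 * int e = R * (L * L - 1)" by (simp add: R_def)
  show ?thesis
  proof (cases "k = 1")
    case True
    have M: "M = 1" "L = a" using True by (simp_all add: M_def L_def a_def)
    \<comment> \<open>Here the balance holds with \<open>n = 0\<close>. The choice made for
      \<open>k \<ge> 2\<close> would violate \<open>s + k + 1 \<le> w\<close> when
      \<open>m = 5\<close> and \<open>r = 1\<close>.\<close>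
    define s where "s = r * ((m - 1) div 2)"
    have "2 * ((m - 1) div 2) = m - 1" using \<open>odd m\<close> by simp
    hence "2 * s = r * (m - 1)" by (simp add: s_def)
    hence "2 * int s = int r * int (m - 1)" by (metis of_nat_mult of_nat_numeral)
    hence s2: "2 * int s = R * (a - 1)" using m by (simp add: a_def R_def of_nat_diff)
    have w: "w = R * (a - 1)" using w2 True M by (simp add: algebra_simps)
    have "R * (a - 1) \<ge> 1 * 4" using R1 a5 by (intro mult_mono) auto
    hence "int s + int k + 1 \<le> w" using s2 True unfolding w by simp
    moreover have "2 * int e = 2 * (w + int s * (L - 1))"
    proof -
      have "2 * (w + int s * (L - 1)) = 2 * w + (2 * int s) * (L - 1)" by (simp add: algebra_simps)
      thus ?thesis unfolding s2 w e2 M by (simp add: algebra_simps)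
    qed
    hence "int e + (int m - 1) * int (m ^ (k - 1)) * int 0 = w + int s * (int (m ^ k) - 1)"
      by (simp add: L_def)
    moreover have "even w" using oda unfolding w by simp
    ultimately show ?thesis using True unfolding w_def by (intro that[of s 0]) auto
  next
    case False
    hence k2: "k \<ge> 2" using k by simp
    \<comment> \<open>With \<open>m - 1\<close> in place of \<open>m + 1\<close>, the number
      \<open>e\<close> would exceed \<open>w + s * (m ^ k - 1)\<close>, leaving no
      \<open>n \<ge> 0\<close>.\<close>
    define s where "s = r * m ^ (k - 1) * ((m + 1) div 2)"
    have "2 * ((m + 1) div 2) = m + 1" using \<open>odd m\<close> by simp
    moreover have "2 * s = r * m ^ (k - 1) * (2 * ((m + 1) div 2))" by (simp only: s_def mult_ac)
    ultimately have "2 * s = r * m ^ (k - 1) * (m + 1)" by (simp only:)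
    hence "2 * int s = int (r * m ^ (k - 1) * (m + 1))" by (metis of_nat_mult of_nat_numeral)
    hence s2: "2 * int s = R * M * (a + 1)" by (simp add: R_def M_def a_def algebra_simps)
    have M_ge: "M \<ge> int k + 3"
    proof -
      have "5 ^ (k - 1) \<ge> int (k - 1) + 4" using k2 by (intro power_5_ge) simp
      moreover have "5 ^ (k - 1) \<le> M" unfolding M_def using a5 by (intro power_mono) (auto simp: a_def)
      ultimately show ?thesis using k2 by simp
    qed
    have div: "2 * (a - 1) dvd a ^ 2 - 1"
    proof -
      have "2 * (a - 1) dvd (a + 1) * (a - 1)" using oda by (intro mult_dvd_mono) auto
      also have "(a + 1) * (a - 1) = a ^ 2 - 1" by (simp add: algebra_simps power2_eq_square)
      finally show ?thesis .
    qed
    have cong1: "[a ^ (2 * i) = 1] (mod 2 * (a - 1))" for i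
      using cong_pow[of "a ^ 2" 1 "2 * (a - 1)" i] div by (simp add: cong_iff_dvd_diff power_mult)
    \<comment> \<open>Chosen so that \<open>2 * (w + s * (L - 1) - e) = R * M * B\<close>. Modulo
      \<open>2 * (a - 1)\<close> the square of \<open>a\<close> is 1, so \<open>L\<close> is
      \<open>a\<close> for odd \<open>k\<close> and 1 for even \<open>k\<close>; in both cases
      \<open>B\<close> becomes \<open>2 * a - 2\<close>, that is 0.\<close>
    define B where "B = (if odd k then L + a - 2 else L + 2 * a - 3)"
    have "a * M \<ge> 5 * 1" using M1 a5 by (intro mult_mono) auto
    hence B_pos: "B \<ge> 0" using a5 LM by (auto simp: B_def)
    have "2 * (a - 1) dvd B"
    proof (cases "odd k")
      case True
      then obtain i where "k = 2 * i + 1" by (elim oddE)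
      hence "L = a ^ (2 * i) * a" by (simp add: L_def a_def)
      moreover have "[a ^ (2 * i) * a = 1 * a] (mod 2 * (a - 1))" by (intro cong_mult cong1 cong_refl)
      ultimately have "2 * (a - 1) dvd L - a" by (simp add: cong_iff_dvd_diff)
      hence "2 * (a - 1) dvd (L - a) + 2 * (a - 1)" by (intro dvd_add) auto
      thus ?thesis using True by (simp add: B_def algebra_simps)
    next
      case False
      hence "even k" by simp
      then obtain i where "k = 2 * i" by (rule evenE)
      hence "L = a ^ (2 * i)" by (simp add: L_def a_def)
      hence "2 * (a - 1) dvd L - 1" using cong1[of i] by (simp add: cong_iff_dvd_diff)
      hence "2 * (a - 1) dvd (L - 1) + 2 * (a - 1)" by (intro dvd_add) auto
      thus ?thesis using False by (simp add: B_def algebra_simps)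
    qed
    then obtain q where q: "B = 2 * (a - 1) * q" by blast
    have "q \<ge> 0" using B_pos a5 unfolding q by (simp add: zero_le_mult_iff)
    define n where "n = r * nat q"
    have n2: "2 * (a - 1) * int n = R * B" using \<open>q \<ge> 0\<close> by (simp add: n_def R_def q)
    have id: "2 * (int e + (a - 1) * M * int n) = 2 * (w + int s * (L - 1))"
    proof -
      have "2 * (int e + (a - 1) * M * int n) = 2 * int e + M * (2 * (a - 1) * int n)"
        by (simp add: algebra_simps)
      also have "\<dots> = R * (L * L - 1) + M * (R * B)" unfolding e2 n2 ..
      also have "\<dots> = 2 * w + (2 * int s) * (L - 1)"
        unfolding w2 s2 B_def LM by (simp add: algebra_simps)
      finally show ?thesis by (simp add: algebra_simps)
    qed
    have "2 * w - 2 * int s \<ge> 2 * (int k + 1)"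
    proof -
      have "2 * w - 2 * int s = R * (if odd k then M * (a - 2) - 1 else M * (2 * a - 3) - 1)"
        unfolding w2 s2 LM by (simp add: algebra_simps)
      moreover have "M * (a - 2) \<ge> M * 3" "M * (2 * a - 3) \<ge> M * 3" using M1 a5 by (intro mult_left_mono; simp)+
      hence "(if odd k then M * (a - 2) - 1 else M * (2 * a - 3) - 1) \<ge> 3 * M - 1" by auto
      hence "R * (if odd k then M * (a - 2) - 1 else M * (2 * a - 3) - 1) \<ge> 1 * (3 * M - 1)"
        using R1 M1 by (intro mult_mono) auto
      ultimately show ?thesis using M_ge by simp
    qed
    hence le: "int s + int k + 1 \<le> w" by simp
    \<comment> \<open>For evenness of the weight: \<open>M\<close> is an odd square for odd
      \<open>k\<close>, and \<open>L\<close> is one for even \<open>k\<close>.\<close>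
    have "4 dvd (if odd k then 2 * L - M - 1 else 3 * L - 2 * M - 1)"
    proof (cases "odd k")
      case True
      then obtain i where "k - 1 = i * 2" by (auto elim!: oddE)
      hence "M = (a ^ i) ^ 2" by (simp add: M_def a_def power_mult)
      hence "[M = 1] (mod 4)" using odd_square_mod_4[of "a ^ i"] oda by simp
      thus ?thesis using True odL unfolding cong_iff_dvd_diff by presburger
    next
      case False
      then obtain i where "k = i * 2" by (auto elim!: evenE)
      hence "L = (a ^ i) ^ 2" by (simp add: L_def a_def power_mult)
      hence "[L = 1] (mod 4)" using odd_square_mod_4[of "a ^ i"] oda by simp
      thus ?thesis using False odM unfolding cong_iff_dvd_diff by presburger
    qed
    hence "4 dvd (if odd k then 2 * L - M - 1 else 3 * L - 2 * M - 1) * R" by simp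
    hence "4 dvd 2 * w" unfolding w2 by (simp split: if_splits)
    hence even: "even w" by presburger
    have "m ^ (k - 1) dvd s" by (simp add: s_def)
    moreover have "int e + (int m - 1) * int (m ^ (k - 1)) * int n = w + int s * (int (m ^ k) - 1)"
      using id by (simp add: a_def M_def L_def)
    ultimately show ?thesis using le even unfolding w_def by (intro that[of s n])
  qed
qed

section \<open>The q-expansion of the eta quotient\<close>

lemma dvd_24_square:
  assumes "coprime (m :: nat) 12"
  shows "24 dvd m ^ k * m ^ k - 1"
proof -
  have "[(m * m) ^ k = 1 ^ k] (mod 24)" by (intro cong_pow square_mod_24(2) assms)
  hence "[m ^ k * m ^ k = 1] (mod 24)" by (simp add: power_mult_distrib)
  thus ?thesis by (rule cong_to_1_nat)
qed

text \<open>With \<open>l = m ^ k\<close>, the power of \<open>fps_X\<close> collects q^(l l/24) and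
  q^(-1/24), raised to \<open>r\<close>. The division by 24 is exact for \<open>m\<close> prime to
  12.\<close>

definition eta_quotient_fps :: "nat \<Rightarrow> nat \<Rightarrow> nat \<Rightarrow> complex fps" where
  "eta_quotient_fps m k r = fps_X ^ (r * ((m ^ k * m ^ k - 1) div 24)) *
     fps_compose euler_fps (fps_X ^ (m ^ k)) ^ (m ^ k * r) * inverse euler_fps ^ r"

lemma coprime_12_prime:
  assumes "prime m" "m \<ge> (5 :: nat)"
  shows "coprime m 12"
proof -
  have "\<not> m dvd 12"
  proof
    assume "m dvd 12"
    hence "m \<le> 12" by (rule dvd_imp_le) simp
    hence "m \<in> {5..12}" using assms by simp
    also have "{5..12} = {5, 6, 7, 8, 9, 10, 11, 12 :: nat}" by auto
    finally show False using \<open>m dvd 12\<close> assms(1) by auto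
  qed
  thus ?thesis using assms(1) by (simp add: prime_imp_coprime)
qed

lemma fps_to_fls_compose_euler:
  assumes "l > 0"
  shows "fps_to_fls (fps_compose euler_fps (fps_X ^ l)) = fls_compose_power (fps_to_fls euler_fps) l"
  using assms by (simp add: fls_compose_power_fps_to_fls)

lemma has_q_expansion_eta_quotient:
  assumes m: "prime m" "m \<ge> 5"
  shows "has_q_expansion (eta_quotient m k r) (eta_quotient_fps m k r)"
  unfolding has_q_expansion_def
proof
  fix z assume "z \<in> upper_half_plane"
  hence z: "Im z > 0" by simp
  define l where "l = m ^ k"
  define q where "q = nome z"
  define E where "E = fps_compose euler_fps (fps_X ^ l)"
  define t where "t = (l * l - 1) div 24"
  have l0: "l > 0" using m by (simp add: l_def)
  have t: "24 * t = l * l - 1" "l * l \<ge> 1"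
    using dvd_24_square[OF coprime_12_prime[OF m], of k] l0 by (auto simp: t_def l_def)
  have q: "norm q < 1" "0 < norm q"
    using norm_nome_less[OF z] by (auto simp: q_def nome_def)
  have ql: "norm (q ^ l) < 1" using q l0 by (simp add: norm_power power_less_one_iff)
  have er: "fls_conv_radius (fps_to_fls euler_fps) \<ge> 1" using euler_fps_conv_radius by simp
  have rE: "fps_conv_radius E \<ge> 1"
    using fls_conv_radius_compose_power[OF er l0] unfolding E_def fps_to_fls_compose_euler[OF l0, symmetric] by simp
  have rad: "ereal (norm q) < R" if "R \<ge> 1" for R
    using q(1) that by (meson ereal_less(3) less_le_trans)
  have evE: "eval_fps E q = euler_fun (q ^ l)"
  proof -
    have "eval_fps E q = eval_fls (fps_to_fls E) q" using rad[OF rE] by (simp add: eval_fps_to_fls)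
    also have "\<dots> = eval_fls (fps_to_fls euler_fps) (q ^ l)"
      unfolding E_def fps_to_fls_compose_euler[OF l0] by (rule eval_fls_compose_power[OF er l0 q(2,1)])
    also have "\<dots> = eval_fps euler_fps (q ^ l)"
      using ql euler_fps_conv_radius by (intro eval_fps_to_fls) (meson ereal_less(3) less_le_trans)
    finally show ?thesis using eval_euler_fps[OF ql] by simp
  qed
  have radii: "fps_conv_radius (fps_X ^ (r * t) :: complex fps) \<ge> 1" "fps_conv_radius (E ^ (l * r)) \<ge> 1"
      "fps_conv_radius (inverse euler_fps ^ r) \<ge> 1"
    using rE fps_conv_radius_inverse_euler fps_conv_radius_power order_trans by (simp, blast, blast)
  have fq: "eta_quotient_fps m k r = fps_X ^ (r * t) * E ^ (l * r) * inverse euler_fps ^ r"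
    by (simp add: eta_quotient_fps_def E_def t_def l_def)
  have r12: "fps_conv_radius (fps_X ^ (r * t) * E ^ (l * r)) \<ge> 1"
    by (intro fps_conv_radius_mult_ge radii)
  have r123: "fps_conv_radius (eta_quotient_fps m k r) \<ge> 1"
    unfolding fq by (intro fps_conv_radius_mult_ge r12 radii)
  have "eval_fps (eta_quotient_fps m k r) q = q ^ (r * t) * euler_fun (q ^ l) ^ (l * r) * inverse (euler_fun q) ^ r"
    unfolding fq using q rE fps_conv_radius_inverse_euler
    by (simp add: eval_fps_mult rad[OF r12] rad[OF radii(1)] rad[OF radii(2)] rad[OF radii(3)]
          eval_fps_power_1 evE eval_inverse_euler)
  also have "\<dots> = eta_quotient m k r z"
  proof -
    \<comment> \<open>All fractional powers of q are powers of this one 24th root;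
      \<open>x ^ (l * l) = x * q ^ t\<close> then removes it from the quotient.\<close>
    define x where "x = exp (2 * of_real pi * \<i> * z / 24)"
    have x0: "x \<noteq> 0" by (simp add: x_def)
    have qx: "q = x ^ 24" unfolding q_def nome_def x_def exp_of_nat_mult[symmetric] by (simp add: mult_ac)
    have eta: "dedekind_eta z = x * euler_fun q"
      by (simp add: dedekind_eta_def euler_fun_def x_def q_def)
    have "exp (2 * of_real pi * \<i> * (of_nat l * z) / 24) = x ^ l"
      unfolding x_def exp_of_nat_mult[symmetric] by (simp add: mult_ac)
    hence etal: "dedekind_eta (of_nat l * z) = x ^ l * euler_fun (q ^ l)"
      by (simp add: dedekind_eta_def euler_fun_def q_def nome_power)
    have "x ^ (l * l) = x * q ^ t"
    proof -
      have "l * l = 1 + 24 * t" using t by simp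
      thus ?thesis by (simp add: qx power_add power_mult)
    qed
    hence "(x ^ l) ^ l / x = q ^ t" using x0 by (simp add: power_mult)
    hence "(x ^ l * euler_fun (q ^ l)) ^ l / (x * euler_fun q) = q ^ t * euler_fun (q ^ l) ^ l * inverse (euler_fun q)"
      by (simp add: power_mult_distrib divide_inverse mult_ac)
    hence "eta_quotient m k r z = (q ^ t * euler_fun (q ^ l) ^ l * inverse (euler_fun q)) ^ r"
      unfolding eta_quotient_def l_def[symmetric] eta etal by simp
    also have "\<dots> = q ^ (r * t) * euler_fun (q ^ l) ^ (l * r) * inverse (euler_fun q) ^ r"
      by (simp add: power_mult_distrib power_mult mult.commute[of r t])
    finally show ?thesis ..
  qed
  finally have "eval_fps (eta_quotient_fps m k r) q = eta_quotient m k r z" .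
  with sums_eval_fps[OF rad[OF r123]]
  show "(\<lambda>n. fps_nth (eta_quotient_fps m k r) n * nome z ^ n) sums eta_quotient m k r z"
    by (simp add: q_def)
qed

theorem theorem3p3:
  fixes m k r :: nat
  assumes "prime m" and "m \<ge> 5" and "k \<ge> 1" and "r \<ge> 1"
  shows "\<exists>G \<in> modular_forms (weight m k r).
    fps_cong (m ^ k) (U_op (m ^ k) (q_expansion (eta_quotient m k r))) (q_expansion G)"
proof -
  note m = \<open>prime m\<close> coprime_12_prime[OF assms(1,2)]
  define l where "l = m ^ k"
  define w where "w = weight m k r"
  \<comment> \<open>The exponent for which \<open>eta2_fls ^ e\<close> is the
    \<open>r * (l * l - 1)\<close>th power of eta.\<close>
  define e where "e = r * (l * l - 1) div 2"
  define f where "f = eta_quotient_fps m k r"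
  define P where "P = fls_compose_power (fps_to_fls euler_fps) 12"
  define P' where "P' = fls_compose_power (fps_to_fls (inverse euler_fps)) 12"
  define f12 where "f12 = fls_compose_power (fps_to_fls f) 12"
  have m0: "m > 0" using m(1) by (rule prime_gt_0_nat)
  have l0: "l > 0" using m0 by (simp add: l_def)
  have "24 dvd l * l - 1" unfolding l_def by (rule dvd_24_square[OF m(2)])
  then obtain t where t: "l * l - 1 = 24 * t" by blast
  have e_eq: "e = 12 * (r * ((l * l - 1) div 24))" unfolding e_def t by simp
  have e_eq': "2 * e + r = l * l * r"
  proof -
    have "l * l = 24 * t + 1" using t l0 by (metis Suc_diff_1 Suc_eq_plus1 nat_0_less_mult_iff)
    thus ?thesis by (simp add: e_def t algebra_simps)
  qed
  obtain s n where sn: "m ^ (k - 1) dvd s" "int s + int k + 1 \<le> w"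
    "int e + (int m - 1) * int (m ^ (k - 1)) * int n = w + int s * (int (m ^ k) - 1)"
    and even: "even w"
    unfolding w_def e_def l_def using weight_arithmetic[OF assms] by metis
  have Pint: "P \<in> int_fls" "P' \<in> int_fls"
    unfolding P_def P'_def
    by (intro int_fls_compose_power fps_to_fls_int_fls euler_fps_nth_Ints fps_inverse_nth_Ints euler_fps_nth_0)+
  have PP': "P * P' = 1"
  proof -
    have "euler_fps * inverse euler_fps = 1"
      using inverse_mult_eq_1[of euler_fps] euler_fps_nth_0 by (simp add: mult.commute)
    hence "fps_to_fls euler_fps * fps_to_fls (inverse euler_fps) = 1"
      by (simp flip: fls_times_fps_to_fls)
    thus ?thesis unfolding P_def P'_def by (simp flip: fls_compose_power_mult)
  qed
  have f12: "f12 = fls_X ^ e * fls_compose_power P l ^ (l * r) * P' ^ r"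
  proof -
    have X: "fls_compose_power fls_X 12 = (fls_X ^ 12 :: complex fls)"
      by (simp add: fls_X_conv_shift_1 fls_shift_power)
    have "fls_compose_power (fls_compose_power (fps_to_fls euler_fps) l) 12 = fls_compose_power P l"
      unfolding P_def using l0 by (simp add: fls_compose_power_compose mult.commute)
    moreover have "fps_to_fls f = fls_X ^ (r * ((l * l - 1) div 24)) *
        fls_compose_power (fps_to_fls euler_fps) l ^ (l * r) * fps_to_fls (inverse euler_fps) ^ r"
      unfolding f_def eta_quotient_fps_def l_def[symmetric]
      by (simp only: fls_times_fps_to_fls fps_to_fls_power fps_to_fls_compose_euler[OF l0] fps_X_to_fls)
    ultimately have "f12 = (fls_X ^ 12) ^ (r * ((l * l - 1) div 24)) * fls_compose_power P l ^ (l * r) * P' ^ r"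
      by (simp add: f12_def X P'_def)
    thus ?thesis by (simp only: e_eq power_mult)
  qed
  have eta2_e: "eta2_fls ^ e = fls_X ^ e * P ^ (2 * e)"
  proof -
    have eq: "eta2_fls = fls_X * P ^ 2"
      by (simp add: eta2_fls_def P_def fps_to_fls_power fls_X_times_conv_shift)
    show ?thesis unfolding eq power_mult by (rule power_mult_distrib)
  qed
  have cong: "fls_cong l f12 (eta2_fls ^ e)"
  proof -
    \<comment> \<open>The exponent \<open>l = m ^ k\<close> lifts the Frobenius congruence up to
      \<open>m ^ Suc k\<close>, one power more than the modulus \<open>l\<close> to which it is then
      reduced.\<close>
    have "fls_cong (m ^ Suc k) (fls_compose_power P l ^ l) (P ^ (l * l))"
      unfolding l_def by (rule frobenius_prime_power[OF m(1) Pint(1)])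
    hence "fls_cong l (fls_compose_power P l ^ l) (P ^ (l * l))"
      by (rule fls_cong_dvd) (simp add: l_def)
    hence "fls_cong l ((fls_compose_power P l ^ l) ^ r) ((P ^ (l * l)) ^ r)"
      by (rule fls_cong_power) (intro int_fls_power Pint)
    moreover have "fls_X \<in> int_fls" by (auto simp: int_fls_def)
    ultimately have "fls_cong l f12 (fls_X ^ e * (P ^ (l * l)) ^ r * P' ^ r)"
      unfolding f12 power_mult by (intro fls_cong_mult fls_cong_refl int_fls_power int_fls_mult Pint)
    also have "(P ^ (l * l)) ^ r = P ^ (2 * e) * P ^ r"
      by (simp only: power_mult[symmetric] power_add[symmetric] e_eq')
    also have "fls_X ^ e * (P ^ (2 * e) * P ^ r) * P' ^ r = fls_X ^ e * P ^ (2 * e) * (P * P') ^ r"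
      by (simp only: power_mult_distrib mult_ac)
    also have "\<dots> = eta2_fls ^ e" by (simp add: PP' eta2_e)
    finally show ?thesis .
  qed
  define F where "F = fls_U l f12"
  have f12_int: "f12 \<in> int_fls" using fls_cong_int[OF cong int_fls_power[OF eta2_int]] .
  have f12_nth: "f12 $$ i = (if 12 dvd i then fps_to_fls f $$ (i div 12) else 0)" for i
    by (simp add: f12_def fls_nth_compose_power)
  have F_int: "F \<in> int_fls" unfolding F_def by (rule int_fls_U[OF l0 f12_int])
  have F_neg: "F $$ i = 0" if "i < 0" for i
  proof -
    have "int l * i < 0" using that l0 by (simp add: mult_pos_neg)
    hence "int l * i div 12 < 0" by simp
    thus ?thesis unfolding F_def fls_U_nth[OF l0] f12_nth by simp
  qed
  \<comment> \<open>U is applied to exponents of q^(1/12); since \<open>l\<close> is prime to 12,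
    the result is still a series in q.\<close>
  have F_12: "12 dvd i" if "F $$ i \<noteq> 0" for i
  proof -
    have "12 dvd int l * i"
      using that unfolding F_def fls_U_nth[OF l0] f12_nth by (simp split: if_splits)
    moreover have "coprime (int l) (int 12)"
      unfolding coprime_int_iff l_def using m(2) by simp
    hence "coprime 12 (int l)" by (simp add: coprime_commute)
    ultimately show ?thesis by (simp add: coprime_dvd_mult_right_iff)
  qed
  have orth: "(F * g) $$ 0 \<in> int_multiples l" if g: "g \<in> eta_forms (2 - w) 0" for g
  proof -
    have gi: "fls_compose_power g l \<in> int_fls" using eta_formsD(1)[OF g] by (rule int_fls_compose_power)
    have "(F * g) $$ 0 = (fls_compose_power g l * f12) $$ 0"
      unfolding F_def constant_term_U[OF l0] by (simp add: mult.commute)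
    moreover have "fls_cong l (fls_compose_power g l * f12) (fls_compose_power g l * eta2_fls ^ e)"
      by (intro fls_cong_mult cong fls_cong_refl gi int_fls_power eta2_int)
    note fls_congD[OF this, of 0]
    moreover have "(fls_compose_power g l * eta2_fls ^ e) $$ 0 \<in> int_multiples l"
      unfolding l_def using constant_term_compose_eta_power[OF m assms(3) sn(1,2) _ sn(3) g] e_eq by simp
    ultimately show ?thesis using int_multiples_add by (metis diff_add_cancel)
  qed
  obtain G where G: "G \<in> eta_forms w 0" "\<And>i. i < 0 \<Longrightarrow> G $$ i = 0" "fls_cong l F G"
    using congruent_to_form[OF even l0 F_int F_neg F_12 orth] by blast
  define Gq where "Gq = Abs_fps (\<lambda>n. G $$ (12 * int n))"
  have Gexp: "has_q_expansion (ev G) Gq"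
    unfolding has_q_expansion_def
  proof
    fix z assume "z \<in> upper_half_plane"
    hence z: "Im z > 0" by simp
    have "((\<lambda>n. G $$ n * q12 z powi n) has_sum ev G z) UNIV"
      by (rule has_sum_ev[OF eta_formsD(2)[OF G(1)] z])
    also have "?this \<longleftrightarrow> ((\<lambda>n. G $$ n * q12 z powi n) has_sum ev G z) (range (\<lambda>n. 12 * int n))"
    proof (rule has_sum_cong_neutral)
      fix i assume i: "i \<in> UNIV - range (\<lambda>n. 12 * int n)"
      have "G $$ i = 0"
      proof (rule ccontr)
        assume nz: "G $$ i \<noteq> 0"
        hence "12 dvd i" using eta_formsD(3)[OF G(1) nz] by (simp add: cong_0_iff)
        moreover have "i \<ge> 0" using G(2)[of i] nz by force
        ultimately have "i = 12 * int (nat (i div 12))" by simp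
        thus False using i by blast
      qed
      thus "G $$ i * q12 z powi i = 0" by simp
    qed auto
    also have "\<dots> \<longleftrightarrow> ((\<lambda>n. G $$ (12 * int n) * q12 z powi (12 * int n)) has_sum ev G z) UNIV"
      by (rule has_sum_reindex_bij_betw[of "\<lambda>n. 12 * int n", symmetric]) (auto simp: bij_betw_def inj_on_def)
    finally have "(\<lambda>n. G $$ (12 * int n) * q12 z powi (12 * int n)) sums ev G z"
      by (rule has_sum_imp_sums)
    moreover have "q12 z powi (12 * int n) = nome z ^ n" for n
      using power_int_mult[of "q12 z" 12 "int n"] by (simp add: q12_nome)
    ultimately show "(\<lambda>n. fps_nth Gq n * nome z ^ n) sums ev G z" by (simp add: Gq_def)
  qed
  have "ev G \<in> modular_forms w"
    unfolding modular_forms_def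
  proof (intro CollectI conjI allI impI ballI)
    show "ev G holomorphic_on upper_half_plane"
      using holomorphic_ev[OF eta_formsD(2)[OF G(1)]] by (simp add: upper_half_plane_def)
    show "\<exists>F. has_q_expansion (ev G) F" using Gexp by blast
    fix a b c d :: int and z assume "a * d - b * c = 1" "z \<in> upper_half_plane"
    thus "ev G ((of_int a * z + of_int b) / (of_int c * z + of_int d)) =
           (of_int c * z + of_int d) powi w * ev G z"
      using ev_transforms[OF G(1)] by (simp add: transforms_def)
  qed
  moreover have "fps_cong l (U_op l (q_expansion (eta_quotient m k r))) (q_expansion (ev G))"
  proof -
    have q: "q_expansion h = H" if "has_q_expansion h H" for h H
      unfolding q_expansion_def using that has_q_expansion_unique by (intro the_equality)
    show ?thesis unfolding q[OF Gexp] q[OF has_q_expansion_eta_quotient[OF assms(1,2)]] fps_cong_def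
    proof
      fix n
      have 1: "fps_nth (U_op l f) n = F $$ (12 * int n)"
      proof -
        have "int l * (12 * int n) = 12 * int (l * n)" by simp
        thus ?thesis unfolding F_def fls_U_nth[OF l0] f12_nth U_op_def by (simp del: of_nat_mult)
      qed
      obtain a where a: "F $$ (12 * int n) = of_int a"
        using int_flsD[OF F_int] by (rule Ints_cases)
      obtain b where b: "G $$ (12 * int n) = of_int b"
        using int_flsD[OF eta_formsD(1)[OF G(1)]] by (rule Ints_cases)
      note ab = a b
      obtain c where "of_int a - of_int b = (of_nat l * of_int c :: complex)"
        using fls_congD[OF G(3), of "12 * int n"] unfolding ab by (auto simp: int_multiples_def)
      hence "(of_int (a - b) :: complex) = of_int (int l * c)" by simp
      hence "a - b = int l * c" by (simp only: of_int_eq_iff)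
      hence "[a = b] (mod int l)" by (simp add: cong_iff_dvd_diff)
      thus "\<exists>a b. fps_nth (U_op l (eta_quotient_fps m k r)) n = of_int a \<and> fps_nth Gq n = of_int b \<and> [a = b] (mod int l)"
        using 1 ab unfolding f_def Gq_def by auto
    qed
  qed
  ultimately show ?thesis unfolding w_def l_def by blast
qed

end
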